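(* Let $R>0$ and consider the generalized $H(\mathrm{div})$ geodesic problem on the torus $M=T^2_{1,R}=S^1_1\times S^1_R$ with coupling $\boldsymbol{\gamma}=[(\mathrm{Id},1),(h,\sqrt{|\mathrm{Jac}(h)|})]_\#\rho_0$, where in polar coordinates $h:(\theta,\phi)\in\mathbb{R}^2/(2\pi\mathbb{Z})^2\mapsto(\theta+\pi,\phi+\pi)\in\mathbb{R}^2/(2\pi\mathbb{Z})^2$, and $\rho_0=(2\pi)^{-2}\mathrm{d}\theta\,\mathrm{d}\phi$. Then the dynamic plan $$\boldsymbol{\mu}^*=\tfrac12(\mathrm{Id},\zeta^0)_\#\rho_0+\tfrac12(\psi^1,\zeta^1)_\#\rho_0,$$ with $$\zeta^0_t(\theta,\phi)=\sqrt2\sin(\sqrt{P^*}t),\quad \zeta^1_t(\theta,\phi)=\sqrt2|\cos(\sqrt{P^*}t)|,\quad \psi^1_t(\theta,\phi)=\begin{cases}(\theta,\phi)& t\le T/2,\\ (\theta+\pi,\phi+\pi)& t>T/2,\end{cases}$$ where $P^*=(\pi/T)^2$, is a minimizer, whereas the (dynamic plan induced by the) constant speed rotation $(t,\theta,\phi)\mapsto(\theta+\pi t/T,\phi+\pi t/T)$ is not a minimizer. Moreover, if $R$ is sufficiently large, no smooth flow can be a minimizer, i.e. there is no smooth curve $t\in[0,T]\mapsto\varphi_t\in\mathrm{Diff}(M)$ with $\varphi_0=\mathrm{Id}$, $\varphi_T=h$ such that $(\varphi,\sqrt{|\mathrm{Jac}(\varphi)|})_\#\rho_0$ is a minimizer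.
   Context: Setting. $S^1_R=\mathbb{R}/2\pi R\mathbb{Z}$ is the circle of radius $R$; $M=S^1_1\times S^1_R$ is the flat torus, described by polar coordinates $(\theta,\phi)\in\mathbb{R}^2/(2\pi\mathbb{Z})^2$ corresponding to arc-length coordinates $(\theta,R\phi)$, so that the metric is $g=\mathrm{d}\theta^2+R^2\mathrm{d}\phi^2$. $\mathrm{Diff}(M)$ is the group of smooth diffeomorphisms of $M$ and $T>0$ is fixed. $\mathcal{C}=(M\times\mathbb{R}_{\ge0})/(M\times\{0\})$ is the cone over $M$, with points $[x,r]$ and apex $o=[x,0]$. Fix $\bar x\in M$; $\pi_x([x,r])=x$ if $r>0$, $\pi_x(o)=\bar x$, $\pi_r([x,r])=r$. The cone carries the metric tensor $g_{\mathcal{C}}=r^2g+\mathrm{d}r^2$ on $M\times\mathbb{R}_{>0}$ and the distance $d_{\mathcal{C}}([x_1,r_1],[x_2,r_2])^2=r_1^2+r_2^2-2r_1r_2\cos(\min(d_M(x_1,x_2),\pi))$, with $d_M$ the geodesic distance on $M$. $\Omega=C^0([0,T];\mathcal{C})$ is the space of continuous paths $\mathrm{z}:t\mapsto z_t=[x_t,r_t]$, with $x_t=\pi_x(z_t)$, $r_t=\pi_r(z_t)$. $AC^2([0,T];\mathcal{C})$ is the set of absolutely continuous paths whose metric derivative is in $L^2$; for such paths $|\dot z_t|^2_{g_{\mathcal{C}}}=r_t^2|\dot x_t|^2+\dot r_t^2$ where $r_t>0$ and the derivatives exist, and $0$ otherwise. $\mathcal{A}(\mathrm{z})=\int_0^T|\dot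 z_t|^2_{g_{\mathcal{C}}}\mathrm{d}t$ if $\mathrm{z}\in AC^2([0,T];\mathcal{C})$, $+\infty$ otherwise; $\mathcal{A}(\boldsymbol{\mu})=\int_\Omega\mathcal{A}(\mathrm{z})\,\mathrm{d}\boldsymbol{\mu}(\mathrm{z})$. A function $f:\mathcal{C}^2\to\mathbb{R}$ is 2-homogeneous if $f([x_1,\lambda r_1],[x_2,\lambda r_2])=\lambda^2f([x_1,r_1],[x_2,r_2])$ for all $\lambda>0$. Generalized $H(\mathrm{div})$ geodesic problem: given $\boldsymbol{\gamma}\in\mathcal{P}_2(\mathcal{C}^2)$ (Borel probability measures with finite second moment), minimize $\mathcal{A}(\boldsymbol{\mu})$ among dynamic plans $\boldsymbol{\mu}\in\mathcal{P}(\Omega)$ satisfying the homogeneous coupling constraint $\int_\Omega f(z_0,z_T)\,\mathrm{d}\boldsymbol{\mu}=\int_{\mathcal{C}^2}f\,\mathrm{d}\boldsymbol{\gamma}$ for all 2-homogeneous continuous $f:\mathcal{C}^2\to\mathbb{R}$, and the homogeneous marginal constraint $\int_\Omega\int_0^Tf(t,x_t)r_t^2\,\mathrm{d}t\,\mathrm{d}\boldsymbol{\mu}=\int_M\int_0^Tf(t,x)\,\mathrm{d}t\,\mathrm{d}\rho_0$ for all $f\in C^0([0,T]\times M)$. For time-dependent maps $\varphi_t:M\to M$, $\lambda_t:M\to\mathbb{R}_{\ge0}$ such that $t\mapsto[\varphi_t(x),\lambda_t(x)]$ is a continuous path in $\mathcal{C}$, $(\varphi,\lambda)_\#\rho_0\in\mathcal{P}(\Omega)$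 is the push-forward of $\rho_0$ under $x\mapsto(t\mapsto[\varphi_t(x),\lambda_t(x)])$. The dynamic plan induced by a smooth flow $\varphi$ is $(\varphi,\sqrt{|\mathrm{Jac}(\varphi)|})_\#\rho_0$, with $\mathrm{Jac}(\varphi_t)$ the Jacobian determinant. $[(\mathrm{Id},1),(h,\sqrt{|\mathrm{Jac}(h)|})]_\#\rho_0$ is the push-forward of $\rho_0$ under $x\mapsto([x,1],[h(x),\sqrt{|\mathrm{Jac}(h)(x)|}])$. *)

theory Defs
  imports "HOL-Probability.Probability"
begin

section \<open>The flat torus\<close>

definition period_rel :: "real^2 \<Rightarrow> real^2 \<Rightarrow> bool" where
  "period_rel p q \<longleftrightarrow> (\<forall>i. \<exists>k::int. p $ i - q $ i = 2 * pi * of_int k)"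

text \<open>
  The torus is described in the polar coordinates \<open>(\<theta>, \<phi>)\<close>, i.e. as the quotient of the plane
  by the lattice of all vectors whose entries are integer multiples of \<open>2 * pi\<close>. The radius \<open>R\<close>
  enters through the metric tensor only. The covering projection is \<open>torus_of\<close>.
\<close>

quotient_type torus = "real^2" / period_rel
  morphisms rep_torus torus_of
proof (rule equivpI)
  show "reflp period_rel"
    by (auto simp: reflp_def period_rel_def intro: exI[of _ 0])
  show "symp period_rel"
  proof (rule sympI)
    fix p q :: "real^2" assume pq: "period_rel p q"
    show "period_rel q p"
      unfolding period_rel_def
    proof
      fix i
      from pq obtain k :: int where "p $ i - q $ i = 2 * pi * of_int k"
        unfolding period_rel_def by blast
      then have "q $ i - p $ i = 2 * pi * of_int (- k)" by simp
      then show "\<exists>k::int. q $ i - p $ i = 2 * pi * of_int k" by blast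
    qed
  qed
  show "transp period_rel"
  proof (rule transpI)
    fix p q r :: "real^2" assume pq: "period_rel p q" and qr: "period_rel q r"
    show "period_rel p r"
      unfolding period_rel_def
    proof
      fix i
      from pq obtain k :: int where k: "p $ i - q $ i = 2 * pi * of_int k"
        unfolding period_rel_def by blast
      from qr obtain l :: int where l: "q $ i - r $ i = 2 * pi * of_int l"
        unfolding period_rel_def by blast
      from k l have "p $ i - r $ i = 2 * pi * of_int (k + l)"
        by (simp add: distrib_left)
      then show "\<exists>k::int. p $ i - r $ i = 2 * pi * of_int k" by blast
    qed
  qed
qed

instantiation torus :: topological_space
begin

definition open_torus :: "torus set \<Rightarrow> bool" where
  "open_torus U \<longleftrightarrow> open (torus_of -` U)"

instance
  by standard (auto simp: open_torus_def vimage_Union vimage_Int)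

end

lift_definition torus_shift :: "real^2 \<Rightarrow> torus \<Rightarrow> torus" is "\<lambda>a p. p + a"
  by (simp add: period_rel_def)

text \<open>Functions on the cone must not be lifted through the torus quotient a second time.\<close>

lifting_forget torus.lifting

definition rho0 :: "torus measure" where
  "rho0 = distr (density lborel (\<lambda>p. ennreal (1 / (2 * pi)\<^sup>2) * indicator (cbox 0 (vec (2 * pi))) p))
            borel torus_of"

text \<open>The squared length of a tangent vector for \<open>d\<theta>\<^sup>2 + R\<^sup>2 d\<phi>\<^sup>2\<close>.\<close>

definition gnorm2 :: "real \<Rightarrow> real^2 \<Rightarrow> real" where
  "gnorm2 R v = (v $ 1)\<^sup>2 + R\<^sup>2 * (v $ 2)\<^sup>2"

definition curve_length :: "real \<Rightarrow> (real \<Rightarrow> real^2) \<Rightarrow> real" where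
  "curve_length R c = integral {0..1} (\<lambda>t. sqrt (gnorm2 R (vector_derivative c (at t))))"

text \<open>
  Geodesic distance: infimum of the lengths of the joining curves. A curve on the torus is given
  by a lift to the plane, where its length can be computed.
\<close>

definition torus_dist :: "real \<Rightarrow> torus \<Rightarrow> torus \<Rightarrow> real" where
  "torus_dist R x y = Inf {curve_length R c | c.
     c C1_differentiable_on {0..1} \<and> torus_of (c 0) = x \<and> torus_of (c 1) = y}"

section \<open>Smooth maps, diffeomorphisms and Jacobians\<close>

text \<open>
  Derivatives are taken within \<open>S\<close>, so that smoothness up to the boundary makes sense. Below,
  \<open>S\<close> is relatively open in the whole space or in \<open>{0..T} \<times> UNIV\<close>, where derivatives within
  \<open>S\<close> are unique. For a finite-dimensional domain, demanding that all directional derivatives be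
  \<open>C\<^sup>k\<close> is the same as demanding that the derivative be \<open>C\<^sup>k\<close>.
\<close>

primrec Ck_on :: "nat \<Rightarrow> 'a::euclidean_space set \<Rightarrow> ('a \<Rightarrow> 'b::real_normed_vector) \<Rightarrow> bool" where
  "Ck_on 0 S f \<longleftrightarrow> continuous_on S f"
| "Ck_on (Suc k) S f \<longleftrightarrow>
     (\<exists>f'. (\<forall>x\<in>S. (f has_derivative f' x) (at x within S)) \<and> (\<forall>v. Ck_on k S (\<lambda>x. f' x v)))"

definition smooth_on :: "'a::euclidean_space set \<Rightarrow> ('a \<Rightarrow> 'b::real_normed_vector) \<Rightarrow> bool" where
  "smooth_on S f \<longleftrightarrow> (\<forall>k. Ck_on k S f)"

text \<open>
  Local inverses of \<open>torus_of\<close> are the charts of the torus; a map is smooth if it is smooth in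
  these charts, i.e. has smooth local lifts to the plane.
\<close>

definition torus_smooth :: "(torus \<Rightarrow> torus) \<Rightarrow> bool" where
  "torus_smooth f \<longleftrightarrow> (\<forall>p. \<exists>U F. open U \<and> p \<in> U \<and> smooth_on U F \<and>
     (\<forall>q\<in>U. torus_of (F q) = f (torus_of q)))"

definition torus_Diff :: "(torus \<Rightarrow> torus) set" where
  "torus_Diff = {f. bij f \<and> torus_smooth f \<and> torus_smooth (inv f)}"

text \<open>Smooth curves in the diffeomorphism group are smooth jointly in time and space.\<close>

definition smooth_Diff_curve :: "real \<Rightarrow> (real \<Rightarrow> torus \<Rightarrow> torus) \<Rightarrow> bool" where
  "smooth_Diff_curve T \<phi> \<longleftrightarrow> (\<forall>t\<in>{0..T}. \<phi> t \<in> torus_Diff) \<and>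
     (\<forall>t\<in>{0..T}. \<forall>p. \<exists>U F. open U \<and> (t, p) \<in> U \<and> smooth_on (U \<inter> ({0..T} \<times> UNIV)) F \<and>
        (\<forall>s q. (s, q) \<in> U \<inter> ({0..T} \<times> UNIV) \<longrightarrow> torus_of (F (s, q)) = \<phi> s (torus_of q)))"

text \<open>
  The Jacobian determinant in the coordinates \<open>(\<theta>, \<phi>)\<close>; it is the same in the arc-length
  coordinates \<open>(\<theta>, R \<phi>)\<close>, source and target being rescaled alike.
\<close>

definition torus_Jac :: "(torus \<Rightarrow> torus) \<Rightarrow> torus \<Rightarrow> real" where
  "torus_Jac f x = (THE d. \<exists>p F D. torus_of p = x \<and>
     (\<forall>\<^sub>F q in nhds p. torus_of (F q) = f (torus_of q)) \<and>
     (F has_derivative D) (at p) \<and> d = det (matrix D))"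

section \<open>The cone\<close>

definition cone_rel :: "torus \<times> real \<Rightarrow> torus \<times> real \<Rightarrow> bool" where
  "cone_rel a b \<longleftrightarrow> 0 \<le> snd a \<and> 0 \<le> snd b \<and> (a = b \<or> snd a = 0 \<and> snd b = 0)"

text \<open>The relation is partial: only pairs with nonnegative radius represent points.\<close>

quotient_type cone = "torus \<times> real" / partial: cone_rel
  morphisms rep_cone abs_cone
proof (rule part_equivpI)
  show "\<exists>a. cone_rel a a" by (rule exI[of _ "(undefined, 0)"]) (simp add: cone_rel_def)
  show "symp cone_rel" by (auto intro!: sympI simp: cone_rel_def)
  show "transp cone_rel" by (auto intro!: transpI simp: cone_rel_def)
qed

text \<open>The point \<open>[x, r]\<close>; to be used for \<open>r \<ge> 0\<close> only.\<close>

definition cone_pt :: "torus \<Rightarrow> real \<Rightarrow> cone" where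
  "cone_pt x r = abs_cone (x, r)"

lift_definition apex :: cone is "(undefined, 0)"
  by (simp add: cone_rel_def)

lift_definition cone_r :: "cone \<Rightarrow> real" is snd
  by (auto simp: cone_rel_def)

text \<open>The first argument is the value assigned to the apex.\<close>

lift_definition cone_x :: "torus \<Rightarrow> cone \<Rightarrow> torus" is
  "\<lambda>xbar (x, r). if r > 0 then x else xbar"
  by (auto simp: cone_rel_def)

lift_definition cone_dist :: "real \<Rightarrow> cone \<Rightarrow> cone \<Rightarrow> real" is
  "\<lambda>R (x1, r1) (x2, r2).
     sqrt (r1\<^sup>2 + r2\<^sup>2 - 2 * r1 * r2 * cos (min (torus_dist R x1 x2) pi))"
  by (auto simp: cone_rel_def)

definition cone_metric :: "real \<Rightarrow> cone metric" where
  "cone_metric R = metric (UNIV, cone_dist R)"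

abbreviation cone_top :: "real \<Rightarrow> cone topology" where
  "cone_top R \<equiv> mtopology_of (cone_metric R)"

definition borel_of_top :: "'a topology \<Rightarrow> 'a measure" where
  "borel_of_top X = sigma (topspace X) {U. openin X U}"

abbreviation cone2_borel :: "real \<Rightarrow> (cone \<times> cone) measure" where
  "cone2_borel R \<equiv> borel_of_top (prod_topology (cone_top R) (cone_top R))"

definition P2_cone2 :: "real \<Rightarrow> (cone \<times> cone) measure set" where
  "P2_cone2 R = {\<gamma>. sets \<gamma> = sets (cone2_borel R) \<and> prob_space \<gamma> \<and>
     (\<integral>\<^sup>+w. ennreal ((cone_dist R (fst w) apex)\<^sup>2 + (cone_dist R (snd w) apex)\<^sup>2) \<partial>\<gamma>) < \<infinity>}"

definition two_homogeneous :: "(cone \<times> cone \<Rightarrow> real) \<Rightarrow> bool" where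
  "two_homogeneous f \<longleftrightarrow> (\<forall>x1 r1 x2 r2 l. 0 \<le> r1 \<longrightarrow> 0 \<le> r2 \<longrightarrow> 0 < l \<longrightarrow>
     f (cone_pt x1 (l * r1), cone_pt x2 (l * r2)) = l\<^sup>2 * f (cone_pt x1 r1, cone_pt x2 r2))"

section \<open>Paths on the cone and their action\<close>

text \<open>
  The space of continuous paths with the supremum distance. Its elements are functions on the
  reals that are undefined outside \<open>[0, T]\<close>.
\<close>

definition path_metric :: "real \<Rightarrow> real \<Rightarrow> (real \<Rightarrow> cone) metric" where
  "path_metric R T = cfunspace (top_of_set {0..T}) (cone_metric R)"

abbreviation path_borel :: "real \<Rightarrow> real \<Rightarrow> (real \<Rightarrow> cone) measure" where
  "path_borel R T \<equiv> borel_of_top (mtopology_of (path_metric R T))"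

text \<open>Absolute continuity in a metric space: the distance is controlled by an integrable density.\<close>

definition abs_cont_path :: "real \<Rightarrow> real \<Rightarrow> (real \<Rightarrow> cone) \<Rightarrow> bool" where
  "abs_cont_path R T z \<longleftrightarrow> (\<exists>m. set_integrable lborel {0..T} m \<and>
     (\<forall>s t. 0 \<le> s \<longrightarrow> s \<le> t \<longrightarrow> t \<le> T \<longrightarrow>
        cone_dist R (z s) (z t) \<le> (LINT u:{s..t}|lborel. m u)))"

definition metric_deriv :: "real \<Rightarrow> real \<Rightarrow> (real \<Rightarrow> cone) \<Rightarrow> real \<Rightarrow> real" where
  "metric_deriv R T z t =
     Lim (at t within {0..T}) (\<lambda>s. cone_dist R (z s) (z t) / \<bar>s - t\<bar>)"

definition AC2 :: "real \<Rightarrow> real \<Rightarrow> (real \<Rightarrow> cone) set" where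
  "AC2 R T = {z \<in> mspace (path_metric R T). abs_cont_path R T z \<and>
     (\<integral>\<^sup>+t\<in>{0..T}. ennreal ((metric_deriv R T z t)\<^sup>2) \<partial>lborel) < \<infinity>}"

text \<open>The velocity of a path on the torus, computed from a local lift to the plane.\<close>

definition torus_has_velocity :: "real \<Rightarrow> (real \<Rightarrow> torus) \<Rightarrow> real^2 \<Rightarrow> real \<Rightarrow> bool" where
  "torus_has_velocity T x v t \<longleftrightarrow> (\<exists>c. torus_of (c t) = x t \<and>
     (\<forall>\<^sub>F s in at t within {0..T}. torus_of (c s) = x s) \<and>
     (c has_vector_derivative v) (at t within {0..T}))"

definition speed2 :: "real \<Rightarrow> real \<Rightarrow> torus \<Rightarrow> (real \<Rightarrow> cone) \<Rightarrow> real \<Rightarrow> real" where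
  "speed2 R T xbar z t =
     (let x = (\<lambda>s. cone_x xbar (z s)); r = (\<lambda>s. cone_r (z s)) in
      if r t > 0 \<and> (\<exists>v. torus_has_velocity T x v t) \<and> r differentiable (at t within {0..T})
      then (r t)\<^sup>2 * gnorm2 R (THE v. torus_has_velocity T x v t)
             + (vector_derivative r (at t within {0..T}))\<^sup>2
      else 0)"

definition path_action :: "real \<Rightarrow> real \<Rightarrow> torus \<Rightarrow> (real \<Rightarrow> cone) \<Rightarrow> ennreal" where
  "path_action R T xbar z =
     (if z \<in> AC2 R T then (\<integral>\<^sup>+t\<in>{0..T}. ennreal (speed2 R T xbar z t) \<partial>lborel) else \<infinity>)"

section \<open>The generalized H(div) geodesic problem\<close>

definition dynamic_plans :: "real \<Rightarrow> real \<Rightarrow> (real \<Rightarrow> cone) measure set" where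
  "dynamic_plans R T = {\<mu>. sets \<mu> = sets (path_borel R T) \<and> prob_space \<mu>}"

definition plan_action :: "real \<Rightarrow> real \<Rightarrow> torus \<Rightarrow> (real \<Rightarrow> cone) measure \<Rightarrow> ennreal" where
  "plan_action R T xbar \<mu> = (\<integral>\<^sup>+z. path_action R T xbar z \<partial>\<mu>)"

text \<open>
  In both constraints the left-hand integrals are required to exist, since the Bochner integral
  of a non-integrable function is \<open>0\<close>.
\<close>

definition coupling_constraint ::
    "real \<Rightarrow> real \<Rightarrow> (cone \<times> cone) measure \<Rightarrow> (real \<Rightarrow> cone) measure \<Rightarrow> bool" where
  "coupling_constraint R T \<gamma> \<mu> \<longleftrightarrow>
     (\<forall>f. continuous_map (prod_topology (cone_top R) (cone_top R)) euclideanreal f \<and>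
          two_homogeneous f \<longrightarrow>
        integrable \<mu> (\<lambda>z. f (z 0, z T)) \<and>
        (LINT z|\<mu>. f (z 0, z T)) = (LINT w|\<gamma>. f w))"

definition marginal_constraint :: "real \<Rightarrow> torus \<Rightarrow> (real \<Rightarrow> cone) measure \<Rightarrow> bool" where
  "marginal_constraint T xbar \<mu> \<longleftrightarrow>
     (\<forall>f :: real \<times> torus \<Rightarrow> real. continuous_on ({0..T} \<times> UNIV) f \<longrightarrow>
        integrable \<mu> (\<lambda>z. LINT t:{0..T}|lborel. f (t, cone_x xbar (z t)) * (cone_r (z t))\<^sup>2) \<and>
        (LINT z|\<mu>. (LINT t:{0..T}|lborel. f (t, cone_x xbar (z t)) * (cone_r (z t))\<^sup>2))
          = (LINT x|rho0. (LINT t:{0..T}|lborel. f (t, x))))"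

definition admissible_plans ::
    "real \<Rightarrow> real \<Rightarrow> torus \<Rightarrow> (cone \<times> cone) measure \<Rightarrow> (real \<Rightarrow> cone) measure set" where
  "admissible_plans R T xbar \<gamma> =
     {\<mu> \<in> dynamic_plans R T. coupling_constraint R T \<gamma> \<mu> \<and> marginal_constraint T xbar \<mu>}"

definition is_minimizer ::
    "real \<Rightarrow> real \<Rightarrow> torus \<Rightarrow> (cone \<times> cone) measure \<Rightarrow> (real \<Rightarrow> cone) measure \<Rightarrow> bool" where
  "is_minimizer R T xbar \<gamma> \<mu> \<longleftrightarrow> \<mu> \<in> admissible_plans R T xbar \<gamma> \<and>
     (\<forall>\<nu> \<in> admissible_plans R T xbar \<gamma>. plan_action R T xbar \<mu> \<le> plan_action R T xbar \<nu>)"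

definition push_plan ::
    "real \<Rightarrow> real \<Rightarrow> (real \<Rightarrow> torus \<Rightarrow> torus) \<Rightarrow> (real \<Rightarrow> torus \<Rightarrow> real) \<Rightarrow> (real \<Rightarrow> cone) measure" where
  "push_plan R T \<phi> l = distr rho0 (path_borel R T) (\<lambda>x. \<lambda>t\<in>{0..T}. cone_pt (\<phi> t x) (l t x))"

definition flow_plan :: "real \<Rightarrow> real \<Rightarrow> (real \<Rightarrow> torus \<Rightarrow> torus) \<Rightarrow> (real \<Rightarrow> cone) measure" where
  "flow_plan R T \<phi> = push_plan R T \<phi> (\<lambda>t x. sqrt \<bar>torus_Jac (\<phi> t) x\<bar>)"

definition coupling_of :: "real \<Rightarrow> (torus \<Rightarrow> torus) \<Rightarrow> (cone \<times> cone) measure" where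
  "coupling_of R h =
     distr rho0 (cone2_borel R) (\<lambda>x. (cone_pt x 1, cone_pt (h x) (sqrt \<bar>torus_Jac h x\<bar>)))"

definition half_sum :: "'a measure \<Rightarrow> 'a measure \<Rightarrow> 'a measure" where
  "half_sum \<mu> \<nu> = measure_of (space \<mu>) (sets \<mu>) (\<lambda>A. emeasure \<mu> A / 2 + emeasure \<nu> A / 2)"

section \<open>The half-turn and the explicit plan\<close>

definition half_turn :: "torus \<Rightarrow> torus" where
  "half_turn = torus_shift (vec pi)"

definition Pstar :: "real \<Rightarrow> real" where
  "Pstar T = (pi / T)\<^sup>2"

definition zeta0 :: "real \<Rightarrow> real \<Rightarrow> torus \<Rightarrow> real" where
  "zeta0 T t x = sqrt 2 * sin (sqrt (Pstar T) * t)"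

definition zeta1 :: "real \<Rightarrow> real \<Rightarrow> torus \<Rightarrow> real" where
  "zeta1 T t x = sqrt 2 * \<bar>cos (sqrt (Pstar T) * t)\<bar>"

definition psi1 :: "real \<Rightarrow> real \<Rightarrow> torus \<Rightarrow> torus" where
  "psi1 T t x = (if t \<le> T / 2 then x else torus_shift (vec pi) x)"

definition mu_star :: "real \<Rightarrow> real \<Rightarrow> (real \<Rightarrow> cone) measure" where
  "mu_star R T = half_sum (push_plan R T (\<lambda>t. id) (zeta0 T)) (push_plan R T (psi1 T) (zeta1 T))"

definition rotation :: "real \<Rightarrow> real \<Rightarrow> torus \<Rightarrow> torus" where
  "rotation T t = torus_shift (vec (pi * t / T))"

end

theory Submission
  imports Defs
begin

text \<open>
  Averaging the 2-homogeneous function \<open>2 (r\<^sub>0\<^sup>2 + r\<^sub>T\<^sup>2) - d\<^sup>2 \<ge> 0\<close> shows that almost every path of an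
  admissible plan joins antipodal points \<open>[x, r]\<close> and \<open>[y, r]\<close>, at distance at least \<open>pi\<close> on the torus.
  Mapping such a path to the plane, with polar angle \<open>min (d\<^sub>M(x\<^sub>0, x\<^sub>t)) pi\<close>, does not increase lengths
  and makes it antiperiodic, so Wirtinger's inequality bounds its action below by \<open>P\<^sup>* \<integral> r\<^sup>2\<close>. The marginal
  constraint makes this \<open>P\<^sup>* T = pi\<^sup>2 / T\<close> on average, which is the action of the explicit plan.
  A flow never visits the apex, and its paths project to curves of length greater than \<open>pi\<close>, the
  distance from \<open>x\<close> to its half-turn; slowing the angle down by a constant factor still gives an
  antiperiodic planar path, so the inequality is strict.

  The bound on the action goes through the energies of inscribed chains: they are continuous on
  path space, whereas the integrand of the action is not known to be measurable, and Wirtinger's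
  inequality is then needed for finite sums only.
\<close>

section \<open>Absolutely continuous functions of one variable\<close>

text \<open>The action is defined by pointwise derivatives of \<open>cone_x\<close> and
  \<open>cone_r\<close>, for paths known only to be absolutely continuous in the cone distance. A
  lower bound has to show that these derivatives exist almost everywhere and control the metric
  increments; otherwise the default value 0 of \<open>speed2\<close> could hide motion. Real
  Lipschitz functions on the cone (the radius, the components of \<open>cone_proj\<close>, distances
  to fixed nodes) reduce this to Lebesgue differentiation on the line.

  The coupling constraint tests only 2-homogeneous functions of the endpoints, so it does not fix
  the endpoint radii; what it enforces is antiperiodicity. The lowest eigenvalue of the negative
  second derivative on [0, T] under antiperiodic conditions is (pi / T)^2, which is where
  \<open>Pstar\<close> comes from. The explicit plan is built from the corresponding eigenfunctions
  sin and cos, whose squares add up to a constant, as the marginal constraint demands.\<close>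

lemma emeasure_half_sum:
  assumes "sets \<nu> = sets \<mu>" "A \<in> sets \<mu>"
  shows "emeasure (half_sum \<mu> \<nu>) A = emeasure \<mu> A / 2 + emeasure \<nu> A / 2"
  unfolding half_sum_def
proof (rule emeasure_measure_of_sigma)
  show "sigma_algebra (space \<mu>) (sets \<mu>)" ..
  show "positive (sets \<mu>) (\<lambda>A. emeasure \<mu> A / 2 + emeasure \<nu> A / 2)"
    by (simp add: positive_def)
  show "countably_additive (sets \<mu>) (\<lambda>A. emeasure \<mu> A / 2 + emeasure \<nu> A / 2)"
  proof (rule countably_additiveI)
    fix B :: "nat \<Rightarrow> _" assume B: "range B \<subseteq> sets \<mu>" "disjoint_family B"
    have "(\<Sum>i. emeasure \<mu> (B i) / 2 + emeasure \<nu> (B i) / 2) =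
        (\<Sum>i. emeasure \<mu> (B i)) / 2 + (\<Sum>i. emeasure \<nu> (B i)) / 2"
      unfolding divide_ennreal_def
      by (subst suminf_add[symmetric]) (simp_all only: ennreal_suminf_multc summableI)
    then show "(\<Sum>i. emeasure \<mu> (B i) / 2 + emeasure \<nu> (B i) / 2) =
        emeasure \<mu> (\<Union>i. B i) / 2 + emeasure \<nu> (\<Union>i. B i) / 2"
      using B assms(1) by (simp add: suminf_emeasure)
  qed
qed fact

lemma sets_half_sum [simp]: "sets (half_sum \<mu> \<nu>) = sets \<mu>"
  and space_half_sum [simp]: "space (half_sum \<mu> \<nu>) = space \<mu>"
  unfolding half_sum_def by (simp_all add: sets.space_closed)

text \<open>A covering estimate: outer regularity encloses A in an open V of small \<nu>-measure,
  the Vitali lemma extracts disjoint balls inside V, and the length of each of them is at most 2 /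
  \<epsilon> times its \<nu>-measure.\<close>

lemma negligible_upper_density_pos:
  fixes A :: "real set"
  assumes "finite_measure \<nu>" and sets: "sets \<nu> = sets borel"
    and A: "A \<in> sets borel" "emeasure \<nu> A = 0" and "\<epsilon> > 0"
  shows "negligible {u\<in>A. \<forall>\<delta>>0. \<exists>h. 0 < h \<and> h < \<delta> \<and> measure \<nu> (cball u h) > \<epsilon> * h}"
    (is "negligible ?N0")
proof -
  define N where "N = ?N0"
  have "negligible N"
    unfolding negligible_outer_le
  proof (intro allI impI)
    fix e :: real assume "e > 0"
    interpret finite_measure \<nu> by fact
    \<comment> \<open>The 10 anticipates the Vitali enlargement: \<open>cball u (5 * h)\<close> has
      length 10 h, which is below 10 / \<epsilon> times the \<nu>-measure of
      \<open>cball u h\<close>.\<close>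
    have "(INF U \<in> {U. A \<subseteq> U \<and> open U}. emeasure \<nu> U) < ennreal (e * \<epsilon> / 10)"
      using outer_regular[OF sets, of A] A emeasure_finite \<open>e > 0\<close> \<open>\<epsilon> > 0\<close>
      by (simp add: emeasure_eq_measure)
    then obtain V where V: "A \<subseteq> V" "open V" "emeasure \<nu> V < ennreal (e * \<epsilon> / 10)"
      by (auto simp: INF_less_iff)
    then have mV: "measure \<nu> V < e * \<epsilon> / 10"
      using \<open>e > 0\<close> \<open>\<epsilon> > 0\<close> by (simp add: emeasure_eq_measure ennreal_less_iff)
    define K where "K = {(u, h). u \<in> N \<and> 0 < h \<and> h < 1 \<and> cball u h \<subseteq> V \<and> measure \<nu> (cball u h) > \<epsilon> * h}"
    have "N \<subseteq> (\<Union>i\<in>K. cball (fst i) (snd i))"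
    proof
      fix u assume u: "u \<in> N"
      then obtain d where d: "d > 0" "cball u d \<subseteq> V"
        using V open_contains_cball unfolding N_def by blast
      from d(1) have "0 < min d 1" by simp
      with u obtain h where h: "0 < h" "h < min d 1" "measure \<nu> (cball u h) > \<epsilon> * h"
        unfolding N_def by blast
      have "cball u h \<subseteq> V" using h(2) d(2) by (meson less_imp_le min.strict_boundedE subset_cball subset_trans)
      with u h have K: "(u, h) \<in> K" unfolding K_def by simp
      show "u \<in> (\<Union>i\<in>K. cball (fst i) (snd i))"
        by (rule UN_I[OF K]) (use h in simp)
    qed
    then obtain C where C: "countable C" "C \<subseteq> K"
       "pairwise (\<lambda>i j. disjnt (cball (fst i) (snd i)) (cball (fst j) (snd j))) C"
       "N \<subseteq> (\<Union>i\<in>C. cball (fst i) (5 * snd i))"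
    proof (rule Vitali_covering_lemma_cballs[where B=1])
      show "0 < snd i \<and> snd i \<le> 1" if "i \<in> K" for i
        using that unfolding K_def by (cases i) simp
    qed
    have bound: "measure lebesgue (\<Union>i\<in>I. cball (fst i) (5 * snd i)) \<le> e"
      if I: "I \<subseteq> C" "finite I" for I
    proof -
      have "measure lebesgue (\<Union>i\<in>I. cball (fst i) (5 * snd i))
          \<le> (\<Sum>i\<in>I. measure lebesgue (cball (fst i) (5 * snd i)))"
        by (rule measure_UNION_le) (use I in auto)
      also have "\<dots> \<le> (\<Sum>i\<in>I. 10 / \<epsilon> * measure \<nu> (cball (fst i) (snd i)))"
      proof (rule sum_mono)
        fix i assume "i \<in> I"
        then have "0 < snd i" "measure \<nu> (cball (fst i) (snd i)) > \<epsilon> * snd i"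
          using I C(2) by (auto simp: K_def)
        then show "measure lebesgue (cball (fst i) (5 * snd i)) \<le> 10 / \<epsilon> * measure \<nu> (cball (fst i) (snd i))"
          using \<open>\<epsilon> > 0\<close> by (simp add: cball_eq_atLeastAtMost field_simps)
      qed
      also have "\<dots> = 10 / \<epsilon> * measure \<nu> (\<Union>i\<in>I. cball (fst i) (snd i))"
      proof -
        have "disjoint_family_on (\<lambda>i. cball (fst i) (snd i)) I"
          using C(3) I unfolding disjoint_family_on_def pairwise_def disjnt_def by blast
        then show ?thesis
          by (subst finite_measure_finite_Union) (use I sets in \<open>auto simp: sum_distrib_left\<close>)
      qed
      also have "\<dots> \<le> 10 / \<epsilon> * measure \<nu> V"
        using I C(2) \<open>\<epsilon> > 0\<close> V(2) sets
        by (intro mult_left_mono finite_measure_mono) (fastforce simp: K_def)+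
      also have "\<dots> \<le> e"
        using mV \<open>\<epsilon> > 0\<close> by (simp add: field_simps)
      finally show ?thesis .
    qed
    have "(\<Union>i\<in>C. cball (fst i) (5 * snd i)) \<in> lmeasurable"
      by (rule fmeasurable_UN_bound[OF C(1) _ bound]) auto
    moreover have "measure lebesgue (\<Union>i\<in>C. cball (fst i) (5 * snd i)) \<le> e"
      by (rule measure_UN_bound[OF C(1) _ bound]) auto
    ultimately show "\<exists>T. N \<subseteq> T \<and> T \<in> lmeasurable \<and> measure lebesgue T \<le> e"
      using C(4) by blast
  qed
  then show ?thesis by (simp add: N_def)
qed

section \<open>Differentiation of indefinite integrals\<close>

lemma set_integrable_of_integrable:
  fixes f :: "real \<Rightarrow> real"
  shows "integrable lborel f \<Longrightarrow> S \<in> sets borel \<Longrightarrow> set_integrable lborel S f"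
  unfolding set_integrable_def by (rule integrable_mult_indicator) simp_all

lemma integrable_max_diff_indicator:
  fixes p :: "real \<Rightarrow> real"
  assumes "integrable lborel p"
  shows "integrable lborel (\<lambda>u. indicator {a..b} u * max 0 (p u - r))"
proof (rule Bochner_Integration.integrable_bound)
  show "integrable lborel (\<lambda>u. \<bar>p u\<bar> + \<bar>r\<bar> * indicator {a..b} u)"
    using assms by (intro Bochner_Integration.integrable_add integrable_abs integrable_mult_right integrable_real_indicator) (auto simp: emeasure_lborel_Icc_eq)
  show "(\<lambda>u. indicator {a..b} u * max 0 (p u - r)) \<in> borel_measurable lborel"
    using borel_measurable_integrable[OF assms] by measurable
qed (auto simp: indicator_def)

lemma measure_density_LINT:
  fixes q :: "real \<Rightarrow> real"
  assumes q: "integrable lborel q" "\<And>u. 0 \<le> q u" and S: "S \<in> sets borel"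
  shows "measure (density lborel (\<lambda>u. ennreal (q u))) S = (LINT u:S|lborel. q u)"
    and "emeasure (density lborel (\<lambda>u. ennreal (q u))) S = ennreal (LINT u:S|lborel. q u)"
proof -
  have "emeasure (density lborel (\<lambda>u. ennreal (q u))) S = (\<integral>\<^sup>+u. ennreal (indicator S u * q u) \<partial>lborel)"
    using q S borel_measurable_integrable[OF q(1)]
    by (subst emeasure_density) (auto intro!: nn_integral_cong simp: indicator_def)
  also have "\<dots> = ennreal (LINT u:S|lborel. q u)"
    unfolding set_lebesgue_integral_def using q S
    by (subst nn_integral_eq_integral) (auto intro!: integrable_mult_indicator[where 'a=real and 'b=real, simplified])
  finally show "emeasure (density lborel (\<lambda>u. ennreal (q u))) S = ennreal (LINT u:S|lborel. q u)" .
  then show "measure (density lborel (\<lambda>u. ennreal (q u))) S = (LINT u:S|lborel. q u)"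
    using q unfolding measure_def set_lebesgue_integral_def by (simp add: integral_nonneg)
qed

lemma finite_measure_density_real:
  fixes q :: "real \<Rightarrow> real"
  assumes q: "integrable lborel q" "\<And>u. 0 \<le> q u"
  shows "finite_measure (density lborel (\<lambda>u. ennreal (q u)))"
  using measure_density_LINT(2)[OF q, of UNIV] by (intro finite_measureI) simp

text \<open>One half of Lebesgue differentiation. For rational r, the part of p above r is the
  density of a measure that does not charge {p < r}. By \<open>negligible_upper_density_pos\<close>
  this measure is o(h) on \<open>cball u h\<close> for almost every u in that set, so increments of
  f exceed r h by o(h) at most.\<close>

lemma AE_upper_derivative_le:
  fixes p f :: "real \<Rightarrow> real"
  assumes p: "integrable lborel p"
    and f: "\<And>s t. s \<le> t \<Longrightarrow> f t - f s = (LINT u:{s..t}|lborel. p u)"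
  shows "AE u in lborel. \<forall>\<epsilon>>0. \<exists>\<delta>>0. \<forall>h. 0 < h \<longrightarrow> h < \<delta> \<longrightarrow>
    f (u + h) - f u \<le> (p u + \<epsilon>) * h \<and> f u - f (u - h) \<le> (p u + \<epsilon>) * h"
proof -
  define A where "A r n = {u. - real n < u \<and> u < real n \<and> p u < r}" for r :: real and n :: nat
  \<comment> \<open>The cut-off to a bounded interval makes q integrable: for r < 0 the function
    \<open>max 0 (p u - r)\<close> stays near - r at infinity.\<close>
  define q where "q r n u = indicator {- real n..real n} u * max 0 (p u - r)" for r :: real and n :: nat and u
  define \<nu> where "\<nu> r n = density lborel (\<lambda>u. ennreal (q r n u))" for r n
  define N where "N r n k = {u\<in>A r n. \<forall>\<delta>>0. \<exists>h. 0 < h \<and> h < \<delta> \<and>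
    measure (\<nu> r n) (cball u h) > inverse (real (Suc k)) * h}" for r n k
  have pm: "p \<in> borel_measurable borel" using borel_measurable_integrable[OF p] by simp
  have q: "integrable lborel (q r n)" "0 \<le> q r n u" for r n u
    using integrable_max_diff_indicator[OF p] by (auto simp: q_def[abs_def])
  have Ab: "A r n \<in> sets borel" for r n
    unfolding A_def using pm by measurable
  have "emeasure (\<nu> r n) (A r n) = 0" for r n
  proof -
    have "(LINT u:A r n|lborel. q r n u) = (LINT u|(lborel :: real measure). 0)"
      unfolding set_lebesgue_integral_def
      by (rule Bochner_Integration.integral_cong) (auto simp: A_def q_def indicator_def)
    then show ?thesis unfolding \<nu>_def by (subst measure_density_LINT(2)[OF q Ab]) simp
  qed
  then have "negligible (N r n k)" for r n k
    unfolding N_def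
    by (intro negligible_upper_density_pos) (auto simp: \<nu>_def Ab finite_measure_density_real[OF q])
  then have "AE u in lborel. u \<notin> N r n k" for r n k
    using AE_not_in[of "N r n k" lebesgue] by (simp add: negligible_iff_null_sets AE_completion_iff)
  then have "AE u in lborel. \<forall>r\<in>\<rat>. \<forall>n k. u \<notin> N r n k"
    by (simp add: AE_ball_countable countable_rat AE_all_countable)
  then show ?thesis
  proof (rule eventually_mono, intro allI impI)
    fix u \<epsilon> :: real assume u: "\<forall>r\<in>\<rat>. \<forall>n k. u \<notin> N r n k" and "\<epsilon> > 0"
    obtain r where r: "r \<in> \<rat>" "p u < r" "r < p u + \<epsilon> / 2"
      using Rats_dense_in_real[of "p u" "p u + \<epsilon> / 2"] \<open>\<epsilon> > 0\<close> by auto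
    obtain k where k: "inverse (real (Suc k)) < \<epsilon> / 2"
      using reals_Archimedean[of "\<epsilon> / 2"] \<open>\<epsilon> > 0\<close> by auto
    obtain n where n: "\<bar>u\<bar> < real n" using reals_Archimedean2 by blast
    have "u \<in> A r n" using n r by (auto simp: A_def)
    moreover have "u \<notin> N r n k" using u r(1) by blast
    ultimately obtain d where d: "d > 0"
        "\<And>h. 0 < h \<Longrightarrow> h < d \<Longrightarrow> measure (\<nu> r n) (cball u h) \<le> inverse (real (Suc k)) * h"
      unfolding N_def mem_Collect_eq by (meson not_less)
    \<comment> \<open>Stated for any interval of length h inside \<open>cball u h\<close>, so that
      it serves the increments on both sides of u.\<close>
    have bound: "f (a + h) - f a \<le> (p u + \<epsilon>) * h"
      if h: "0 < h" "h < min d (real n - \<bar>u\<bar>)" and a: "{a..a + h} \<subseteq> cball u h" for a h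
    proof -
      have sub: "{a..a + h} \<subseteq> {- real n..real n}"
      proof -
        have "a \<in> cball u h" "a + h \<in> cball u h" using h by (auto intro!: subsetD[OF a] simp del: mem_cball)
        then show ?thesis using h by (auto simp: dist_real_def)
      qed
      have int: "set_integrable lborel {a..a+h} (q r n)" "set_integrable lborel (cball u h) (q r n)"
         "set_integrable lborel {a..a+h} p"
        using q p by (simp_all add: set_integrable_of_integrable)
      have "f (a + h) - f a = (LINT v:{a..a+h}|lborel. p v)" using f h by simp
      also have "\<dots> \<le> (LINT v:{a..a+h}|lborel. r + q r n v)"
      proof (rule set_integral_mono)
        show "set_integrable lborel {a..a+h} (\<lambda>v. r + q r n v)"
          by (intro set_integral_add int) (simp add: set_integrable_def emeasure_lborel_Icc_eq)
        fix v assume "v \<in> {a..a + h}"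
        then have "v \<in> {- real n..real n}" using sub by blast
        then show "p v \<le> r + q r n v" by (auto simp: q_def)
      qed (use int in auto)
      also have "\<dots> = r * h + (LINT v:{a..a+h}|lborel. q r n v)"
        using int h by (subst set_integral_add) (auto simp: set_integrable_def set_lebesgue_integral_def emeasure_lborel_Icc_eq)
      also have "(LINT v:{a..a+h}|lborel. q r n v) \<le> (LINT v:cball u h|lborel. q r n v)"
        unfolding set_lebesgue_integral_def
      proof (rule integral_mono)
        fix v show "indicator {a..a + h} v *\<^sub>R q r n v \<le> indicator (cball u h) v *\<^sub>R q r n v"
          using subsetD[OF a, of v] q(2)[of r n v] by (auto simp: indicator_def simp del: mem_cball)
      qed (use int in \<open>simp_all add: set_integrable_def\<close>)
      also have "\<dots> = measure (\<nu> r n) (cball u h)"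
        unfolding \<nu>_def by (rule measure_density_LINT(1)[OF q, symmetric]) simp
      also have "\<dots> \<le> \<epsilon> / 2 * h"
        using d(2)[of h] h k by (smt (verit) mult_right_mono)
      also have "r * h + \<epsilon> / 2 * h \<le> (p u + \<epsilon>) * h"
        using r h by (smt (verit) mult_right_mono distrib_right field_sum_of_halves)
      finally show ?thesis by simp
    qed
    show "\<exists>\<delta>>0. \<forall>h. 0 < h \<longrightarrow> h < \<delta> \<longrightarrow>
        f (u + h) - f u \<le> (p u + \<epsilon>) * h \<and> f u - f (u - h) \<le> (p u + \<epsilon>) * h"
    proof (intro exI[of _ "min d (real n - \<bar>u\<bar>)"] conjI allI impI)
      show "0 < min d (real n - \<bar>u\<bar>)" using d n by simp
      fix h assume h: "0 < h" "h < min d (real n - \<bar>u\<bar>)"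
      show "f (u + h) - f u \<le> (p u + \<epsilon>) * h"
        using h by (intro bound) (auto simp: dist_real_def)
      show "f u - f (u - h) \<le> (p u + \<epsilon>) * h"
        using bound[OF h, of "u - h"] h by (simp add: subset_iff dist_real_def)
    qed
  qed
qed

text \<open>\<open>AE_upper_derivative_le\<close> for p bounds the difference quotients from above,
  and for - p from below.\<close>

theorem AE_has_real_derivative_integral:
  fixes p f :: "real \<Rightarrow> real"
  assumes p: "integrable lborel p"
    and f: "\<And>s t. s \<le> t \<Longrightarrow> f t - f s = (LINT u:{s..t}|lborel. p u)"
  shows "AE u in lborel. (f has_real_derivative p u) (at u)"
proof -
  have "AE u in lborel. \<forall>\<epsilon>>0. \<exists>\<delta>>0. \<forall>h. 0 < h \<longrightarrow> h < \<delta> \<longrightarrow>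
    - f (u + h) - - f u \<le> (- p u + \<epsilon>) * h \<and> - f u - - f (u - h) \<le> (- p u + \<epsilon>) * h"
  proof (rule AE_upper_derivative_le[of "\<lambda>u. - p u" "\<lambda>u. - f u"])
    fix s t :: real assume "s \<le> t"
    with f[of s t] show "- f t - - f s = (LINT u:{s..t}|lborel. - p u)"
      by (simp add: set_lebesgue_integral_def)
  qed (use p in simp)
  moreover have "AE u in lborel. \<forall>\<epsilon>>0. \<exists>\<delta>>0. \<forall>h. 0 < h \<longrightarrow> h < \<delta> \<longrightarrow>
    f (u + h) - f u \<le> (p u + \<epsilon>) * h \<and> f u - f (u - h) \<le> (p u + \<epsilon>) * h"
    by (rule AE_upper_derivative_le) (use p f in auto)
  ultimately show ?thesis
  proof eventually_elim
    case (elim u)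
    show ?case
      unfolding DERIV_def
    proof (rule LIM_I)
      fix r :: real assume "r > 0"
      then have "r / 2 > 0" by simp
      from elim(2)[rule_format, OF this] obtain d1 where d1: "d1 > 0"
        "\<And>h. 0 < h \<Longrightarrow> h < d1 \<Longrightarrow> f (u + h) - f u \<le> (p u + r / 2) * h"
        "\<And>h. 0 < h \<Longrightarrow> h < d1 \<Longrightarrow> f u - f (u - h) \<le> (p u + r / 2) * h" by blast
      from elim(1)[rule_format, OF \<open>r / 2 > 0\<close>] obtain d2 where d2: "d2 > 0"
        "\<And>h. 0 < h \<Longrightarrow> h < d2 \<Longrightarrow> - f (u + h) - - f u \<le> (- p u + r / 2) * h"
        "\<And>h. 0 < h \<Longrightarrow> h < d2 \<Longrightarrow> - f u - - f (u - h) \<le> (- p u + r / 2) * h" by blast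
      show "\<exists>s>0. \<forall>h::real. h \<noteq> 0 \<and> norm (h - 0) < s \<longrightarrow> norm ((f (u + h) - f u) / h - p u) < r"
      proof (intro exI[of _ "min d1 d2"] conjI allI impI)
        fix h :: real assume "h \<noteq> 0 \<and> norm (h - 0) < min d1 d2"
        then have h: "h \<noteq> 0" "\<bar>h\<bar> < d1" "\<bar>h\<bar> < d2" by auto
        have "\<bar>f (u + h) - f u - p u * h\<bar> \<le> r / 2 * \<bar>h\<bar>"
        proof (cases "h > 0")
          case True
          then show ?thesis using d1(2)[of h] d2(2)[of h] h unfolding abs_le_iff by (simp add: algebra_simps)
        next
          case False
          then have "0 < - h" "-h < d1" "- h < d2" using h by auto
          then show ?thesis using d1(3)[of "-h"] d2(3)[of "-h"] h
            unfolding abs_le_iff by (simp add: algebra_simps)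
        qed
        then have "\<bar>(f (u + h) - f u - p u * h) / h\<bar> \<le> r / 2"
          using h by (simp add: field_simps)
        then show "norm ((f (u + h) - f u) / h - p u) < r"
          using h \<open>r > 0\<close> by (simp add: diff_divide_distrib)
      qed (use d1 d2 in auto)
    qed
  qed
qed

text \<open>With M the distribution function of the measure m du, domination by m makes M + f and M
  - f nondecreasing, so both generate measures. These average to m du, hence are absolutely
  continuous, and Radon-Nikodym gives the density of M + f.\<close>

theorem absolutely_continuous_imp_AE_derivative:
  fixes f m :: "real \<Rightarrow> real"
  assumes m: "integrable lborel m" "\<And>u. 0 \<le> m u"
    and f: "\<And>s t. s \<le> t \<Longrightarrow> \<bar>f t - f s\<bar> \<le> (LINT u:{s..t}|lborel. m u)"
  obtains p where "integrable lborel p"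
    "\<And>s t. s \<le> t \<Longrightarrow> f t - f s = (LINT u:{s..t}|lborel. p u)"
    "AE u in lborel. (f has_real_derivative p u) (at u)"
proof -
  define \<nu> where "\<nu> = density lborel (\<lambda>u. ennreal (m u))"
  interpret finite_borel_measure \<nu>
    unfolding finite_borel_measure_def finite_borel_measure_axioms_def \<nu>_def
    using finite_measure_density_real[OF m] by simp
  have Ioc: "(LINT u:{s<..t}|lborel. g u) = (LINT u:{s..t}|lborel. g u)"
    if [measurable]: "g \<in> borel_measurable borel" for s t and g :: "real \<Rightarrow> real"
  proof -
    have "AE u in lborel. indicator {s<..t} u *\<^sub>R g u = indicator {s..t} u *\<^sub>R g u"
      using AE_lborel_singleton[of s] by eventually_elim (auto simp: indicator_def)
    then show ?thesis
      unfolding set_lebesgue_integral_def by (intro integral_cong_AE) auto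
  qed
  have mm: "m \<in> borel_measurable borel" using borel_measurable_integrable[OF m(1)] by simp
  have M: "cdf \<nu> t - cdf \<nu> s = (LINT u:{s..t}|lborel. m u)" if "s \<le> t" for s t
  proof (cases "s < t")
    case True
    then show ?thesis using cdf_diff_eq[of s t] measure_density_LINT(1)[OF m, of "{s<..t}"] 
      by (simp add: \<nu>_def Ioc[OF mm])
  next
    case False
    have "(LINT u:{s..s}|lborel. m u) = (LINT u:{s<..s}|lborel. m u)" by (rule Ioc[OF mm, symmetric])
    then show ?thesis using False that by (simp add: set_lebesgue_integral_def)
  qed
  have fM: "\<bar>f t - f s\<bar> \<le> cdf \<nu> t - cdf \<nu> s" if "s \<le> t" for s t
    using M f that by simp
  have cM: "continuous (at_right a) (cdf \<nu>)" for a by (rule cdf_is_right_cont)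
  have cf: "continuous (at_right a) f" for a
  proof -
    have "((\<lambda>t. cdf \<nu> t - cdf \<nu> a) \<longlongrightarrow> cdf \<nu> a - cdf \<nu> a) (at_right a)"
      using cM[of a] by (intro tendsto_diff) (auto simp: continuous_within)
    then have "((\<lambda>t. cdf \<nu> t - cdf \<nu> a) \<longlongrightarrow> 0) (at_right a)" by simp
    moreover have "\<forall>\<^sub>F x in at_right a. norm (f x - f a) \<le> cdf \<nu> x - cdf \<nu> a"
      by (rule eventually_at_rightI[of a "a + 1"]) (use fM in auto)
    ultimately have "((\<lambda>t. f t - f a) \<longlongrightarrow> 0) (at_right a)"
      by (rule Lim_null_comparison[rotated])
    then show ?thesis by (simp add: continuous_within LIM_zero_iff)
  qed
  define F where "F t = cdf \<nu> t + f t" for t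
  define G where "G t = cdf \<nu> t - f t" for t
  have incF: "F s \<le> F t" and incG: "G s \<le> G t" if "s \<le> t" for s t
    using fM[OF that] by (auto simp: F_def G_def)
  have cF: "continuous (at_right a) F" and cG: "continuous (at_right a) G" for a
    unfolding F_def[abs_def] G_def[abs_def] by (intro continuous_intros cM cf)+
  note eF = emeasure_interval_measure_Ioc_eq[OF incF cF] and eG = emeasure_interval_measure_Ioc_eq[OF incG cG]
  \<comment> \<open>F and G average to the distribution function of \<nu>, so the two measures agree
    on half-open intervals, an intersection-stable generator.\<close>
  have half: "half_sum (interval_measure F) (interval_measure G) = \<nu>"
  proof (rule measure_eqI_generator_eq)
    define E where "E = range (\<lambda>(a, b). {a<..b::real})"
    show "Int_stable E"
    proof (rule Int_stableI)
      fix a b assume "a \<in> E" "b \<in> E"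
      then obtain x y x' y' where "a = {x<..y}" "b = {x'<..y'}" by (auto simp: E_def)
      then have "a \<inter> b = {max x x'<..min y y'}" by auto
      then show "a \<inter> b \<in> E" by (auto simp: E_def)
    qed
    show "E \<subseteq> Pow UNIV" by simp
    show "sets (half_sum (interval_measure F) (interval_measure G)) = sigma_sets UNIV E"
      "sets \<nu> = sigma_sets UNIV E"
      by (simp_all add: \<nu>_def E_def borel_sigma_sets_Ioc)
    show "range (\<lambda>n::nat. {- real n<..real n}) \<subseteq> E" by (auto simp: E_def)
    show "(\<Union>n::nat. {- real n<..real n}) = UNIV"
    proof -
      have "\<exists>n. - real n < x \<and> x \<le> real n" for x :: real
      proof -
        obtain n where "\<bar>x\<bar> < real n" using reals_Archimedean2 by blast
        then show ?thesis by (intro exI[of _ n]) auto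
      qed
      then show ?thesis by auto
    qed
    have *: "emeasure (half_sum (interval_measure F) (interval_measure G)) {a<..b} = emeasure \<nu> {a<..b}" for a b
    proof (cases "a \<le> b")
      case True
      have "emeasure (half_sum (interval_measure F) (interval_measure G)) {a<..b} =
          ennreal (F b - F a) / 2 + ennreal (G b - G a) / 2"
        using True by (subst emeasure_half_sum) (auto simp: eF eG)
      also have "\<dots> = ennreal ((F b - F a) / 2 + (G b - G a) / 2)"
        using incF[OF True] incG[OF True] by (simp add: ennreal_divide_numeral)
      also have "(F b - F a) / 2 + (G b - G a) / 2 = cdf \<nu> b - cdf \<nu> a"
        by (simp add: F_def G_def field_simps)
      also have "ennreal \<dots> = emeasure \<nu> {a<..b}"
        using M[OF True] measure_density_LINT(2)[OF m, of "{a<..b}"] by (simp add: \<nu>_def Ioc[OF mm])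
      finally show ?thesis .
    next
      case False
      then have "{a<..b} = {}" by auto
      then show ?thesis by simp
    qed
    then show "emeasure (half_sum (interval_measure F) (interval_measure G)) X = emeasure \<nu> X" if "X \<in> E" for X
      using that by (auto simp: E_def)
    show "emeasure (half_sum (interval_measure F) (interval_measure G)) {- real i<..real i} \<noteq> \<infinity>" for i
      using * by (simp add: emeasure_eq_measure)
  qed
  have le: "emeasure (interval_measure F) A / 2 \<le> emeasure \<nu> A" if "A \<in> sets borel" for A
    using that emeasure_half_sum[of "interval_measure G" "interval_measure F" A] half by simp
  have "finite_measure (interval_measure F)"
    using le[of UNIV] by (intro finite_measureI) (auto simp: emeasure_eq_measure ennreal_top_divide top_unique)
  moreover have "absolutely_continuous lborel (interval_measure F)"
  proof -
    have "A \<in> null_sets (interval_measure F)" if "A \<in> null_sets lborel" for A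
    proof -
      have A: "A \<in> sets borel" "emeasure lborel A = 0" using that by (auto simp: null_sets_def)
      have "emeasure \<nu> A = 0"
        using absolutely_continuousI_density[of "\<lambda>u. ennreal (m u)" lborel] A borel_measurable_integrable[OF m(1)]
        by (auto simp: \<nu>_def intro: absolutely_continuousD)
      then show ?thesis using le[OF A(1)] A(1) by (auto simp: null_sets_def ennreal_divide_zero)
    qed
    then show ?thesis by (auto simp: absolutely_continuous_def)
  qed
  ultimately obtain D where D: "D \<in> borel_measurable lborel"
      "AE u in lborel. RN_deriv lborel (interval_measure F) u = ennreal (D u)" "\<And>u. 0 \<le> D u"
    by (rule sigma_finite_measure.real_RN_deriv[OF sigma_finite_lborel]) auto
  have IF: "density lborel (\<lambda>u. ennreal (D u)) = interval_measure F"
  proof -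
    have "density lborel (RN_deriv lborel (interval_measure F)) = interval_measure F"
      by (rule sigma_finite_measure.density_RN_deriv[OF sigma_finite_lborel]) (use \<open>absolutely_continuous lborel (interval_measure F)\<close> in auto)
    then show ?thesis
      using density_cong[OF _ _ D(2)] D(1) by simp
  qed
  interpret F: finite_measure "interval_measure F" by fact
  have Dint: "integrable lborel D"
  proof (rule integrableI_nonneg)
    have "(\<integral>\<^sup>+u. ennreal (D u) \<partial>lborel) = emeasure (interval_measure F) UNIV"
      unfolding IF[symmetric] using D(1) by (simp add: emeasure_density)
    then show "(\<integral>\<^sup>+u. ennreal (D u) \<partial>lborel) < \<infinity>" by (simp add: F.emeasure_eq_measure)
  qed (use D in auto)
  have FD: "F t - F s = (LINT u:{s..t}|lborel. D u)" if "s \<le> t" for s t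
  proof -
    have "ennreal (F t - F s) = ennreal (LINT u:{s<..t}|lborel. D u)"
      using measure_density_LINT(2)[OF Dint D(3), of "{s<..t}"] eF[of s t] that by (simp add: IF)
    moreover have "0 \<le> (LINT u:{s<..t}|lborel. D u)"
      unfolding set_lebesgue_integral_def using D(3) by (simp add: integral_nonneg)
    ultimately show ?thesis using incF[OF that] D(1) by (simp add: Ioc)
  qed
  \<comment> \<open>f is F minus the distribution function of \<nu>, so its density is that of F
    minus m.\<close>
  have eq: "f t - f s = (LINT u:{s..t}|lborel. D u - m u)" if "s \<le> t" for s t
  proof -
    have "(LINT u:{s..t}|lborel. D u - m u) = (LINT u:{s..t}|lborel. D u) - (LINT u:{s..t}|lborel. m u)"
      by (rule set_integral_diff) (use Dint m in \<open>simp_all add: set_integrable_of_integrable\<close>)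
    then show ?thesis using FD[OF that] M[OF that] by (simp add: F_def)
  qed
  have int: "integrable lborel (\<lambda>u. D u - m u)" using Dint m(1) by simp
  have "AE u in lborel. (f has_real_derivative D u - m u) (at u)"
    by (rule AE_has_real_derivative_integral) (use int eq in auto)
  with int eq show thesis by (rule that)
qed

section \<open>The distances on the torus and on the cone\<close>

definition gnorm :: "real \<Rightarrow> real^2 \<Rightarrow> real" where
  "gnorm R v = sqrt (gnorm2 R v)"

text \<open>The passage to arc-length coordinates. It pulls the Euclidean norm back to
  \<open>gnorm\<close>, through which the triangle inequality and the norm bound for integrals
  become available.\<close>

definition gscale :: "real \<Rightarrow> real^2 \<Rightarrow> real^2" where
  "gscale R v = (\<chi> i. if i = 1 then v $ i else R * v $ i)"

lemma gnorm_eq_norm: "gnorm R v = norm (gscale R v)"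
  by (simp add: gnorm_def gnorm2_def norm_eq_sqrt_inner inner_vec_def sum_2 gscale_def power2_eq_square algebra_simps)

lemma gscale_simps:
  "gscale R (v + w) = gscale R v + gscale R w" "gscale R (v - w) = gscale R v - gscale R w"
  "gscale R (c *\<^sub>R v) = c *\<^sub>R gscale R v" "gscale R (- v) = - gscale R v" "gscale R 0 = 0"
  by (simp_all add: gscale_def vec_eq_iff algebra_simps)

lemma bounded_linear_gscale: "bounded_linear (gscale R)"
  by (intro linear_conv_bounded_linear[THEN iffD1] linearI) (simp_all add: gscale_simps)

lemma gnorm_simps [simp]: "gnorm R 0 = 0" "gnorm R (- v) = gnorm R v" "0 \<le> gnorm R v"
  "gnorm R (c *\<^sub>R v) = \<bar>c\<bar> * gnorm R v"
  by (simp_all add: gnorm_eq_norm gscale_simps)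

lemma gnorm_triangle: "gnorm R (v + w) \<le> gnorm R v + gnorm R w"
  by (simp add: gnorm_eq_norm gscale_simps norm_triangle_ineq)

lemma gnorm_sq: "(gnorm R v)\<^sup>2 = gnorm2 R v"
  by (simp add: gnorm_def gnorm2_def)

lemma gnorm_mono:
  assumes "\<And>i. \<bar>v $ i\<bar> \<le> \<bar>w $ i\<bar>"
  shows "gnorm R v \<le> gnorm R w"
proof -
  have "(v $ i)\<^sup>2 \<le> (w $ i)\<^sup>2" for i using assms[of i] by (simp add: abs_le_square_iff)
  then show ?thesis by (simp add: gnorm_def gnorm2_def add_mono mult_left_mono)
qed

lemma gnorm_component_le: "\<bar>v $ 1\<bar> \<le> gnorm R v" "\<bar>R\<bar> * \<bar>v $ 2\<bar> \<le> gnorm R v"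
  unfolding gnorm_def gnorm2_def
  by (auto intro!: real_le_rsqrt simp: power_mult_distrib)

section \<open>Lattice translates and shortest displacements\<close>

lemma torus_of_eq_iff: "torus_of p = torus_of q \<longleftrightarrow> period_rel p q"
  by (rule torus.abs_eq_iff)

lemma torus_cases: obtains p where "x = torus_of p"
  using Quotient3_abs_rep[OF Quotient3_torus] by metis

lemma torus_shift_torus_of: "torus_shift a (torus_of p) = torus_of (p + a)"
  by (rule torus_shift.abs_eq)

text \<open>The representative of a modulo 2 pi closest to 0: rounding picks the lattice translate
  of least absolute value.\<close>

definition wrap :: "real \<Rightarrow> real" where
  "wrap a = a - 2 * pi * of_int (round (a / (2 * pi)))"

lemma wrap_eq: "wrap a = 2 * pi * (a / (2 * pi) - of_int (round (a / (2 * pi))))"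
  by (simp add: wrap_def right_diff_distrib)

lemma wrap_le: "\<bar>wrap a\<bar> \<le> \<bar>a + 2 * pi * of_int k\<bar>"
proof -
  have "\<bar>wrap a\<bar> \<le> 2 * pi * \<bar>a / (2 * pi) - of_int (- k)\<bar>"
    unfolding wrap_eq abs_mult using round_diff_minimal[of "a / (2 * pi)" "- k"]
    by (auto intro!: mult_left_mono)
  also have "\<dots> = \<bar>2 * pi * (a / (2 * pi) - of_int (- k))\<bar>" by (simp add: abs_mult)
  also have "2 * pi * (a / (2 * pi) - of_int (- k)) = a + 2 * pi * of_int k"
    by (simp add: field_simps)
  finally show ?thesis .
qed

text \<open>The shortest vector from p to a lattice translate of q. It can be chosen componentwise,
  and independently of R, because \<open>gnorm\<close> is monotone in the absolute value of each
  component.\<close>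

definition disp :: "real^2 \<Rightarrow> real^2 \<Rightarrow> real^2" where
  "disp p q = (\<chi> i. wrap (q $ i - p $ i))"

lemma torus_of_disp: "torus_of (p + disp p q) = torus_of q"
  unfolding torus_of_eq_iff period_rel_def
proof
  fix i
  show "\<exists>k::int. (p + disp p q) $ i - q $ i = 2 * pi * of_int k"
    by (rule exI[of _ "- round ((q $ i - p $ i) / (2 * pi))"]) (simp add: disp_def wrap_def)
qed

lemma disp_le:
  assumes "torus_of a = torus_of p" "torus_of b = torus_of q"
  shows "gnorm R (disp p q) \<le> gnorm R (b - a)"
proof (rule gnorm_mono)
  fix i
  from assms obtain k l :: int where "a $ i - p $ i = 2 * pi * of_int k" "b $ i - q $ i = 2 * pi * of_int l"
    unfolding torus_of_eq_iff period_rel_def by meson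
  then have "(b - a) $ i = (q $ i - p $ i) + 2 * pi * of_int (l - k)"
    by (simp add: algebra_simps)
  then show "\<bar>disp p q $ i\<bar> \<le> \<bar>(b - a) $ i\<bar>"
    using wrap_le[of "q $ i - p $ i" "l - k"] by (simp add: disp_def)
qed

lemma curve_length_ge:
  assumes "c C1_differentiable_on {0..1}"
  shows "gnorm R (c 1 - c 0) \<le> curve_length R c"
proof -
  from assms obtain D where D: "\<And>t. t \<in> {0..1} \<Longrightarrow> (c has_vector_derivative D t) (at t)"
      and cD: "continuous_on {0..1} D"
    unfolding C1_differentiable_on_def by blast
  interpret bounded_linear "gscale R" by (rule bounded_linear_gscale)
  have i: "((\<lambda>t. gscale R (D t)) has_integral gscale R (c 1) - gscale R (c 0)) {0..1}"
  proof (rule fundamental_theorem_of_calculus)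
    fix t :: real assume "t \<in> {0..1}"
    then show "((\<lambda>t. gscale R (c t)) has_vector_derivative gscale R (D t)) (at t within {0..1})"
      by (rule has_vector_derivative_at_within[OF has_vector_derivative[OF D]])
  qed simp
  have cg: "continuous_on {0..1} (\<lambda>t. gscale R (D t))" by (intro continuous_on cD)
  have "curve_length R c = integral {0..1} (\<lambda>t. norm (gscale R (D t)))"
    unfolding curve_length_def
  proof (rule Henstock_Kurzweil_Integration.integral_cong)
    fix t :: real assume "t \<in> {0..1}"
    then have "vector_derivative c (at t) = D t" by (rule vector_derivative_at[OF D])
    then show "sqrt (gnorm2 R (vector_derivative c (at t))) = norm (gscale R (D t))"
      by (simp flip: gnorm_def gnorm_eq_norm)
  qed
  moreover have "norm (integral {0..1} (\<lambda>t. gscale R (D t))) \<le> integral {0..1} (\<lambda>t. norm (gscale R (D t)))"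
    by (rule integral_norm_bound_integral)
      (use cg in \<open>auto intro!: integrable_continuous_real continuous_intros\<close>)
  ultimately show ?thesis
    using integral_unique[OF i] by (simp add: gnorm_eq_norm gscale_simps)
qed

text \<open>The straight segment along \<open>disp p q\<close> attains the infimum. Any competitor
  is at least as long as its endpoint displacement, which differs from \<open>disp p q\<close> by a
  lattice vector.\<close>

theorem torus_dist_torus_of: "torus_dist R (torus_of p) (torus_of q) = gnorm R (disp p q)"
  unfolding torus_dist_def
proof (rule cInf_eq_minimum)
  let ?c = "\<lambda>t. p + t *\<^sub>R disp p q"
  have d: "(?c has_vector_derivative disp p q) (at t)" for t
    by (auto intro!: derivative_eq_intros)
  have "?c C1_differentiable_on {0..1}"
    unfolding C1_differentiable_on_def using d by (intro exI[of _ "\<lambda>t. disp p q"]) auto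
  moreover have "curve_length R ?c = gnorm R (disp p q)"
    unfolding curve_length_def using vector_derivative_at[OF d] by (simp add: gnorm_def)
  ultimately show "gnorm R (disp p q) \<in> {curve_length R c |c. c C1_differentiable_on {0..1} \<and>
      torus_of (c 0) = torus_of p \<and> torus_of (c 1) = torus_of q}"
    by (intro CollectI exI[of _ ?c]) (simp add: torus_of_disp)
next
  fix l assume "l \<in> {curve_length R c |c. c C1_differentiable_on {0..1} \<and>
      torus_of (c 0) = torus_of p \<and> torus_of (c 1) = torus_of q}"
  then show "gnorm R (disp p q) \<le> l"
    using disp_le curve_length_ge order_trans by blast
qed

lemma torus_dist_le:
  assumes "torus_of (p + v) = y"
  shows "torus_dist R (torus_of p) y \<le> gnorm R v"
  using disp_le[of p p "p + v" "p + v" R] unfolding assms[symmetric] torus_dist_torus_of by simp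

lemma torus_dist_attained:
  obtains v where "torus_of (p + v) = y" "torus_dist R (torus_of p) y = gnorm R v"
  by (metis torus_cases torus_of_disp torus_dist_torus_of)

lemma torus_dist_nonneg [simp]: "0 \<le> torus_dist R x y"
  by (metis torus_cases torus_dist_torus_of gnorm_simps(3))

lemma torus_dist_self [simp]: "torus_dist R x x = 0"
  by (metis torus_cases torus_dist_le gnorm_simps(1) add.right_neutral torus_dist_nonneg order_antisym)

lemma torus_dist_commute: "torus_dist R x y = torus_dist R y x"
proof -
  have "torus_dist R x y \<le> torus_dist R y x" for x y
  proof -
    obtain p where p: "y = torus_of p" by (rule torus_cases)
    obtain v where v: "torus_of (p + v) = x" "torus_dist R y x = gnorm R v"
      unfolding p by (rule torus_dist_attained)
    have "torus_dist R (torus_of (p + v)) y \<le> gnorm R (- v)"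
      by (rule torus_dist_le) (simp add: p)
    then show ?thesis using v by simp
  qed
  then show ?thesis by (simp add: order_antisym)
qed

lemma torus_dist_triangle: "torus_dist R x z \<le> torus_dist R x y + torus_dist R y z"
proof -
  obtain p where p: "x = torus_of p" by (rule torus_cases)
  obtain v where v: "torus_of (p + v) = y" "torus_dist R x y = gnorm R v"
    unfolding p by (rule torus_dist_attained)
  obtain w where w: "torus_of ((p + v) + w) = z" "torus_dist R (torus_of (p + v)) z = gnorm R w"
    by (rule torus_dist_attained)
  have "torus_dist R x z \<le> gnorm R (v + w)"
    unfolding p by (rule torus_dist_le) (use w in \<open>simp add: add.assoc\<close>)
  then show ?thesis using gnorm_triangle[of R v w] v w by simp
qed

lemma gnorm_eq_0_iff: "R > 0 \<Longrightarrow> gnorm R v = 0 \<longleftrightarrow> v = 0"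
  by (auto simp: gnorm_def gnorm2_def vec_eq_iff forall_2 add_nonneg_eq_0_iff)

lemma torus_dist_eq_0_iff:
  assumes "R > 0"
  shows "torus_dist R x y = 0 \<longleftrightarrow> x = y"
proof
  assume d: "torus_dist R x y = 0"
  obtain p where p: "x = torus_of p" by (rule torus_cases)
  obtain v where v: "torus_of (p + v) = y" "torus_dist R x y = gnorm R v"
    unfolding p by (rule torus_dist_attained)
  then show "x = y" using d gnorm_eq_0_iff[OF assms] p by simp
qed simp

section \<open>Points and distance of the cone\<close>

lemma cone_pt_cases:
  obtains x r where "z = cone_pt x r" "0 \<le> r"
proof -
  have "cone_rel (rep_cone z) (rep_cone z)"
    by (rule Quotient3_rep_reflp[OF Quotient3_cone])
  moreover have "abs_cone (rep_cone z) = z"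
    by (rule Quotient3_abs_rep[OF Quotient3_cone])
  ultimately show thesis
    using that[of "fst (rep_cone z)" "snd (rep_cone z)"] by (simp add: cone_pt_def cone_rel_def)
qed

lemma cone_rel_refl: "0 \<le> r \<Longrightarrow> cone_rel (x, r) (x, r)"
  by (simp add: cone_rel_def)

lemma cone_pt_eq_iff:
  "0 \<le> r \<Longrightarrow> 0 \<le> s \<Longrightarrow> cone_pt x r = cone_pt y s \<longleftrightarrow> r = s \<and> (r = 0 \<or> x = y)"
  unfolding cone_pt_def
  using Quotient3_rel[OF Quotient3_cone, of "(x, r)" "(y, s)"] by (auto simp: cone_rel_def)

lemma cone_r_cone_pt [simp]: "0 \<le> r \<Longrightarrow> cone_r (cone_pt x r) = r"
  unfolding cone_pt_def by (simp add: cone_r.abs_eq cone_rel_refl)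

lemma cone_x_cone_pt [simp]: "0 < r \<Longrightarrow> cone_x xbar (cone_pt x r) = x"
  unfolding cone_pt_def by (simp add: cone_x.abs_eq cone_rel_refl)

lemma cone_r_nonneg [simp]: "0 \<le> cone_r z"
  by (metis cone_pt_cases cone_r_cone_pt)

lemma apex_eq: "apex = cone_pt x 0"
proof -
  have "apex = cone_pt undefined 0" by (simp add: apex_def cone_pt_def)
  also have "\<dots> = cone_pt x 0" by (subst cone_pt_eq_iff) simp_all
  finally show ?thesis .
qed

lemma cone_r_apex [simp]: "cone_r apex = 0"
  by (simp add: apex_eq[of undefined])

lemma cone_pt_cone_x_cone_r [simp]: "cone_pt (cone_x xbar z) (cone_r z) = z"
proof -
  obtain x r where z: "z = cone_pt x r" "0 \<le> r" by (rule cone_pt_cases)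
  then show ?thesis by (cases "r = 0") (simp_all add: cone_pt_eq_iff)
qed

lemma cos_eq_sin_half: "cos a = 1 - 2 * (sin (a / 2))\<^sup>2" for a :: real
  using cos_double_sin[of "a / 2"] by simp

text \<open>The law of cosines in half-angle form: the radicand is visibly nonnegative and
  increasing in the truncated angle. \<open>cmod_rcis_diff_sq\<close> has the same shape, so
  comparing the cone with the plane comes down to comparing two squared sines.\<close>

lemma cone_dist_cone_pt_sq:
  assumes "0 \<le> r" "0 \<le> s"
  shows "(cone_dist R (cone_pt x r) (cone_pt y s))\<^sup>2 =
    (r - s)\<^sup>2 + 4 * r * s * (sin (min (torus_dist R x y) pi / 2))\<^sup>2"
    and "0 \<le> cone_dist R (cone_pt x r) (cone_pt y s)"
proof -
  let ?c = "cos (min (torus_dist R x y) pi)"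
  have e: "r\<^sup>2 + s\<^sup>2 - 2 * r * s * ?c = (r - s)\<^sup>2 + 4 * r * s * (sin (min (torus_dist R x y) pi / 2))\<^sup>2"
    by (subst cos_eq_sin_half) (simp add: power2_eq_square algebra_simps)
  have "cone_dist R (cone_pt x r) (cone_pt y s) = sqrt (r\<^sup>2 + s\<^sup>2 - 2 * r * s * ?c)"
    unfolding cone_pt_def using assms by (simp add: cone_dist.abs_eq cone_rel_refl)
  with e assms show "(cone_dist R (cone_pt x r) (cone_pt y s))\<^sup>2 =
    (r - s)\<^sup>2 + 4 * r * s * (sin (min (torus_dist R x y) pi / 2))\<^sup>2"
    "0 \<le> cone_dist R (cone_pt x r) (cone_pt y s)" by simp_all
qed

lemma cone_dist_sq:
  "(cone_dist R z w)\<^sup>2 = (cone_r z - cone_r w)\<^sup>2 + 4 * cone_r z * cone_r w *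
     (sin (min (torus_dist R (cone_x xbar z) (cone_x xbar w)) pi / 2))\<^sup>2"
  by (metis cone_dist_cone_pt_sq(1) cone_pt_cone_x_cone_r cone_r_nonneg)

lemma cone_dist_nonneg [simp]: "0 \<le> cone_dist R z w"
  by (metis cone_dist_cone_pt_sq(2) cone_pt_cone_x_cone_r cone_r_nonneg)

lemma cone_dist_commute: "cone_dist R z w = cone_dist R w z"
proof (rule power2_eq_imp_eq)
  show "(cone_dist R z w)\<^sup>2 = (cone_dist R w z)\<^sup>2"
    unfolding cone_dist_sq[of _ _ _ undefined]
    by (simp add: torus_dist_commute power2_commute algebra_simps)
qed simp_all

lemma cone_r_diff_le: "\<bar>cone_r z - cone_r w\<bar> \<le> cone_dist R z w"
  by (rule power2_le_imp_le) (simp_all add: cone_dist_sq[of _ _ _ undefined])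

lemma cone_dist_apex [simp]: "cone_dist R z apex = cone_r z"
  by (rule power2_eq_imp_eq) (simp_all add: cone_dist_sq[of _ _ _ undefined])

lemma cmod_rcis_diff_sq:
  "(cmod (rcis r a - rcis s b))\<^sup>2 = (r - s)\<^sup>2 + 4 * r * s * (sin ((a - b) / 2))\<^sup>2"
proof -
  have sin: "sin c * sin c = 1 - cos c * cos c" for c :: real
    using sin_squared_eq[of c] by (simp add: power2_eq_square)
  have "(cmod (rcis r a - rcis s b))\<^sup>2 = r\<^sup>2 + s\<^sup>2 - 2 * r * s * cos (a - b)"
    unfolding cmod_power2 by (simp add: cos_diff power2_eq_square algebra_simps sin)
  also have "\<dots> = (r - s)\<^sup>2 + 4 * r * s * (sin ((a - b) / 2))\<^sup>2"
    by (simp only: cos_eq_sin_half[of "a - b"]) (simp add: power2_eq_square algebra_simps)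
  finally show ?thesis .
qed

lemma sin_half_mono:
  assumes "\<bar>a\<bar> \<le> b" "b \<le> pi"
  shows "(sin (a / 2))\<^sup>2 \<le> (sin (b / 2))\<^sup>2"
proof -
  have "(sin (a / 2))\<^sup>2 = (sin (\<bar>a\<bar> / 2))\<^sup>2" by (cases "a \<ge> 0") simp_all
  also have "\<dots> \<le> (sin (b / 2))\<^sup>2"
    using assms by (intro power_mono sin_monotone_2pi_le sin_ge_zero) auto
  finally show ?thesis .
qed

text \<open>A triangle in the cone is compared with the planar triangle whose angle at the origin is
  \<open>min (a + b) pi\<close>.\<close>

lemma cone_dist_triangle: "cone_dist R z1 z3 \<le> cone_dist R z1 z2 + cone_dist R z2 z3"
proof -
  define x where "x z = cone_x undefined z" for z
  define a where "a = min (torus_dist R (x z1) (x z2)) pi"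
  define b where "b = min (torus_dist R (x z2) (x z3)) pi"
  \<comment> \<open>Shrinking b keeps a + b' in the range where the squared half-sine increases, and
    can only shorten the planar side that replaces the one from z2 to z3.\<close>
  define b' where "b' = min b (pi - a)"
  define c where "c = min (torus_dist R (x z1) (x z3)) pi"
  have ab: "0 \<le> a" "a \<le> pi" "0 \<le> b" "b \<le> pi" by (auto simp: a_def b_def)
  have c: "0 \<le> c" "c \<le> a + b'"
    using torus_dist_triangle[of R "x z1" "x z3" "x z2"] ab torus_dist_nonneg[of R]
    unfolding c_def b'_def a_def b_def min_def by (smt (verit))+
  note sq = cone_dist_sq[of R _ _ undefined, folded x_def]
  have "cone_dist R z1 z3 \<le> cmod (rcis (cone_r z1) 0 - rcis (cone_r z3) (a + b'))"
  proof (rule power2_le_imp_le)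
    show "(cone_dist R z1 z3)\<^sup>2 \<le> (cmod (rcis (cone_r z1) 0 - rcis (cone_r z3) (a + b')))\<^sup>2"
      unfolding sq cmod_rcis_diff_sq c_def[symmetric]
    proof (intro add_mono order_refl mult_left_mono)
      have "(0 - (a + b')) / 2 = - ((a + b') / 2)" by (simp only: diff_0 minus_divide_left)
      moreover have "(sin (c / 2))\<^sup>2 \<le> (sin ((a + b') / 2))\<^sup>2"
        by (rule sin_half_mono) (use c in \<open>auto simp: b'_def\<close>)
      ultimately show "(sin (c / 2))\<^sup>2 \<le> (sin ((0 - (a + b')) / 2))\<^sup>2"
        by (simp only: sin_minus power2_minus)
    qed simp_all
  qed simp
  also have "\<dots> \<le> cmod (rcis (cone_r z1) 0 - rcis (cone_r z2) a) + cmod (rcis (cone_r z2) a - rcis (cone_r z3) (a + b'))"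
    using norm_triangle_ineq[of "rcis (cone_r z1) 0 - rcis (cone_r z2) a" "rcis (cone_r z2) a - rcis (cone_r z3) (a + b')"]
    by simp
  also have "cmod (rcis (cone_r z1) 0 - rcis (cone_r z2) a) \<le> cone_dist R z1 z2"
  proof (rule power2_le_imp_le)
    have "(0 - a) / 2 = - (a / 2)" by (simp only: diff_0 minus_divide_left)
    then show "(cmod (rcis (cone_r z1) 0 - rcis (cone_r z2) a))\<^sup>2 \<le> (cone_dist R z1 z2)\<^sup>2"
      unfolding sq cmod_rcis_diff_sq a_def[symmetric] by (simp only: sin_minus power2_minus order_refl)
  qed simp
  also have "cmod (rcis (cone_r z2) a - rcis (cone_r z3) (a + b')) \<le> cone_dist R z2 z3"
  proof (rule power2_le_imp_le)
    show "(cmod (rcis (cone_r z2) a - rcis (cone_r z3) (a + b')))\<^sup>2 \<le> (cone_dist R z2 z3)\<^sup>2"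
      unfolding sq cmod_rcis_diff_sq b_def[symmetric]
      using sin_half_mono[of b' b] ab
      by (intro add_mono order_refl mult_left_mono) (auto simp: b'_def)
  qed simp
  finally show ?thesis by simp
qed

lemma cone_dist_eq_0_iff:
  assumes "R > 0"
  shows "cone_dist R z w = 0 \<longleftrightarrow> z = w"
proof
  assume "cone_dist R z w = 0"
  then have "0 = (cone_dist R z w)\<^sup>2" by simp
  then have r: "cone_r z = cone_r w" and s: "cone_r z * cone_r w *
     (sin (min (torus_dist R (cone_x undefined z) (cone_x undefined w)) pi / 2))\<^sup>2 = 0"
    unfolding cone_dist_sq[of R _ _ undefined]
    by (auto simp: add_nonneg_eq_0_iff)
  show "z = w"
  proof (cases "cone_r z = 0")
    case True
    then show ?thesis
      using r by (metis apex_eq cone_pt_cone_x_cone_r)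
  next
    case False
    let ?d = "torus_dist R (cone_x undefined z) (cone_x undefined w)"
    have "sin (min ?d pi / 2) = 0" using s r False by simp
    then have "min ?d pi = 0"
      using sin_gt_zero_02 sin_gt_zero[of "min ?d pi / 2"] by (smt (verit) pi_gt_zero field_sum_of_halves torus_dist_nonneg)
    then have "?d = 0" by (auto simp: min_def split: if_splits)
    then have "cone_x undefined z = cone_x undefined w" by (simp add: torus_dist_eq_0_iff[OF assms])
    then show ?thesis using r by (metis cone_pt_cone_x_cone_r)
  qed
qed (use cone_dist_sq[of R z z undefined] in simp)

lemma Metric_space_cone: "R > 0 \<Longrightarrow> Metric_space UNIV (cone_dist R)"
  by unfold_locales (auto simp: cone_dist_commute cone_dist_eq_0_iff cone_dist_triangle)

lemma mspace_cone_metric [simp]: "R > 0 \<Longrightarrow> mspace (cone_metric R) = UNIV"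
  and mdist_cone_metric [simp]: "R > 0 \<Longrightarrow> mdist (cone_metric R) = cone_dist R"
  by (simp_all add: cone_metric_def Metric_space_cone Metric_space.mspace_metric Metric_space.mdist_metric)

section \<open>The action bounds the energy of inscribed chains\<close>

text \<open>A crude Jordan inequality. Up to pi / 3 the derivative cos y - 1 / 2 is nonnegative;
  beyond, sin x is at least sqrt 3 / 2 and thus at least 0.85, while x / 2 is at most 0.8.\<close>

lemma sin_ge_half:
  assumes "0 \<le> x" "x \<le> pi / 2"
  shows "x / 2 \<le> sin x"
proof (cases "x \<le> pi / 3")
  case True
  have "(\<lambda>y. sin y - y / 2) 0 \<le> (\<lambda>y. sin y - y / 2) x"
  proof (rule DERIV_nonneg_imp_nondecreasing[OF assms(1)])
    fix y assume y: "0 \<le> y" "y \<le> x"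
    have "cos (pi / 3) \<le> cos y" using y True by (intro cos_monotone_0_pi_le) auto
    then show "\<exists>d. ((\<lambda>y. sin y - y / 2) has_real_derivative d) (at y) \<and> 0 \<le> d"
      by (intro exI[of _ "cos y - 1 / 2"]) (auto intro!: derivative_eq_intros simp: cos_60)
  qed
  then show ?thesis by simp
next
  case False
  have "sin (pi / 3) \<le> sin x" using False assms by (intro sin_monotone_2pi_le) auto
  moreover have "17 / 10 \<le> sqrt 3" by (rule real_le_rsqrt) (simp add: power2_eq_square)
  moreover have "x \<le> 16 / 10" using assms(2) pi_approx by (simp add: field_simps)
  ultimately show ?thesis by (simp add: sin_60)
qed

lemma sin_half_sq_le: "(sin (a / 2))\<^sup>2 \<le> a\<^sup>2 / 4" for a :: real
  using power_mono[OF abs_sin_x_le_abs_x[of "a / 2"], of 2] by (simp add: power_divide)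

text \<open>The squared sine is replaced by its quadratic majorant. Divided by the square of a time
  step, the right-hand side converges to \<open>speed2\<close>.\<close>

lemma cone_dist_sq_le:
  assumes "torus_of (p + v) = cone_x xbar w" "torus_of p = cone_x xbar z"
  shows "(cone_dist R z w)\<^sup>2 \<le> (cone_r z - cone_r w)\<^sup>2 + cone_r z * cone_r w * gnorm2 R v"
proof -
  let ?d = "torus_dist R (cone_x xbar z) (cone_x xbar w)"
  have "?d \<le> gnorm R v" using torus_dist_le[OF assms(1)] assms(2) by simp
  then have "min ?d pi ^ 2 \<le> (gnorm R v)\<^sup>2" by (intro power_mono) auto
  then have "(sin (min ?d pi / 2))\<^sup>2 \<le> gnorm2 R v / 4"
    using sin_half_sq_le[of "min ?d pi"] by (simp add: gnorm_sq)
  then have "4 * (cone_r z * cone_r w) * (sin (min ?d pi / 2))\<^sup>2 \<le> 4 * (cone_r z * cone_r w) * (gnorm2 R v / 4)"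
    by (intro mult_left_mono) auto
  then show ?thesis by (simp add: cone_dist_sq[of R z w xbar] mult.assoc)
qed

text \<open>The planar point with the radius of z and the i-th torus coordinate as angle. Passing to
  the exponential removes the dependence on the representative, and the factor r that on the value
  at the apex. Unlike the coordinates themselves, these maps are Lipschitz on the cone, so they
  carry absolute continuity over to the angles.\<close>

definition cone_proj :: "torus \<Rightarrow> 2 \<Rightarrow> cone \<Rightarrow> complex" where
  "cone_proj xbar i z = rcis (cone_r z) (rep_torus (cone_x xbar z) $ i)"

lemma cis_rep_torus:
  assumes "torus_of p = x"
  shows "cis (rep_torus x $ i) = cis (p $ i)"
proof -
  have "period_rel (rep_torus x) p"
    using assms torus_of_eq_iff Quotient3_abs_rep[OF Quotient3_torus, of x] by metis
  then obtain k :: int where "rep_torus x $ i = p $ i + 2 * pi * of_int k"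
    unfolding period_rel_def by (metis add.commute diff_eq_eq)
  then show ?thesis using sin_cos_eq_iff[of "rep_torus x $ i" "p $ i"] by (auto simp: complex_eq_iff)
qed

lemma cone_proj_eq: "torus_of p = cone_x xbar z \<Longrightarrow> cone_proj xbar i z = rcis (cone_r z) (p $ i)"
  by (simp add: cone_proj_def rcis_def cis_rep_torus)

text \<open>The components of the shortest displacement are at most 1 + 1 / R times its
  \<open>gnorm\<close>. The extra factor 2 is the loss of \<open>sin_ge_half\<close> when the
  squared sines are compared.\<close>

lemma cone_proj_Lipschitz:
  assumes "R > 0"
  shows "cmod (cone_proj xbar i z - cone_proj xbar i w) \<le> 2 * (1 + 1 / R) * cone_dist R z w"
proof (rule power2_le_imp_le)
  obtain p where p: "cone_x xbar z = torus_of p" by (rule torus_cases)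
  obtain v where v: "torus_of (p + v) = cone_x xbar w" "torus_dist R (cone_x xbar z) (cone_x xbar w) = gnorm R v"
    unfolding p by (rule torus_dist_attained)
  define c where "c = 1 + 1 / R"
  have c: "c \<ge> 1" using assms by (simp add: c_def)
  have c2: "1 \<le> (2 * c)\<^sup>2" by (rule one_le_power) (use c in simp)
  have vi: "\<bar>v $ i\<bar> \<le> c * gnorm R v"
  proof -
    have "\<bar>v $ 1\<bar> \<le> 1 * gnorm R v" using gnorm_component_le(1)[of v R] by simp
    also have "\<dots> \<le> c * gnorm R v" using c by (intro mult_right_mono) auto
    finally have 1: "\<bar>v $ 1\<bar> \<le> c * gnorm R v" .
    have "\<bar>v $ 2\<bar> \<le> 1 / R * gnorm R v" using gnorm_component_le(2)[of R v] assms by (simp add: field_simps)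
    also have "\<dots> \<le> c * gnorm R v" by (intro mult_right_mono) (auto simp: c_def)
    finally show ?thesis using 1 exhaust_2[of i] by auto
  qed
  have "(sin (v $ i / 2))\<^sup>2 \<le> (2 * c)\<^sup>2 * (sin (min (gnorm R v) pi / 2))\<^sup>2"
  proof (cases "gnorm R v \<le> pi")
    case True
    have "(sin (v $ i / 2))\<^sup>2 \<le> (v $ i)\<^sup>2 / 4" by (rule sin_half_sq_le)
    also have "\<dots> \<le> (c * gnorm R v)\<^sup>2 / 4" using power_mono[OF vi, of 2] by simp
    also have "\<dots> = (2 * c)\<^sup>2 * (gnorm R v / 2 / 2)\<^sup>2" by (simp add: power_mult_distrib power_divide)
    also have "\<dots> \<le> (2 * c)\<^sup>2 * (sin (gnorm R v / 2))\<^sup>2"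
      using sin_ge_half[of "gnorm R v / 2"] True by (intro mult_left_mono power_mono) auto
    finally show ?thesis using True by simp
  next
    case False
    have "(sin (v $ i / 2))\<^sup>2 \<le> 1" using abs_sin_le_one abs_square_le_1 by blast
    also note c2
    finally show ?thesis using False by simp
  qed
  then have *: "4 * cone_r z * cone_r w * (sin (v $ i / 2))\<^sup>2
      \<le> 4 * cone_r z * cone_r w * ((2 * c)\<^sup>2 * (sin (min (gnorm R v) pi / 2))\<^sup>2)"
    by (intro mult_left_mono) auto
  have "(cmod (cone_proj xbar i z - cone_proj xbar i w))\<^sup>2 =
      (cone_r z - cone_r w)\<^sup>2 + 4 * cone_r z * cone_r w * (sin (v $ i / 2))\<^sup>2"
  proof -
    have "(p $ i - (p + v) $ i) / 2 = - (v $ i / 2)" by simp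
    then have "(sin ((p $ i - (p + v) $ i) / 2))\<^sup>2 = (sin (v $ i / 2))\<^sup>2"
      by (simp only: sin_minus power2_minus)
    then show ?thesis
      using cmod_rcis_diff_sq[of "cone_r z" "p $ i" "cone_r w" "(p + v) $ i"]
      by (simp only: cone_proj_eq[OF p[symmetric]] cone_proj_eq[OF v(1)])
  qed
  also have "\<dots> \<le> (2 * c)\<^sup>2 * (cone_r z - cone_r w)\<^sup>2 + 4 * cone_r z * cone_r w * ((2 * c)\<^sup>2 * (sin (min (gnorm R v) pi / 2))\<^sup>2)"
  proof -
    have "1 * (cone_r z - cone_r w)\<^sup>2 \<le> (2 * c)\<^sup>2 * (cone_r z - cone_r w)\<^sup>2"
      using c2 by (intro mult_right_mono) auto
    then show ?thesis using add_mono[OF _ *] by (simp only: mult_1)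
  qed
  also have "\<dots> = (2 * c * cone_dist R z w)\<^sup>2"
    unfolding power_mult_distrib[of "2 * c"] cone_dist_sq[of R z w xbar] v(2) by (simp add: algebra_simps)
  finally show "(cmod (cone_proj xbar i z - cone_proj xbar i w))\<^sup>2 \<le> (2 * (1 + 1 / R) * cone_dist R z w)\<^sup>2"
    by (simp add: c_def)
qed (use assms in simp)

text \<open>The difference of two local lifts takes values in the lattice and is continuous at t,
  hence is constant nearby. This gives the description operator in \<open>speed2\<close> its
  meaning.\<close>

lemma torus_has_velocity_unique:
  assumes "T > 0" and t: "t \<in> {0..T}"
    and v: "torus_has_velocity T x v t" and w: "torus_has_velocity T x w t"
  shows "v = w"
proof -
  from v obtain c where c: "torus_of (c t) = x t" "\<forall>\<^sub>F s in at t within {0..T}. torus_of (c s) = x s"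
    "(c has_vector_derivative v) (at t within {0..T})" unfolding torus_has_velocity_def by blast
  from w obtain d where d: "torus_of (d t) = x t" "\<forall>\<^sub>F s in at t within {0..T}. torus_of (d s) = x s"
    "(d has_vector_derivative w) (at t within {0..T})" unfolding torus_has_velocity_def by blast
  define e where "e s = c s - d s" for s
  have e: "(e has_vector_derivative v - w) (at t within {0..T})"
    unfolding e_def[abs_def] using c(3) d(3) by (rule has_vector_derivative_diff)
  have "(e \<longlongrightarrow> e t) (at t within {0..T})"
    using has_vector_derivative_continuous[OF e] by (simp add: continuous_within)
  then have "\<forall>\<^sub>F s in at t within {0..T}. dist (e s) (e t) < 2 * pi"
    by (rule tendstoD) simp
  with c(2) d(2) have "\<forall>\<^sub>F s in at t within {0..T}. e s = e t"
  proof eventually_elim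
    case (elim s)
    have "e s $ i = e t $ i" for i
    proof -
      obtain k l :: int where kl: "e s $ i = 2 * pi * of_int k" "e t $ i = 2 * pi * of_int l"
        using elim(1,2) c(1) d(1) torus_of_eq_iff[of "c s" "d s"] torus_of_eq_iff[of "c t" "d t"]
        unfolding period_rel_def e_def by (metis vector_minus_component)
      have "\<bar>e s $ i - e t $ i\<bar> < 2 * pi"
        using component_le_norm_cart[of "e s - e t" i] elim(3) by (simp add: dist_norm)
      also have "e s $ i - e t $ i = 2 * pi * of_int (k - l)" by (simp add: kl algebra_simps)
      finally have "\<bar>real_of_int (k - l)\<bar> < 1" by (simp add: abs_mult)
      then have "k = l" by linarith
      then show ?thesis using kl by simp
    qed
    then show ?case by (simp add: vec_eq_iff)
  qed
  then have ev: "\<forall>\<^sub>F s in at t within {0..T}. e t = e s" by (rule eventually_mono) simp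
  have "((\<lambda>s. e t) has_derivative (\<lambda>h. h *\<^sub>R 0)) (at t within {0..T})" by simp
  from has_derivative_transform_eventually[OF this ev refl t]
  have "(e has_vector_derivative 0) (at t within {0..T})"
    unfolding has_vector_derivative_def .
  with e have "v - w = 0"
    by (intro vector_derivative_unique_within_closed_interval[of 0 T t e "v - w" 0]) (use t \<open>T > 0\<close> in simp_all)
  then show ?thesis by simp
qed

lemma speed2_nonneg: "0 \<le> speed2 R T xbar z t"
  by (simp add: speed2_def Let_def gnorm2_def)

text \<open>At a point where the path leaves the apex, a lift to the plane is read off from the
  arguments of \<open>cone_proj\<close>.\<close>

lemma derivative_sq_le_speed2:
  fixes z :: "real \<Rightarrow> cone"
  assumes R: "R > 0" and u: "0 < u" "u < T"
    and r: "((\<lambda>s. cone_r (z s)) has_real_derivative r') (at u)"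
    and W: "\<And>i. ((\<lambda>s. cone_proj xbar i (z s)) has_vector_derivative w i) (at u)"
    and f: "(f has_real_derivative f') (at u)"
    and fd: "\<And>s. s \<in> {0..T} \<Longrightarrow> \<bar>f s - f u\<bar> \<le> cone_dist R (z u) (z s)"
  shows "f'\<^sup>2 \<le> speed2 R T xbar z u"
proof -
  have within: "at u within {0..T} = at u" using u by (rule at_within_Icc_at)
  have ev: "\<forall>\<^sub>F s in at u. s \<in> {0..T} \<and> s \<noteq> u"
    using eventually_at_in_open[of "{0<..<T}" u] u by (auto elim: eventually_mono)
  define Q where "Q g s = (g s - g u) / (s - u)" for g :: "real \<Rightarrow> real" and s
  have Q: "(Q g \<longlongrightarrow> g') (at u)" if "(g has_real_derivative g') (at u)" for g g'
    using that unfolding Q_def[abs_def] has_field_derivative_iff .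
  show ?thesis
  proof (cases "cone_r (z u) = 0")
    case True
    then have zu: "z u = apex" by (metis apex_eq cone_pt_cone_x_cone_r)
    \<comment> \<open>At the apex the radius is minimal, so r' = 0. Increments of f are bounded by
      the radius there, which forces f' = 0, in accordance with the value 0 of
      \<open>speed2\<close>.\<close>
    have "r' = 0"
      by (rule DERIV_local_min[OF r, of 1]) (simp_all add: True)
    have "f'\<^sup>2 \<le> r'\<^sup>2"
    proof (rule tendsto_le)
      show "((\<lambda>s. (Q f s)\<^sup>2) \<longlongrightarrow> f'\<^sup>2) (at u)" by (intro tendsto_intros Q f)
      show "((\<lambda>s. (Q (\<lambda>s. cone_r (z s)) s)\<^sup>2) \<longlongrightarrow> r'\<^sup>2) (at u)" by (intro tendsto_intros Q r)
      show "\<forall>\<^sub>F s in at u. (Q f s)\<^sup>2 \<le> (Q (\<lambda>s. cone_r (z s)) s)\<^sup>2"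
        using ev
      proof eventually_elim
        case (elim s)
        have "\<bar>f s - f u\<bar> \<le> cone_r (z s)" using fd[of s] elim by (simp add: zu cone_dist_commute[of R apex])
        then have "(f s - f u)\<^sup>2 \<le> (cone_r (z s))\<^sup>2" using abs_le_square_iff[of "f s - f u" "cone_r (z s)"] by simp
        then show ?case by (simp add: Q_def True power_divide divide_right_mono)
      qed
    qed simp
    then show ?thesis using \<open>r' = 0\<close> speed2_nonneg[of R T xbar z u] by simp
  next
    case False
    then have ru: "cone_r (z u) > 0" by (simp add: less_le)
    obtain p where p: "cone_x xbar (z u) = torus_of p" by (rule torus_cases)
    \<comment> \<open>At time u the quotient is 1, where the principal logarithm is differentiable;
      the imaginary part of \<open>Ln (q i s)\<close> is the angle travelled since u, up to
      multiples of 2 pi.\<close>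
    define q where "q i s = cone_proj xbar i (z s) / cone_proj xbar i (z u)" for i s
    define c where "c s = p + Im (Ln (q 1 s)) *\<^sub>R axis 1 1 + Im (Ln (q 2 s)) *\<^sub>R axis 2 1" for s
    have c_i: "c s $ i = p $ i + Im (Ln (q i s))" for s i
      using exhaust_2[of i] by (auto simp: c_def axis_def)
    have Wu: "cone_proj xbar i (z u) \<noteq> 0" for i
      using False by (simp add: cone_proj_def)
    have qu: "q i u = 1" for i using Wu by (simp add: q_def)
    have cu: "c u = p" by (simp add: vec_eq_iff c_i qu)
    have lift: "torus_of (c s) = cone_x xbar (z s)" if s: "cone_r (z s) > 0" for s
    proof -
      obtain p' where p': "cone_x xbar (z s) = torus_of p'" by (rule torus_cases)
      have "period_rel (c s) p'"
        unfolding period_rel_def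
      proof
        fix i
        have q: "q i s = rcis (cone_r (z s) / cone_r (z u)) (p' $ i - p $ i)"
          by (simp add: q_def cone_proj_eq[OF p'[symmetric]] cone_proj_eq[OF p[symmetric]] rcis_divide)
        then have "q i s \<noteq> 0" using s ru by simp
        then have "cis (Im (Ln (q i s))) = sgn (q i s)" by (simp add: cis_Arg flip: Arg_eq_Im_Ln)
        also have "\<dots> = cis (p' $ i - p $ i)"
          using s ru by (simp add: q rcis_def sgn_mult sgn_of_real)
        finally obtain k :: int where "Im (Ln (q i s)) = p' $ i - p $ i + 2 * pi * of_int k"
          using sin_cos_eq_iff by (metis cis.sel)
        then show "\<exists>k::int. c s $ i - p' $ i = 2 * pi * of_int k" by (auto simp: c_i)
      qed
      then show ?thesis by (simp add: p' torus_of_eq_iff)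
    qed
    have LV: "((\<lambda>s. Ln (q i s)) has_vector_derivative w i / cone_proj xbar i (z u)) (at u)" for i
    proof -
      have "((\<lambda>s. q i s) has_vector_derivative w i / cone_proj xbar i (z u)) (at u)"
        unfolding q_def divide_inverse by (rule has_vector_derivative_mult_left[OF W])
      moreover have "(Ln has_field_derivative inverse (q i u)) (at (q i u))"
        by (rule has_field_derivative_Ln) (simp add: qu)
      ultimately have "((Ln \<circ> q i) has_vector_derivative w i / cone_proj xbar i (z u) * inverse (q i u)) (at u)"
        by (rule field_vector_diff_chain_at)
      then show ?thesis by (simp add: o_def qu)
    qed
    have Lq: "((\<lambda>s. Im (Ln (q i s))) has_real_derivative Im (w i / cone_proj xbar i (z u))) (at u)" for i
      using LV[of i] by (simp add: has_vector_derivative_complex_iff)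
    define v where "v = Im (w 1 / cone_proj xbar 1 (z u)) *\<^sub>R axis 1 1 + Im (w 2 / cone_proj xbar 2 (z u)) *\<^sub>R (axis 2 1 :: real^2)"
    have v_i: "v $ i = Im (w i / cone_proj xbar i (z u))" for i
      using exhaust_2[of i] by (auto simp: v_def axis_def)
    have cv: "(c has_vector_derivative v) (at u)"
      unfolding c_def[abs_def] v_def
      by (auto intro!: derivative_eq_intros LV)
    have rpos: "\<forall>\<^sub>F s in at u. cone_r (z s) > 0"
      using order_tendstoD(1)[OF DERIV_isCont[OF r, unfolded isCont_def] ru] .
    have vel: "torus_has_velocity T (\<lambda>s. cone_x xbar (z s)) v u"
      unfolding torus_has_velocity_def within
      by (intro exI[of _ c] conjI cv lift ru eventually_mono[OF rpos lift])
    have the: "(THE v. torus_has_velocity T (\<lambda>s. cone_x xbar (z s)) v u) = v"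
    proof (rule the_equality)
      show "v' = v" if "torus_has_velocity T (\<lambda>s. cone_x xbar (z s)) v' u" for v'
        by (rule torus_has_velocity_unique[OF _ _ that vel]) (use u in auto)
    qed (rule vel)
    have sp: "speed2 R T xbar z u = (cone_r (z u))\<^sup>2 * gnorm2 R v + r'\<^sup>2"
    proof -
      have "(\<lambda>s. cone_r (z s)) differentiable (at u within {0..T})"
        unfolding within using r by (auto simp: has_field_derivative_def differentiable_def)
      moreover have "vector_derivative (\<lambda>s. cone_r (z s)) (at u within {0..T}) = r'"
        unfolding within using r by (simp add: has_real_derivative_iff_has_vector_derivative vector_derivative_at)
      ultimately show ?thesis
        using vel ru by (auto simp: speed2_def Let_def the)
    qed
    have ci: "((\<lambda>s. c s $ i) has_real_derivative v $ i) (at u)" for i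
      unfolding c_i v_i using DERIV_add[OF DERIV_const Lq] by simp
    have "f'\<^sup>2 \<le> r'\<^sup>2 + cone_r (z u) * cone_r (z u) * ((v $ 1)\<^sup>2 + R\<^sup>2 * (v $ 2)\<^sup>2)"
    \<comment> \<open>The squared difference quotients of f are bounded by
      \<open>cone_dist_sq_le\<close> along the lift c, and this bound passes to the limit.\<close>
    proof (rule tendsto_le)
      show "((\<lambda>s. (Q f s)\<^sup>2) \<longlongrightarrow> f'\<^sup>2) (at u)" by (intro tendsto_intros Q f)
      show "((\<lambda>s. (Q (\<lambda>s. cone_r (z s)) s)\<^sup>2 + cone_r (z u) * cone_r (z s) *
          ((Q (\<lambda>s. c s $ 1) s)\<^sup>2 + R\<^sup>2 * (Q (\<lambda>s. c s $ 2) s)\<^sup>2)) \<longlongrightarrow>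
          r'\<^sup>2 + cone_r (z u) * cone_r (z u) * ((v $ 1)\<^sup>2 + R\<^sup>2 * (v $ 2)\<^sup>2)) (at u)"
        by (intro tendsto_intros Q r ci DERIV_isCont[OF r, unfolded isCont_def])
      show "\<forall>\<^sub>F s in at u. (Q f s)\<^sup>2 \<le> (Q (\<lambda>s. cone_r (z s)) s)\<^sup>2 + cone_r (z u) * cone_r (z s) *
          ((Q (\<lambda>s. c s $ 1) s)\<^sup>2 + R\<^sup>2 * (Q (\<lambda>s. c s $ 2) s)\<^sup>2)"
        using ev rpos
      proof eventually_elim
        case (elim s)
        have "(f s - f u)\<^sup>2 \<le> (cone_dist R (z u) (z s))\<^sup>2"
          using abs_le_square_iff[of "f s - f u" "cone_dist R (z u) (z s)"] fd[of s] elim by simp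
        also have "\<dots> \<le> (cone_r (z u) - cone_r (z s))\<^sup>2 + cone_r (z u) * cone_r (z s) * gnorm2 R (c s - c u)"
          by (rule cone_dist_sq_le[of "c u"]) (use lift ru elim in auto)
        finally have "(f s - f u)\<^sup>2 / (s - u)\<^sup>2 \<le> ((cone_r (z u) - cone_r (z s))\<^sup>2 + cone_r (z u) * cone_r (z s) * gnorm2 R (c s - c u)) / (s - u)\<^sup>2"
          by (intro divide_right_mono) auto
        then show ?case
          unfolding Q_def gnorm2_def
          by (simp add: power_divide add_divide_distrib power2_commute[of "cone_r (z u)"] distrib_left)
      qed
    qed simp
    then show ?thesis by (simp add: sp gnorm2_def power2_eq_square algebra_simps)
  qed
qed


section \<open>Integrating the speed bound over a partition\<close>

lemma ennreal_integral_le_nn_integral: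
  fixes g :: "'a \<Rightarrow> real"
  assumes "integrable M g"
  shows "ennreal (integral\<^sup>L M g) \<le> (\<integral>\<^sup>+x. ennreal (g x) \<partial>M)"
proof -
  have i: "integrable M (\<lambda>x. max 0 (g x))" using assms by simp
  have "ennreal (integral\<^sup>L M g) \<le> ennreal (integral\<^sup>L M (\<lambda>x. max 0 (g x)))"
    by (intro ennreal_leI integral_mono assms i) auto
  also have "\<dots> = (\<integral>\<^sup>+x. ennreal (max 0 (g x)) \<partial>M)"
    by (rule nn_integral_eq_integral[symmetric, OF i]) auto
  also have "\<dots> = (\<integral>\<^sup>+x. ennreal (g x) \<partial>M)"
    by (rule nn_integral_cong) (auto simp: max_def ennreal_neg)
  finally show ?thesis .
qed

text \<open>The elementary inequality \<open>2 c x - c\<^sup>2 \<le> x\<^sup>2\<close> replaces Cauchy-Schwarz.\<close>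

lemma square_integral_le_nn_integral:
  fixes p :: "real \<Rightarrow> real"
  assumes p: "integrable lborel p" and "a < b"
  shows "ennreal ((LINT u:{a..b}|lborel. p u)\<^sup>2 / (b - a)) \<le> (\<integral>\<^sup>+u\<in>{a<..<b}. ennreal ((p u)\<^sup>2) \<partial>lborel)"
proof -
  define c where "c = (LINT u:{a..b}|lborel. p u) / (b - a)"
  have d: "(LINT u:{a..b}|lborel. p u) = c * (b - a)" using \<open>a < b\<close> by (simp add: c_def)
  have pm [measurable]: "p \<in> borel_measurable borel" using borel_measurable_integrable[OF p] by simp
  have ip: "integrable lborel (\<lambda>u. indicator {a<..<b} u * p u)"
    using set_integrable_of_integrable[OF p, of "{a<..<b}"] by (simp add: set_integrable_def)
  have i1: "integrable lborel (indicator {a<..<b} :: real \<Rightarrow> real)"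
    using \<open>a < b\<close> by (intro integrable_real_indicator) auto
  have eq: "(LINT u|lborel. indicator {a<..<b} u * p u) = c * (b - a)"
  proof -
    have "AE u in lborel. indicator {a<..<b} u * p u = indicator {a..b} u *\<^sub>R p u"
      using AE_lborel_singleton[of a] AE_lborel_singleton[of b]
      by eventually_elim (auto simp: indicator_def)
    then show ?thesis
      unfolding d[symmetric] set_lebesgue_integral_def by (intro integral_cong_AE) auto
  qed
  have "(LINT u:{a..b}|lborel. p u)\<^sup>2 / (b - a) = 2 * c * (c * (b - a)) - c\<^sup>2 * (b - a)"
    using \<open>a < b\<close> by (simp add: d power2_eq_square field_simps)
  also have "\<dots> = (LINT u|lborel. 2 * c * (indicator {a<..<b} u * p u) - c\<^sup>2 * indicator {a<..<b} u)"
    using \<open>a < b\<close> ip i1 by (simp add: eq)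
  finally have "ennreal ((LINT u:{a..b}|lborel. p u)\<^sup>2 / (b - a)) \<le>
      (\<integral>\<^sup>+u. ennreal (2 * c * (indicator {a<..<b} u * p u) - c\<^sup>2 * indicator {a<..<b} u) \<partial>lborel)"
    using ennreal_integral_le_nn_integral[of lborel "\<lambda>u. 2 * c * (indicator {a<..<b} u * p u) - c\<^sup>2 * indicator {a<..<b} u"]
      ip i1 by simp
  also have "\<dots> \<le> (\<integral>\<^sup>+u\<in>{a<..<b}. ennreal ((p u)\<^sup>2) \<partial>lborel)"
  proof (rule nn_integral_mono)
    fix u
    have "0 \<le> (p u - c)\<^sup>2" by simp
    then have "2 * c * p u - c\<^sup>2 \<le> (p u)\<^sup>2" by (simp add: power2_eq_square algebra_simps)
    then show "ennreal (2 * c * (indicator {a<..<b} u * p u) - c\<^sup>2 * indicator {a<..<b} u)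
        \<le> ennreal ((p u)\<^sup>2) * indicator {a<..<b} u"
      by (auto simp: indicator_def intro!: ennreal_leI)
  qed
  finally show ?thesis .
qed

text \<open>Clamping the times to {0..T} and replacing the density by its absolute value, cut off
  outside {0..T}, produces the data on the whole line that
  \<open>absolutely_continuous_imp_AE_derivative\<close> expects.\<close>

lemma abs_cont_path_dominated:
  assumes "abs_cont_path R T z" "T > 0" "R > 0"
  obtains m where "integrable lborel m" "\<And>u. 0 \<le> m u"
    "\<And>s t. s \<le> t \<Longrightarrow> cone_dist R (z (max 0 (min T s))) (z (max 0 (min T t))) \<le> (LINT u:{s..t}|lborel. m u)"
proof -
  from assms(1) obtain m where m: "set_integrable lborel {0..T} m"
    "\<And>s t. 0 \<le> s \<Longrightarrow> s \<le> t \<Longrightarrow> t \<le> T \<Longrightarrow> cone_dist R (z s) (z t) \<le> (LINT u:{s..t}|lborel. m u)"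
    unfolding abs_cont_path_def by blast
  define m' where "m' u = \<bar>indicator {0..T} u * m u\<bar>" for u
  have m'i: "integrable lborel m'" using m(1) unfolding m'_def[abs_def] set_integrable_def by simp
  have m'si: "set_integrable lborel S m'" if "S \<in> sets borel" for S
    using m'i that by (rule set_integrable_of_integrable)
  show thesis
  proof (rule that[OF m'i])
    fix s t :: real assume "s \<le> t"
    define a where "a = max 0 (min T s)"
    define b where "b = max 0 (min T t)"
    have ab: "0 \<le> a" "a \<le> b" "b \<le> T" using \<open>s \<le> t\<close> \<open>T > 0\<close> by (auto simp: a_def b_def)
    have nonneg: "0 \<le> (LINT u:{s..t}|lborel. m' u)"
      unfolding set_lebesgue_integral_def by (rule Bochner_Integration.integral_nonneg) (simp add: m'_def)
    show "cone_dist R (z a) (z b) \<le> (LINT u:{s..t}|lborel. m' u)"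
    proof (cases "a = b")
      case True
      then show ?thesis using nonneg cone_dist_eq_0_iff[OF assms(3), of "z a" "z b"] by simp
    next
      case False
      then have sub: "{a..b} \<subseteq> {s..t}" using \<open>s \<le> t\<close> by (auto simp: a_def b_def max_def min_def split: if_splits)
      have "cone_dist R (z a) (z b) \<le> (LINT u:{a..b}|lborel. m u)" using m(2) ab by blast
      also have "\<dots> \<le> (LINT u:{a..b}|lborel. m' u)"
      proof (rule set_integral_mono)
        show "set_integrable lborel {a..b} m" by (rule set_integrable_subset[OF m(1)]) (use ab in auto)
        show "set_integrable lborel {a..b} m'" by (rule m'si) simp
        show "m u \<le> m' u" if "u \<in> {a..b}" for u using that ab by (simp add: m'_def)
      qed
      also have "\<dots> \<le> (LINT u:{s..t}|lborel. m' u)"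
        unfolding set_lebesgue_integral_def
      proof (rule integral_mono)
        show "indicator {a..b} u *\<^sub>R m' u \<le> indicator {s..t} u *\<^sub>R m' u" for u
          using subsetD[OF sub, of u] by (auto simp: indicator_def m'_def)
      qed (use m'si in \<open>auto simp: set_integrable_def\<close>)
      finally show ?thesis .
    qed
  qed (simp add: m'_def)
qed

text \<open>The action of a polygon through n + 1 equidistant nodes, each piece run at constant
  speed: squared distance over the step length T / n, summed.\<close>

definition chain_energy :: "real \<Rightarrow> real \<Rightarrow> nat \<Rightarrow> (real \<Rightarrow> cone) \<Rightarrow> real" where
  "chain_energy R T n z = real n / T *
     (\<Sum>k<n. (cone_dist R (z (T * real k / real n)) (z (T * real (Suc k) / real n)))\<^sup>2)"

text \<open>On each step, the distance to the left node starts at 0 and is absolutely continuous,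
  and its squared derivative is at most \<open>speed2\<close> almost everywhere.
  \<open>square_integral_le_nn_integral\<close> turns this into a bound for the squared distance
  over the step length.\<close>

theorem chain_energy_le_path_action:
  assumes R: "R > 0" and T: "T > 0" and n: "n > 0"
  shows "ennreal (chain_energy R T n z) \<le> path_action R T xbar z"
proof (cases "z \<in> AC2 R T")
  case False
  then show ?thesis by (simp add: path_action_def)
next
  case True
  define cl where "cl t = max 0 (min T t)" for t
  have "abs_cont_path R T z" using True by (simp add: AC2_def)
  then obtain m where m: "integrable lborel m" "\<And>u. 0 \<le> m u"
    "\<And>s t. s \<le> t \<Longrightarrow> cone_dist R (z (cl s)) (z (cl t)) \<le> (LINT u:{s..t}|lborel. m u)"
    unfolding cl_def using abs_cont_path_dominated T R by metis
  \<comment> \<open>A Lipschitz function of the path inherits the domination by m, and so is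
    differentiable almost everywhere; inside the open interval the clamping is the identity. The
    functions used are the radius, the components of \<open>cone_proj\<close> and the distances to
    the nodes.\<close>
  have AC: "\<exists>p. integrable lborel p \<and> (\<forall>s t. s \<le> t \<longrightarrow> g (z (cl t)) - g (z (cl s)) = (LINT u:{s..t}|lborel. p u)) \<and>
      (AE u in lborel. u \<in> {0<..<T} \<longrightarrow> ((\<lambda>s. g (z s)) has_real_derivative p u) (at u))"
    if g: "\<And>w w'. \<bar>g w - g w'\<bar> \<le> L * cone_dist R w w'" and "L \<ge> 0" for g :: "cone \<Rightarrow> real" and L
  proof -
    have bd: "\<bar>g (z (cl t)) - g (z (cl s))\<bar> \<le> (LINT u:{s..t}|lborel. L * m u)" if "s \<le> t" for s t
    proof -
      have "\<bar>g (z (cl t)) - g (z (cl s))\<bar> \<le> L * cone_dist R (z (cl s)) (z (cl t))"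
        using g[of "z (cl t)" "z (cl s)"] by (simp add: cone_dist_commute)
      also have "\<dots> \<le> L * (LINT u:{s..t}|lborel. m u)"
        using m(3)[OF that] \<open>L \<ge> 0\<close> by (rule mult_left_mono)
      finally show ?thesis by simp
    qed
    have Lm: "integrable lborel (\<lambda>u. L * m u)" "\<And>u. 0 \<le> L * m u" using m(1,2) \<open>L \<ge> 0\<close> by auto
    obtain p where p: "integrable lborel p"
       "\<And>s t. s \<le> t \<Longrightarrow> g (z (cl t)) - g (z (cl s)) = (LINT u:{s..t}|lborel. p u)"
       "AE u in lborel. ((\<lambda>s. g (z (cl s))) has_real_derivative p u) (at u)"
      using absolutely_continuous_imp_AE_derivative[OF Lm bd] by blast
    have "AE u in lborel. u \<in> {0<..<T} \<longrightarrow> ((\<lambda>s. g (z s)) has_real_derivative p u) (at u)"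
      using p(3)
    proof eventually_elim
      case (elim u)
      show ?case
      proof
        assume "u \<in> {0<..<T}"
        then show "((\<lambda>s. g (z s)) has_real_derivative p u) (at u)"
          by (rule has_field_derivative_transform_within_open[OF elim open_greaterThanLessThan])
            (auto simp: cl_def)
      qed
    qed
    with p show ?thesis by blast
  qed
  have r: "\<bar>cone_r w - cone_r w'\<bar> \<le> 1 * cone_dist R w w'" for w w' by (simp add: cone_r_diff_le)
  define L where "L = 2 * (1 + 1 / R)"
  have L: "L \<ge> 0" using R by (simp add: L_def)
  have Re: "\<bar>Re (cone_proj xbar i w) - Re (cone_proj xbar i w')\<bar> \<le> L * cone_dist R w w'"
    and Im: "\<bar>Im (cone_proj xbar i w) - Im (cone_proj xbar i w')\<bar> \<le> L * cone_dist R w w'" for i w w'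
    using cone_proj_Lipschitz[OF R, of xbar i w w'] abs_Re_le_cmod[of "cone_proj xbar i w - cone_proj xbar i w'"]
      abs_Im_le_cmod[of "cone_proj xbar i w - cone_proj xbar i w'"] by (simp_all add: L_def)
  have D: "\<bar>cone_dist R v w - cone_dist R v w'\<bar> \<le> 1 * cone_dist R w w'" for v w w'
    using cone_dist_triangle[of R v w w'] cone_dist_triangle[of R v w' w] cone_dist_commute[of R w w'] by simp
  obtain pr where pr: "AE u in lborel. u \<in> {0<..<T} \<longrightarrow> ((\<lambda>s. cone_r (z s)) has_real_derivative pr u) (at u)"
    using AC[OF r] by auto
  have "\<forall>i. \<exists>p. AE u in lborel. u \<in> {0<..<T} \<longrightarrow> ((\<lambda>s. Re (cone_proj xbar i (z s))) has_real_derivative p u) (at u)"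
    using AC[OF Re L] by blast
  from choice[OF this] obtain pR
    where pR: "\<And>i. AE u in lborel. u \<in> {0<..<T} \<longrightarrow> ((\<lambda>s. Re (cone_proj xbar i (z s))) has_real_derivative pR i u) (at u)"
    by blast
  have "\<forall>i. \<exists>p. AE u in lborel. u \<in> {0<..<T} \<longrightarrow> ((\<lambda>s. Im (cone_proj xbar i (z s))) has_real_derivative p u) (at u)"
    using AC[OF Im L] by blast
  from choice[OF this] obtain pI
    where pI: "\<And>i. AE u in lborel. u \<in> {0<..<T} \<longrightarrow> ((\<lambda>s. Im (cone_proj xbar i (z s))) has_real_derivative pI i u) (at u)"
    by blast
  define tk where "tk k = T * real k / real n" for k
  have tk: "tk k < tk (Suc k)" "tk (Suc k) - tk k = T / real n" "0 \<le> tk k" for k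
    using T n by (auto simp: tk_def field_simps)
  have tkT: "tk k \<le> T" if "k \<le> n" for k
    using that T n by (simp add: tk_def field_simps)
  have "\<forall>k. \<exists>p. integrable lborel p \<and>
      (\<forall>s t. s \<le> t \<longrightarrow> cone_dist R (z (tk k)) (z (cl t)) - cone_dist R (z (tk k)) (z (cl s)) = (LINT u:{s..t}|lborel. p u)) \<and>
      (AE u in lborel. u \<in> {0<..<T} \<longrightarrow> ((\<lambda>s. cone_dist R (z (tk k)) (z s)) has_real_derivative p u) (at u))"
    using AC[OF D] by simp
  from choice[OF this] obtain p where p: "\<And>k. integrable lborel (p k)"
     "\<And>k s t. s \<le> t \<Longrightarrow> cone_dist R (z (tk k)) (z (cl t)) - cone_dist R (z (tk k)) (z (cl s)) = (LINT u:{s..t}|lborel. p k u)"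
     "\<And>k. AE u in lborel. u \<in> {0<..<T} \<longrightarrow> ((\<lambda>s. cone_dist R (z (tk k)) (z s)) has_real_derivative p k u) (at u)"
    by blast
  have "AE u in lborel. \<forall>k. u \<in> {0<..<T} \<longrightarrow> ((\<lambda>s. cone_dist R (z (tk k)) (z s)) has_real_derivative p k u) (at u)"
    using p(3) by (simp only: AE_all_countable) blast
  with pr pR[of 1] pR[of 2] pI[of 1] pI[of 2]
  have speed: "AE u in lborel. u \<in> {0<..<T} \<longrightarrow> (\<forall>k. (p k u)\<^sup>2 \<le> speed2 R T xbar z u)"
  proof eventually_elim
    case (elim u)
    show ?case
    proof (intro impI allI)
      fix k assume u: "u \<in> {0<..<T}"
      show "(p k u)\<^sup>2 \<le> speed2 R T xbar z u"
      proof (rule derivative_sq_le_speed2[OF R])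
        show "((\<lambda>s. cone_r (z s)) has_real_derivative pr u) (at u)" using elim u by blast
        show "((\<lambda>s. cone_proj xbar i (z s)) has_vector_derivative Complex (pR i u) (pI i u)) (at u)" for i
          using exhaust_2[of i] elim u by (auto simp: has_vector_derivative_complex_iff)
        show "((\<lambda>s. cone_dist R (z (tk k)) (z s)) has_real_derivative p k u) (at u)" using elim u by blast
        show "\<bar>cone_dist R (z (tk k)) (z s) - cone_dist R (z (tk k)) (z u)\<bar> \<le> cone_dist R (z u) (z s)" for s
          using D[of "z (tk k)" "z s" "z u"] by (simp add: cone_dist_commute)
      qed (use u in auto)
    qed
  qed
  \<comment> \<open>The open steps are disjoint, so at every time at most one of the derivatives
    \<open>p k\<close> contributes to the sum.\<close>
  define I where "I k = {tk k<..<tk (Suc k)}" for k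
  have disj: "j = k" if "u \<in> I j" "u \<in> I k" for j k u
  proof -
    have "tk j < tk (Suc k)" "tk k < tk (Suc j)" using that by (auto simp: I_def)
    then have "real j < real (Suc k)" "real k < real (Suc j)"
      using T n by (auto simp: tk_def divide_less_cancel)
    then show ?thesis by linarith
  qed
  have "ennreal (chain_energy R T n z) = (\<Sum>k<n. ennreal ((LINT u:{tk k..tk (Suc k)}|lborel. p k u)\<^sup>2 / (tk (Suc k) - tk k)))"
  proof -
    have "(LINT u:{tk k..tk (Suc k)}|lborel. p k u) = cone_dist R (z (tk k)) (z (tk (Suc k)))" if "k < n" for k
    proof -
      have "cl (tk k) = tk k" "cl (tk (Suc k)) = tk (Suc k)"
        using tk(3) tkT[of k] tkT[of "Suc k"] that by (auto simp: cl_def)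
      then show ?thesis
        using p(2)[of "tk k" "tk (Suc k)" k] tk(1)[of k] cone_dist_eq_0_iff[OF R, of "z (tk k)" "z (tk k)"] by simp
    qed
    then have "(\<Sum>k<n. ennreal ((LINT u:{tk k..tk (Suc k)}|lborel. p k u)\<^sup>2 / (tk (Suc k) - tk k)))
        = (\<Sum>k<n. ennreal (real n / T * (cone_dist R (z (tk k)) (z (tk (Suc k))))\<^sup>2))"
      using T n by (intro sum.cong refl) (simp add: tk(2) field_simps)
    also have "\<dots> = ennreal (chain_energy R T n z)"
      using T n by (subst sum_ennreal) (auto simp: chain_energy_def sum_distrib_left tk_def)
    finally show ?thesis ..
  qed
  also have "\<dots> \<le> (\<Sum>k<n. \<integral>\<^sup>+u. ennreal ((p k u)\<^sup>2) * indicator (I k) u \<partial>lborel)"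
    unfolding I_def by (intro sum_mono square_integral_le_nn_integral p tk)
  also have "\<dots> = (\<integral>\<^sup>+u. (\<Sum>k<n. ennreal ((p k u)\<^sup>2) * indicator (I k) u) \<partial>lborel)"
  proof (rule nn_integral_sum[symmetric])
    fix k
    show "(\<lambda>u. ennreal ((p k u)\<^sup>2) * indicator (I k) u) \<in> borel_measurable lborel"
      using borel_measurable_integrable[OF p(1)[of k]] by (auto simp: I_def)
  qed
  also have "\<dots> \<le> (\<integral>\<^sup>+u\<in>{0..T}. ennreal (speed2 R T xbar z u) \<partial>lborel)"
  proof (rule nn_integral_mono_AE, use speed in eventually_elim)
    case (elim u)
    show ?case
    proof (cases "\<exists>k<n. u \<in> I k")
      case True
      then obtain k where k: "k < n" "u \<in> I k" by blast
      have "(\<Sum>j<n. ennreal ((p j u)\<^sup>2) * indicator (I j) u) = (\<Sum>j<n. if j = k then ennreal ((p k u)\<^sup>2) else 0)"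
        using disj k by (intro sum.cong refl) (auto simp: indicator_def)
      also have "\<dots> = ennreal ((p k u)\<^sup>2)" using k by simp
      finally have *: "(\<Sum>j<n. ennreal ((p j u)\<^sup>2) * indicator (I j) u) = ennreal ((p k u)\<^sup>2)" .
      have "u \<in> {0<..<T}"
        using k tk(3)[of k] tkT[of "Suc k"] by (auto simp: I_def)
      then show ?thesis using elim by (simp add: * ennreal_leI)
    next
      case False
      then have "(\<Sum>j<n. ennreal ((p j u)\<^sup>2) * indicator (I j) u) = 0"
        by (intro sum.neutral) auto
      then show ?thesis by simp
    qed
  qed
  also have "\<dots> = path_action R T xbar z" using True by (simp add: path_action_def)
  finally show ?thesis .
qed

section \<open>A discrete Wirtinger inequality\<close>

lemma four_sin_sq_half: "4 * (sin (a / 2))\<^sup>2 = 2 - 2 * cos a" for a :: real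
  using cos_eq_sin_half[of a] by simp

lemma sum_Suc_eq:
  fixes g :: "nat \<Rightarrow> real"
  assumes "g n = g 0"
  shows "(\<Sum>k<n. g (Suc k)) = (\<Sum>k<n. g k)"
  using sum.lessThan_Suc_shift[of g n] assms by simp

text \<open>A discrete Picone identity with the positive eigenfunction s k = sin (k pi / n): each
  squared increment exceeds \<open>f k + g (Suc k)\<close> by (y k * s (k + 1) - y (k + 1) * s k)^2
  / (s k * s (k + 1)). After an index shift f and g recombine, and the three-term recurrence of s
  yields the eigenvalue.\<close>

lemma discrete_Wirtinger_Dirichlet:
  fixes y :: "nat \<Rightarrow> real"
  assumes n: "n > 0" and y0: "y 0 = 0" and yn: "y n = 0"
  shows "(2 - 2 * cos (pi / real n)) * (\<Sum>k<n. (y k)\<^sup>2) \<le> (\<Sum>k<n. (y (Suc k) - y k)\<^sup>2)"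
proof -
  define a where "a = pi / real n"
  define s where "s x = sin (x * a)" for x :: real
  have spos: "s (real k) > 0" if "0 < k" "k < n" for k
    unfolding s_def using that by (intro sin_gt_zero) (auto simp: a_def field_simps)
  have sn: "s (real n) = 0" "s 0 = 0" using n by (simp_all add: s_def a_def)
  define g where "g k = (y k)\<^sup>2 * (1 - s (real k - 1) / s (real k))" for k
  define f where "f k = (y k)\<^sup>2 * (1 - s (real k + 1) / s (real k))" for k
  have step: "f k + g (Suc k) \<le> (y (Suc k) - y k)\<^sup>2" if "k < n" for k
  \<comment> \<open>Where s vanishes so does y, and the term with a zero denominator is multiplied
    by 0; the other one reduces to the squared increment.\<close>
  proof (cases "k = 0 \<or> Suc k = n")
    case True
    then show ?thesis using y0 yn sn by (auto simp: f_def g_def add.commute)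
  next
    case False
    then have k: "s (real k) > 0" "s (real (Suc k)) > 0" using that spos[of k] spos[of "Suc k"] by (simp_all del: of_nat_Suc)
    define p where "p = s (real k)"
    define q where "q = s (real (Suc k))"
    have e: "s (real (Suc k) - 1) = p" "s (real k + 1) = q" by (simp_all add: p_def q_def add.commute)
    have "(y (Suc k) - y k)\<^sup>2 - (f k + g (Suc k)) = (y k * q - y (Suc k) * p)\<^sup>2 / (p * q)"
      unfolding f_def g_def e p_def[symmetric] q_def[symmetric]
      using k[folded p_def q_def] by (simp add: field_simps power2_eq_square)
    also have "\<dots> \<ge> 0" using k by (simp add: p_def q_def)
    finally show ?thesis by simp
  qed
  have mid: "f k + g k = (2 - 2 * cos a) * (y k)\<^sup>2" if "k < n" for k
  proof (cases "k = 0")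
    case True
    then show ?thesis using y0 by (simp add: f_def g_def)
  next
    case False
    then have sk: "s (real k) > 0" using spos that by auto
    have "s (real k + 1) + s (real k - 1) = 2 * cos a * s (real k)"
      by (simp add: s_def distrib_right left_diff_distrib sin_add sin_diff)
    then have e: "s (real k - 1) = 2 * cos a * s (real k) - s (real k + 1)" by simp
    show ?thesis unfolding f_def g_def e using sk by (simp add: field_simps)
  qed
  have "(2 - 2 * cos a) * (\<Sum>k<n. (y k)\<^sup>2) = (\<Sum>k<n. f k + g k)"
    unfolding sum_distrib_left by (rule sum.cong) (simp_all add: mid)
  also have "\<dots> = (\<Sum>k<n. f k + g (Suc k))"
    using sum_Suc_eq[of g n] y0 yn by (simp add: sum.distrib g_def)
  also have "\<dots> \<le> (\<Sum>k<n. (y (Suc k) - y k)\<^sup>2)"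
    by (rule sum_mono) (use step in simp)
  finally show ?thesis by (simp add: a_def)
qed

text \<open>Subtracting the antiperiodic eigenfunction \<open>u 0 * cos\<close>, which lies in the kernel of the
  quadratic form, reduces the antiperiodic case to the Dirichlet case.\<close>

lemma discrete_Wirtinger:
  fixes u :: "nat \<Rightarrow> real"
  assumes n: "n > 0" and un: "u n = - u 0"
  shows "(2 - 2 * cos (pi / real n)) * (\<Sum>k<n. (u k)\<^sup>2) \<le> (\<Sum>k<n. (u (Suc k) - u k)\<^sup>2)"
proof -
  define a where "a = pi / real n"
  define l where "l = 2 - 2 * cos a"
  \<comment> \<open>Defined on the reals because \<open>e (real k - 1)\<close> occurs at k = 0,
    where subtraction on nat would truncate.\<close>
  define e where "e x = u 0 * cos (x * a)" for x :: real
  define c where "c k = e (real k)" for k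
  define y where "y k = u k - c k" for k
  have na: "real n * a = pi" using n by (simp add: a_def)
  have cn: "c n = - c 0" by (simp add: c_def e_def na)
  have en: "e (real n - 1) = - e (- 1)"
    by (simp add: e_def left_diff_distrib na cos_diff)
  \<comment> \<open>Summation by parts: the boundary terms agree because c and w both change sign
    over n steps, and the recurrence of the cosine produces the eigenvalue l.\<close>
  have kernel: "(\<Sum>k<n. (c (Suc k) - c k) * (w (Suc k) - w k)) = l * (\<Sum>k<n. c k * w k)"
    if w: "w n = - w 0" for w :: "nat \<Rightarrow> real"
  proof -
    define g where "g k = c k * w k" for k
    define h where "h k = e (real k - 1) * w k" for k
    have "(\<Sum>k<n. (c (Suc k) - c k) * (w (Suc k) - w k)) =
        (\<Sum>k<n. g (Suc k) + g k - c (Suc k) * w k - h (Suc k))"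
      by (intro sum.cong refl) (simp add: g_def h_def c_def algebra_simps)
    also have "\<dots> = (\<Sum>k<n. g (Suc k)) + (\<Sum>k<n. g k) - (\<Sum>k<n. c (Suc k) * w k) - (\<Sum>k<n. h (Suc k))"
      by (simp add: sum.distrib sum_subtractf)
    also have "(\<Sum>k<n. g (Suc k)) = (\<Sum>k<n. g k)"
      by (rule sum_Suc_eq) (simp add: g_def cn w)
    also have "(\<Sum>k<n. h (Suc k)) = (\<Sum>k<n. h k)"
      by (rule sum_Suc_eq) (simp add: h_def en w)
    also have "(\<Sum>k<n. g k) + (\<Sum>k<n. g k) - (\<Sum>k<n. c (Suc k) * w k) - (\<Sum>k<n. h k) =
        (\<Sum>k<n. g k + g k - c (Suc k) * w k - h k)"
      by (simp add: sum.distrib sum_subtractf sum_distrib_left)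
    also have "\<dots> = (\<Sum>k<n. l * (c k * w k))"
    proof (intro sum.cong refl)
      fix k
      have "c (Suc k) + e (real k - 1) = 2 * cos a * c k"
        by (simp add: c_def e_def distrib_right left_diff_distrib cos_add cos_diff algebra_simps)
      then have e: "e (real k - 1) = 2 * cos a * c k - c (Suc k)" by simp
      show "g k + g k - c (Suc k) * w k - h k = l * (c k * w k)"
        unfolding g_def h_def l_def e by (simp add: algebra_simps)
    qed
    finally show ?thesis by (simp add: sum_distrib_left)
  qed
  have yn: "y n = - y 0" by (simp add: y_def un cn)
  have u: "u k = y k + c k" for k by (simp add: y_def)
  have "(\<Sum>k<n. (u (Suc k) - u k)\<^sup>2) = (\<Sum>k<n. (y (Suc k) - y k)\<^sup>2 +
      2 * ((c (Suc k) - c k) * (y (Suc k) - y k)) + (c (Suc k) - c k) * (c (Suc k) - c k))"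
    by (intro sum.cong refl) (simp add: u power2_eq_square algebra_simps)
  also have "\<dots> = (\<Sum>k<n. (y (Suc k) - y k)\<^sup>2) + 2 * (l * (\<Sum>k<n. c k * y k)) + l * (\<Sum>k<n. c k * c k)"
    by (simp only: sum.distrib sum_distrib_left[symmetric] kernel[OF yn] kernel[OF cn])
  finally have eq: "(\<Sum>k<n. (u (Suc k) - u k)\<^sup>2) =
      (\<Sum>k<n. (y (Suc k) - y k)\<^sup>2) + 2 * (l * (\<Sum>k<n. c k * y k)) + l * (\<Sum>k<n. c k * c k)" .
  have "l * (\<Sum>k<n. (y k)\<^sup>2) \<le> (\<Sum>k<n. (y (Suc k) - y k)\<^sup>2)"
    unfolding l_def a_def
    by (rule discrete_Wirtinger_Dirichlet) (simp_all add: n y_def un c_def e_def na)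
  moreover have "l * (\<Sum>k<n. (y k)\<^sup>2) + 2 * (l * (\<Sum>k<n. c k * y k)) + l * (\<Sum>k<n. c k * c k)
     = l * (\<Sum>k<n. (u k)\<^sup>2)"
    by (simp add: u power2_eq_square sum_distrib_left sum.distrib[symmetric] algebra_simps)
  ultimately show ?thesis unfolding eq by (simp add: l_def a_def)
qed

text \<open>Real and imaginary parts are treated separately. The half-angle form of the eigenvalue
  is the one whose limit is easy to take.\<close>

lemma discrete_Wirtinger_complex:
  fixes u :: "nat \<Rightarrow> complex"
  assumes "n > 0" "u n = - u 0"
  shows "4 * (sin (pi / (2 * real n)))\<^sup>2 * (\<Sum>k<n. (cmod (u k))\<^sup>2) \<le> (\<Sum>k<n. (cmod (u (Suc k) - u k))\<^sup>2)"
proof -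
  have "4 * (sin (pi / (2 * real n)))\<^sup>2 = 2 - 2 * cos (pi / real n)"
    using four_sin_sq_half[of "pi / real n"] by (simp add: mult.commute)
  then show ?thesis
    using discrete_Wirtinger[of n "\<lambda>k. Re (u k)"] discrete_Wirtinger[of n "\<lambda>k. Im (u k)"] assms
    by (simp add: cmod_power2 sum.distrib distrib_left)
qed

section \<open>Riemann sums and the limit of the discrete constants\<close>

lemma integral_partition:
  fixes f :: "real \<Rightarrow> real"
  assumes f: "continuous_on {0..T} f" and "T > 0" "n > 0" "m \<le> n"
  shows "integral {0..T * real m / real n} f =
    (\<Sum>k<m. integral {T * real k / real n..T * real (Suc k) / real n} f)"
  using \<open>m \<le> n\<close>
proof (induction m)
  case (Suc m)
  have "T * real (Suc m) / real n \<le> T"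
    using Suc.prems \<open>T > 0\<close> \<open>n > 0\<close> by (simp add: field_simps del: of_nat_Suc)
  then have "f integrable_on {0..T * real (Suc m) / real n}"
    by (intro integrable_continuous_real continuous_on_subset[OF f]) auto
  then have "integral {0..T * real m / real n} f + integral {T * real m / real n..T * real (Suc m) / real n} f
      = integral {0..T * real (Suc m) / real n} f"
    using \<open>T > 0\<close> \<open>n > 0\<close> by (intro Henstock_Kurzweil_Integration.integral_combine) (auto simp: field_simps)
  then show ?case using Suc by simp
qed simp

lemma Riemann_sums_tendsto:
  fixes f :: "real \<Rightarrow> real"
  assumes f: "continuous_on {0..T} f" and T: "T > 0"
  shows "(\<lambda>n. T / real n * (\<Sum>k<n. f (T * real k / real n))) \<longlonglongrightarrow> integral {0..T} f"
proof (rule LIMSEQ_I)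
  fix e :: real assume "e > 0"
  define e' where "e' = e / (2 * T)"
  have "e' > 0" using \<open>e > 0\<close> T by (simp add: e'_def)
  have "uniformly_continuous_on {0..T} f" using f by (intro compact_uniformly_continuous) auto
  then obtain d where d: "d > 0" "\<And>s t. s \<in> {0..T} \<Longrightarrow> t \<in> {0..T} \<Longrightarrow> dist t s < d \<Longrightarrow> dist (f t) (f s) < e'"
    unfolding uniformly_continuous_on_def using \<open>e' > 0\<close> by metis
  obtain N where N: "T / d < real N" using reals_Archimedean2 by blast
  have "norm (T / real n * (\<Sum>k<n. f (T * real k / real n)) - integral {0..T} f) < e" if "n \<ge> Suc N" for n
  proof -
    have n: "n > 0" "T / d < real n" using that N by auto
    define tk where "tk k = T * real k / real n" for k
    have h: "tk (Suc k) - tk k = T / real n" "tk k \<le> tk (Suc k)" "0 \<le> tk k" for k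
      using n T by (auto simp: tk_def field_simps)
    have le: "tk k \<le> T" if "k \<le> n" for k using that n T by (simp add: tk_def field_simps)
    have hd: "T / real n < d" using n d(1) T by (simp add: field_simps)
    have "integral {0..T} f = (\<Sum>k<n. integral {tk k..tk (Suc k)} f)"
      using integral_partition[OF f T n(1) order_refl] n by (simp add: tk_def)
    then have "T / real n * (\<Sum>k<n. f (tk k)) - integral {0..T} f =
        (\<Sum>k<n. T / real n * f (tk k) - integral {tk k..tk (Suc k)} f)"
      by (simp add: sum_distrib_left sum_subtractf)
    also have "norm \<dots> \<le> (\<Sum>k<n. T / real n * e')"
    proof (rule sum_norm_le)
      fix k assume "k \<in> {..<n}"
      then have sub: "{tk k..tk (Suc k)} \<subseteq> {0..T}" using h(3)[of k] le[of "Suc k"] by auto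
      have int: "f integrable_on {tk k..tk (Suc k)}"
        by (intro integrable_continuous_real continuous_on_subset[OF f sub])
      have "T / real n * f (tk k) - integral {tk k..tk (Suc k)} f = integral {tk k..tk (Suc k)} (\<lambda>t. f (tk k) - f t)"
        using h int by (subst Henstock_Kurzweil_Integration.integral_diff) auto
      also have "norm \<dots> \<le> integral {tk k..tk (Suc k)} (\<lambda>t. e')"
      proof (rule integral_norm_bound_integral)
        fix t assume t: "t \<in> {tk k..tk (Suc k)}"
        have "dist t (tk k) < d" using t h(1)[of k] hd by (auto simp: dist_real_def)
        then have "dist (f t) (f (tk k)) < e'" using d(2)[of "tk k" t] t sub h(2) by auto
        then show "norm (f (tk k) - f t) \<le> e'" by (simp add: dist_real_def)
      qed (use int in \<open>auto intro!: integrable_diff\<close>)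
      also have "\<dots> = T / real n * e'" using h by simp
      finally show "norm (T / real n * f (tk k) - integral {tk k..tk (Suc k)} f) \<le> T / real n * e'" .
    qed
    also have "\<dots> = T * e'" using n by simp
    also have "\<dots> < e" using T \<open>e > 0\<close> by (simp add: e'_def)
    finally show ?thesis by (simp add: tk_def)
  qed
  then show "\<exists>N. \<forall>n\<ge>N. norm (T / real n * (\<Sum>k<n. f (T * real k / real n)) - integral {0..T} f) < e"
    by blast
qed

text \<open>(n / T)^2 times 4 sin^2 (pi / (2 n)) tends to (pi / T)^2 because sin x / x tends to 1 at
  0; what remains is a Riemann sum.\<close>

lemma Wirtinger_sums_tendsto:
  fixes f :: "real \<Rightarrow> real"
  assumes f: "continuous_on {0..T} f" and T: "T > 0"
  shows "(\<lambda>n. real n / T * (4 * (sin (pi / (2 * real n)))\<^sup>2 * (\<Sum>k<n. f (T * real k / real n))))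
    \<longlonglongrightarrow> (pi / T)\<^sup>2 * integral {0..T} f"
proof -
  have "((\<lambda>x. sin x / x) \<longlongrightarrow> 1) (at (0::real))"
    using DERIV_sin[of "0::real"] by (simp add: has_field_derivative_iff)
  moreover have "filterlim (\<lambda>n. pi / (2 * real n)) (at 0) sequentially"
  proof (rule filterlim_atI)
    have "(\<lambda>n. (pi / 2) / real n) \<longlonglongrightarrow> 0" by (rule lim_const_over_n)
    then show "(\<lambda>n. pi / (2 * real n)) \<longlonglongrightarrow> 0" by simp
    show "\<forall>\<^sub>F n in sequentially. pi / (2 * real n) \<noteq> 0"
      using eventually_gt_at_top[of 0] by eventually_elim simp
  qed
  ultimately have "(\<lambda>n. sin (pi / (2 * real n)) / (pi / (2 * real n))) \<longlonglongrightarrow> 1"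
    by (rule filterlim_compose)
  then have "(\<lambda>n. (pi / T)\<^sup>2 * (sin (pi / (2 * real n)) / (pi / (2 * real n)))\<^sup>2 *
      (T / real n * (\<Sum>k<n. f (T * real k / real n)))) \<longlonglongrightarrow> (pi / T)\<^sup>2 * 1\<^sup>2 * integral {0..T} f"
    by (intro tendsto_intros Riemann_sums_tendsto[OF f T])
  moreover have "\<forall>\<^sub>F n in sequentially. (pi / T)\<^sup>2 * (sin (pi / (2 * real n)) / (pi / (2 * real n)))\<^sup>2 *
      (T / real n * (\<Sum>k<n. f (T * real k / real n))) =
      real n / T * (4 * (sin (pi / (2 * real n)))\<^sup>2 * (\<Sum>k<n. f (T * real k / real n)))"
    using eventually_gt_at_top[of 0]
    by eventually_elim (use T in \<open>simp add: field_simps power2_eq_square\<close>)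
  ultimately show ?thesis by (simp add: tendsto_cong)
qed

section \<open>Lower bounds for the energy of a path\<close>

text \<open>Compactness of {0..T} makes the boundedness required in \<open>cfunspace\<close>
  automatic.\<close>

lemma path_space_iff:
  assumes "R > 0"
  shows "z \<in> mspace (path_metric R T) \<longleftrightarrow>
    z \<in> extensional {0..T} \<and> continuous_map (top_of_set {0..T}) (cone_top R) z"
  unfolding path_metric_def
  by (subst compactin_mspace_cfunspace) (use assms in \<open>auto simp: compactin_subtopology\<close>)

lemma continuous_map_cone_iff:
  fixes T :: real
  assumes "R > 0"
  shows "continuous_map (top_of_set {0..T}) (cone_top R) z \<longleftrightarrow>
    (\<forall>t\<in>{0..T}. ((\<lambda>s. cone_dist R (z s) (z t)) \<longlongrightarrow> 0) (at t within {0..T}))"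
proof -
  interpret Metric_space UNIV "cone_dist R" by (rule Metric_space_cone[OF assms])
  have "cone_top R = mtopology" by (simp add: cone_metric_def)
  then have "continuous_map (top_of_set {0..T}) (cone_top R) z \<longleftrightarrow>
     (\<forall>t\<in>{0..T}. \<forall>e>0. \<exists>U. openin (top_of_set {0..T}) U \<and> t \<in> U \<and> (\<forall>s\<in>U. cone_dist R (z t) (z s) < e))"
    by (simp add: continuous_map_to_metric)
  also have "\<dots> \<longleftrightarrow> (\<forall>t\<in>{0..T}. \<forall>e>0. \<forall>\<^sub>F s in at t within {0..T}. cone_dist R (z s) (z t) < e)"
  proof (intro ball_cong refl all_cong)
    fix t e :: real assume t: "t \<in> {0..T}" and e: "e > 0"
    show "(\<exists>U. openin (top_of_set {0..T}) U \<and> t \<in> U \<and> (\<forall>s\<in>U. cone_dist R (z t) (z s) < e)) \<longleftrightarrow>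
        (\<forall>\<^sub>F s in at t within {0..T}. cone_dist R (z s) (z t) < e)" (is "?l \<longleftrightarrow> ?r")
    proof
      assume ?l
      then obtain V where V: "open V" "t \<in> V" "\<And>s. s \<in> V \<inter> {0..T} \<Longrightarrow> cone_dist R (z t) (z s) < e"
        by (auto simp: openin_open)
      then show ?r
        unfolding eventually_at_topological by (intro exI[of _ V]) (auto simp: cone_dist_commute)
    next
      assume ?r
      then obtain V where V: "open V" "t \<in> V" "\<And>s. s \<in> V \<Longrightarrow> s \<noteq> t \<Longrightarrow> s \<in> {0..T} \<Longrightarrow> cone_dist R (z s) (z t) < e"
        unfolding eventually_at_topological by blast
      have "cone_dist R (z t) (z s) < e" if "s \<in> V \<inter> {0..T}" for s
        using that V(3)[of s] e by (cases "s = t") (auto simp: cone_dist_commute cone_dist_eq_0_iff[OF assms, THEN iffD2])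
      then show ?l using V t by (intro exI[of _ "{0..T} \<inter> V"]) (auto simp: openin_open)
    qed
  qed
  also have "\<dots> \<longleftrightarrow> (\<forall>t\<in>{0..T}. ((\<lambda>s. cone_dist R (z s) (z t)) \<longlongrightarrow> 0) (at t within {0..T}))"
    by (simp add: tendsto_iff dist_real_def)
  finally show ?thesis .
qed

lemma path_tendsto:
  assumes "R > 0" "z \<in> mspace (path_metric R T)" "t \<in> {0..T}"
  shows "((\<lambda>s. cone_dist R (z s) (z t)) \<longlongrightarrow> 0) (at t within {0..T})"
  using assms path_space_iff continuous_map_cone_iff by blast

lemma path_continuous_on_cone_r:
  assumes "R > 0" "z \<in> mspace (path_metric R T)"
  shows "continuous_on {0..T} (\<lambda>t. cone_r (z t))"
  unfolding continuous_on
proof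
  fix t assume "t \<in> {0..T}"
  note * = path_tendsto[OF assms this]
  have "((\<lambda>s. cone_r (z s) - cone_r (z t)) \<longlongrightarrow> 0) (at t within {0..T})"
    by (rule Lim_null_comparison[OF _ *]) (simp add: cone_r_diff_le)
  then show "((\<lambda>s. cone_r (z s)) \<longlongrightarrow> cone_r (z t)) (at t within {0..T})"
    by (simp add: LIM_zero_iff)
qed

text \<open>The cone metric depends on R and is not a type class instance. Uniform continuity is
  therefore obtained for the real function d(z s, z t) on the square, which vanishes on the
  diagonal.\<close>

lemma path_uniformly_continuous:
  assumes R: "R > 0" and z: "z \<in> mspace (path_metric R T)" and "e > 0"
  obtains d where "d > 0"
    "\<And>s t. s \<in> {0..T} \<Longrightarrow> t \<in> {0..T} \<Longrightarrow> \<bar>s - t\<bar> < d \<Longrightarrow> cone_dist R (z s) (z t) < e"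
proof -
  define f where "f p = cone_dist R (z (fst p)) (z (snd p))" for p
  have "continuous_on ({0..T} \<times> {0..T}) f"
    unfolding continuous_on
  proof
    fix p assume p: "p \<in> {0..T} \<times> {0..T}"
    obtain s t where st: "p = (s, t)" "s \<in> {0..T}" "t \<in> {0..T}" using p by auto
    let ?F = "at p within {0..T} \<times> {0..T}"
    have l1: "((\<lambda>q. cone_dist R (z (g q)) (z u)) \<longlongrightarrow> 0) ?F"
      if g: "(g \<longlongrightarrow> u) ?F" "\<And>q. q \<in> {0..T} \<times> {0..T} \<Longrightarrow> g q \<in> {0..T}" and u: "u \<in> {0..T}" for g u
    proof -
      have "((\<lambda>s. cone_dist R (z s) (z u)) \<longlongrightarrow> cone_dist R (z u) (z u)) (at u within {0..T})"
        using path_tendsto[OF R z u] cone_dist_eq_0_iff[OF R, of "z u" "z u"] by simp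
      then have "continuous (at u within {0..T}) (\<lambda>s. cone_dist R (z s) (z u))"
        by (simp add: continuous_within)
      then have "((\<lambda>q. cone_dist R (z (g q)) (z u)) \<longlongrightarrow> cone_dist R (z u) (z u)) ?F"
        by (rule continuous_within_tendsto_compose)
          (use g in \<open>auto simp: eventually_at_topological intro!: exI[of _ UNIV]\<close>)
      then show ?thesis using cone_dist_eq_0_iff[OF R, of "z u" "z u"] by simp
    qed
    have "((\<lambda>q. cone_dist R (z (fst q)) (z s) + cone_dist R (z (snd q)) (z t)) \<longlongrightarrow> 0 + 0) ?F"
      using st by (intro tendsto_add l1) (auto intro!: tendsto_eq_intros)
    then have lim: "((\<lambda>q. cone_dist R (z (fst q)) (z s) + cone_dist R (z (snd q)) (z t)) \<longlongrightarrow> 0) ?F" by simp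
    have "\<bar>f q - f p\<bar> \<le> cone_dist R (z (fst q)) (z s) + cone_dist R (z (snd q)) (z t)" for q
      using cone_dist_triangle[of R "z (fst q)" "z (snd q)" "z s"] cone_dist_triangle[of R "z s" "z (snd q)" "z t"]
        cone_dist_triangle[of R "z s" "z t" "z (fst q)"] cone_dist_triangle[of R "z (fst q)" "z t" "z (snd q)"]
      by (simp add: f_def st cone_dist_commute abs_le_iff)
    then have "((\<lambda>q. f q - f p) \<longlongrightarrow> 0) ?F"
      by (intro Lim_null_comparison[OF _ lim]) simp
    then show "(f \<longlongrightarrow> f p) ?F" by (simp add: LIM_zero_iff)
  qed
  then have "uniformly_continuous_on ({0..T} \<times> {0..T}) f"
    by (intro compact_uniformly_continuous compact_Times) auto
  then obtain d where d: "d > 0" "\<And>p q. p \<in> {0..T} \<times> {0..T} \<Longrightarrow> q \<in> {0..T} \<times> {0..T} \<Longrightarrow> dist q p < d \<Longrightarrow> dist (f q) (f p) < e"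
    unfolding uniformly_continuous_on_def using \<open>e > 0\<close> by metis
  show thesis
  proof (rule that[OF d(1)])
    fix s t assume st: "s \<in> {0..T}" "t \<in> {0..T}" "\<bar>s - t\<bar> < d"
    have "dist (s, t) (s, s) < d" using st by (simp add: dist_Pair_Pair dist_real_def)
    then have "dist (f (s, t)) (f (s, s)) < e" using d(2)[of "(s, s)" "(s, t)"] st by simp
    then show "cone_dist R (z s) (z t) < e"
      using cone_dist_eq_0_iff[OF R, of "z s" "z s"] by (simp add: f_def dist_real_def)
  qed
qed

text \<open>If the angle \<open>\<kappa>\<close> is a 1-Lipschitz function on the torus, the path with polar coordinates
  \<open>(cone_r, \<kappa>)\<close> in the plane is antiperiodic and not longer than the path in the cone.\<close>

lemma chain_energy_ge:
  assumes R: "R > 0" and T: "T > 0" and n: "n > 0"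
    and rT: "cone_r (z T) = cone_r (z 0)"
    and far: "cone_r (z 0) = 0 \<or> pi \<le> torus_dist R (cone_x xbar (z 0)) (cone_x xbar (z T))"
  shows "real n / T * (4 * (sin (pi / (2 * real n)))\<^sup>2 * (\<Sum>k<n. (cone_r (z (T * real k / real n)))\<^sup>2))
    \<le> chain_energy R T n z"
proof -
  define tk where "tk k = T * real k / real n" for k
  define x where "x k = cone_x xbar (z (tk k))" for k
  \<comment> \<open>The distance from the starting point, truncated at pi: it is 0 at the start and,
    by \<open>far\<close>, exactly pi at the end. If the endpoint radii are 0 instead, both ends of
    W are 0.\<close>
  define \<kappa> where "\<kappa> k = min (torus_dist R (x 0) (x k)) pi" for k
  define W where "W k = rcis (cone_r (z (tk k))) (\<kappa> k)" for k
  have tk: "tk 0 = 0" "tk n = T" using n by (simp_all add: tk_def)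
  have "W n = - W 0"
  proof (cases "cone_r (z 0) = 0")
    case False
    then have "\<kappa> n = pi" "\<kappa> 0 = 0" using far by (simp_all add: \<kappa>_def x_def tk)
    then show ?thesis by (simp add: W_def tk rT rcis_def)
  qed (simp add: W_def tk rT)
  then have "4 * (sin (pi / (2 * real n)))\<^sup>2 * (\<Sum>k<n. (cmod (W k))\<^sup>2) \<le> (\<Sum>k<n. (cmod (W (Suc k) - W k))\<^sup>2)"
    by (rule discrete_Wirtinger_complex[OF n])
  also have "\<dots> \<le> (\<Sum>k<n. (cone_dist R (z (tk k)) (z (tk (Suc k))))\<^sup>2)"
  proof (rule sum_mono)
    fix k
    have "\<bar>\<kappa> (Suc k) - \<kappa> k\<bar> \<le> min (torus_dist R (x (Suc k)) (x k)) pi"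
      using torus_dist_triangle[of R "x 0" "x k" "x (Suc k)"] torus_dist_triangle[of R "x 0" "x (Suc k)" "x k"]
        torus_dist_commute[of R "x (Suc k)" "x k"] torus_dist_nonneg[of R "x 0" "x k"] torus_dist_nonneg[of R "x 0" "x (Suc k)"]
        pi_gt_zero
      unfolding \<kappa>_def min_def by (smt (verit))
    then have "(sin ((\<kappa> (Suc k) - \<kappa> k) / 2))\<^sup>2 \<le> (sin (min (torus_dist R (x (Suc k)) (x k)) pi / 2))\<^sup>2"
      by (rule sin_half_mono) simp
    then have "(cmod (W (Suc k) - W k))\<^sup>2 \<le> (cone_dist R (z (tk (Suc k))) (z (tk k)))\<^sup>2"
      unfolding W_def cmod_rcis_diff_sq cone_dist_sq[of R _ _ xbar] x_def[symmetric]
      by (intro add_mono order_refl mult_left_mono) auto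
    then show "(cmod (W (Suc k) - W k))\<^sup>2 \<le> (cone_dist R (z (tk k)) (z (tk (Suc k))))\<^sup>2"
      by (simp add: cone_dist_commute)
  qed
  finally have "4 * (sin (pi / (2 * real n)))\<^sup>2 * (\<Sum>k<n. (cone_r (z (tk k)))\<^sup>2) \<le>
      (\<Sum>k<n. (cone_dist R (z (tk k)) (z (tk (Suc k))))\<^sup>2)"
    by (simp add: W_def)
  then show ?thesis
    unfolding chain_energy_def tk_def using T by (intro mult_left_mono) auto
qed

text \<open>A path that stays away from the apex and whose projection is longer than \<open>pi\<close> keeps a definite
  amount of energy when its angular speed is scaled down by the factor \<open>\<beta> < 1\<close> for which the
  scaled path still ends at the antipode.\<close>

lemma chain_energy_ge_strict:
  assumes R: "R > 0" and T: "T > 0" and z: "z \<in> mspace (path_metric R T)"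
    and rT: "cone_r (z T) = cone_r (z 0)"
    and pos: "\<And>t. t \<in> {0..T} \<Longrightarrow> cone_r (z t) > 0"
    and far: "pi < torus_dist R (cone_x xbar (z 0)) (cone_x xbar (z T))"
  obtains c where "c > 0" "\<forall>\<^sub>F n in sequentially.
    real n / T * (4 * (sin (pi / (2 * real n)))\<^sup>2 * (\<Sum>k<n. (cone_r (z (T * real k / real n)))\<^sup>2)) + c
    \<le> chain_energy R T n z"
proof -
  define D where "D = torus_dist R (cone_x xbar (z 0)) (cone_x xbar (z T))"
  define \<beta> where "\<beta> = pi / D"
  have "D > pi" using far by (simp add: D_def)
  then have D: "D > pi" "D > 0" using pi_gt_zero by linarith+
  have \<beta>: "0 < \<beta>" "\<beta> < 1" "\<beta> * D = pi" using D by (simp_all add: \<beta>_def)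
  obtain t0 where t0: "t0 \<in> {0..T}" "\<And>t. t \<in> {0..T} \<Longrightarrow> cone_r (z t0) \<le> cone_r (z t)"
    using continuous_attains_inf[of "{0..T}" "\<lambda>t. cone_r (z t)"] path_continuous_on_cone_r[OF R z] T by auto
  define \<rho> where "\<rho> = cone_r (z t0)"
  have \<rho>: "\<rho> > 0" "\<And>t. t \<in> {0..T} \<Longrightarrow> \<rho> \<le> cone_r (z t)" using pos t0 by (auto simp: \<rho>_def)
  obtain d where d: "d > 0"
    "\<And>s t. s \<in> {0..T} \<Longrightarrow> t \<in> {0..T} \<Longrightarrow> \<bar>s - t\<bar> < d \<Longrightarrow> cone_dist R (z s) (z t) < \<rho>"
    using path_uniformly_continuous[OF R z \<rho>(1)] by blast
  \<comment> \<open>The scaled path gains n / T times \<rho>^2 (1 - \<beta>^2) / 4 times the sum of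
    the squared angular steps. Cauchy-Schwarz bounds that sum below by D^2 / n, so n cancels and c
    is uniform.\<close>
  define c where "c = \<rho>\<^sup>2 * (1 - \<beta>\<^sup>2) / 4 * D\<^sup>2 / T"
  have "\<beta>\<^sup>2 < 1" using \<beta> by (simp add: power_less_one_iff)
  then have c: "c > 0" using \<rho> D T by (simp add: c_def)
  obtain N where N: "T / d < real N" using reals_Archimedean2 by blast
  have "real n / T * (4 * (sin (pi / (2 * real n)))\<^sup>2 * (\<Sum>k<n. (cone_r (z (T * real k / real n)))\<^sup>2)) + c
    \<le> chain_energy R T n z" if "n \<ge> Suc N" for n
  proof -
    have n: "n > 0" "T / d < real n" using that N by auto
    define tk where "tk k = T * real k / real n" for k
    define x where "x k = cone_x xbar (z (tk k))" for k
    define r where "r k = cone_r (z (tk k))" for k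
    define \<delta> where "\<delta> k = torus_dist R (x (Suc k)) (x k)" for k
    define \<alpha> where "\<alpha> k = torus_dist R (x 0) (x k)" for k
    define W where "W k = rcis (r k) (\<beta> * \<alpha> k)" for k
    have tk: "tk 0 = 0" "tk n = T" using n by (simp_all add: tk_def)
    have tk_in: "tk k \<in> {0..T}" if "k \<le> n" for k
      using that n T by (simp add: tk_def field_simps)
    have rk: "\<rho> \<le> r k" if "k \<le> n" for k using \<rho>(2)[OF tk_in[OF that]] by (simp add: r_def)
    \<comment> \<open>On a fine mesh the angular steps are small: at radii \<ge> \<rho>, an angle of
      pi / 2 would force a distance of at least \<rho>, against uniform continuity. The bound keeps
      (1 + \<beta>) * \<delta> k / 2 in the range of \<open>sin_ge_half\<close>.\<close>
    have small: "\<delta> k < pi / 2" if "k < n" for k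
    proof (rule ccontr)
      assume "\<not> \<delta> k < pi / 2"
      then have "(sin (pi / 2 / 2))\<^sup>2 \<le> (sin (min (\<delta> k) pi / 2))\<^sup>2"
        by (intro sin_half_mono) auto
      then have s: "1 / 2 \<le> (sin (min (\<delta> k) pi / 2))\<^sup>2" by (simp add: sin_45 power_divide)
      have "\<rho>\<^sup>2 \<le> r (Suc k) * r k"
        unfolding power2_eq_square using rk[of k] rk[of "Suc k"] that \<rho>(1) by (intro mult_mono) auto
      then have "\<rho>\<^sup>2 * (1 / 2) \<le> r (Suc k) * r k * (sin (min (\<delta> k) pi / 2))\<^sup>2"
        using s \<rho>(1) by (intro mult_mono) (auto simp: r_def)
      moreover have "(cone_dist R (z (tk (Suc k))) (z (tk k)))\<^sup>2 = (r (Suc k) - r k)\<^sup>2 + 4 * (r (Suc k) * r k * (sin (min (\<delta> k) pi / 2))\<^sup>2)"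
        by (simp add: cone_dist_sq[of R _ _ xbar] r_def \<delta>_def x_def)
      moreover have "0 \<le> (r (Suc k) - r k)\<^sup>2" by simp
      moreover have "0 \<le> \<rho>\<^sup>2" by simp
      ultimately have "\<rho>\<^sup>2 \<le> (cone_dist R (z (tk (Suc k))) (z (tk k)))\<^sup>2" by linarith
      then have "\<rho> \<le> cone_dist R (z (tk (Suc k))) (z (tk k))" by (rule power2_le_imp_le) simp
      moreover have "\<bar>tk (Suc k) - tk k\<bar> < d"
        using n d(1) T by (simp add: tk_def field_simps)
      ultimately show False using d(2)[of "tk (Suc k)" "tk k"] tk_in[of k] tk_in[of "Suc k"] that by simp
    qed
    have "W n = - W 0"
      using \<beta>(3) by (simp add: W_def \<alpha>_def x_def r_def tk rT rcis_def D_def)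
    then have "4 * (sin (pi / (2 * real n)))\<^sup>2 * (\<Sum>k<n. (cmod (W k))\<^sup>2) \<le> (\<Sum>k<n. (cmod (W (Suc k) - W k))\<^sup>2)"
      by (rule discrete_Wirtinger_complex[OF n(1)])
    moreover have "(\<Sum>k<n. (cmod (W (Suc k) - W k))\<^sup>2) \<le>
       (\<Sum>k<n. (cone_dist R (z (tk k)) (z (tk (Suc k))))\<^sup>2 - \<rho>\<^sup>2 * (1 - \<beta>\<^sup>2) / 4 * (\<delta> k)\<^sup>2)"
    proof (rule sum_mono)
      fix k assume "k \<in> {..<n}"
      then have k: "k < n" by simp
      have \<delta>k: "0 \<le> \<delta> k" "\<delta> k < pi / 2" using small[OF k] by (simp_all add: \<delta>_def)
      have "\<bar>\<alpha> (Suc k) - \<alpha> k\<bar> \<le> \<delta> k"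
        using torus_dist_triangle[of R "x 0" "x k" "x (Suc k)"] torus_dist_triangle[of R "x 0" "x (Suc k)" "x k"]
          torus_dist_commute[of R "x (Suc k)" "x k"] by (simp add: \<alpha>_def \<delta>_def abs_le_iff)
      then have "\<bar>\<beta> * \<alpha> (Suc k) - \<beta> * \<alpha> k\<bar> \<le> \<beta> * \<delta> k"
        using \<beta>(1) by (simp add: abs_mult flip: right_diff_distrib)
      moreover have b\<delta>: "\<beta> * \<delta> k \<le> \<delta> k" using \<beta> \<delta>k by (simp add: mult_left_le_one_le)
      ultimately have s1: "(sin ((\<beta> * \<alpha> (Suc k) - \<beta> * \<alpha> k) / 2))\<^sup>2 \<le> (sin (\<beta> * \<delta> k / 2))\<^sup>2"
        using \<delta>k by (intro sin_half_mono) auto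
      \<comment> \<open>The gain per step is a difference of two squared sines, which factors as sin
        (a + b) * sin (a - b) with a = \<delta> k / 2 and b = \<beta> * \<delta> k / 2; each factor
        has a linear lower bound.\<close>
      have "(1 - \<beta>\<^sup>2) * (\<delta> k)\<^sup>2 / 16 = ((1 + \<beta>) * \<delta> k / 2 / 2) * ((1 - \<beta>) * \<delta> k / 2 / 2)"
        by (simp add: power2_eq_square algebra_simps)
      also have "\<dots> \<le> sin ((1 + \<beta>) * \<delta> k / 2) * sin ((1 - \<beta>) * \<delta> k / 2)"
      proof (intro mult_mono sin_ge_half)
        show "(1 + \<beta>) * \<delta> k / 2 \<le> pi / 2" "(1 - \<beta>) * \<delta> k / 2 \<le> pi / 2"
        proof -
          have "(1 + \<beta>) * \<delta> k = \<delta> k + \<beta> * \<delta> k" by (simp add: algebra_simps)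
          also have "\<dots> \<le> pi / 2 + pi / 2"
            using \<delta>k(2) b\<delta> by (intro add_mono) auto
          finally have 1: "(1 + \<beta>) * \<delta> k \<le> pi" by simp
          have "(1 - \<beta>) * \<delta> k \<le> (1 + \<beta>) * \<delta> k"
            using \<beta>(1) \<delta>k(1) by (intro mult_right_mono) auto
          with 1 show "(1 + \<beta>) * \<delta> k / 2 \<le> pi / 2" "(1 - \<beta>) * \<delta> k / 2 \<le> pi / 2" by simp_all
        qed
        then show "0 \<le> sin ((1 + \<beta>) * \<delta> k / 2)"
          using \<beta> \<delta>k by (intro sin_ge_zero) auto
      qed (use \<beta> \<delta>k in auto)
      also have "\<dots> = (sin (\<delta> k / 2))\<^sup>2 - (sin (\<beta> * \<delta> k / 2))\<^sup>2"
      proof -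
        have "sin (a + b) * sin (a - b) = (sin a)\<^sup>2 - (sin b)\<^sup>2" for a b :: real
        proof -
          have "sin (a + b) * sin (a - b) = (sin a)\<^sup>2 * (cos b)\<^sup>2 - (cos a)\<^sup>2 * (sin b)\<^sup>2"
            by (simp add: sin_add sin_diff power2_eq_square algebra_simps)
          then show ?thesis by (simp add: cos_squared_eq algebra_simps)
        qed
        from this[of "\<delta> k / 2" "\<beta> * \<delta> k / 2"] show ?thesis
          by (simp add: algebra_simps add_divide_distrib diff_divide_distrib)
      qed
      finally have s2: "(sin (\<beta> * \<delta> k / 2))\<^sup>2 \<le> (sin (min (\<delta> k) pi / 2))\<^sup>2 - (1 - \<beta>\<^sup>2) * (\<delta> k)\<^sup>2 / 16"
        using \<delta>k by simp
      have rr: "\<rho>\<^sup>2 \<le> r (Suc k) * r k"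
        unfolding power2_eq_square using rk[of k] rk[of "Suc k"] k \<rho>(1) by (intro mult_mono) auto
      have rr0: "0 \<le> 4 * r (Suc k) * r k" by (simp add: r_def)
      define C where "C = (1 - \<beta>\<^sup>2) * (\<delta> k)\<^sup>2 / 16"
      have "C \<ge> 0" using \<open>\<beta>\<^sup>2 < 1\<close> by (simp add: C_def)
      have "\<rho>\<^sup>2 * (1 - \<beta>\<^sup>2) / 4 * (\<delta> k)\<^sup>2 = 4 * (\<rho>\<^sup>2 * C)" by (simp add: C_def)
      also have "\<dots> \<le> 4 * (r (Suc k) * r k * C)"
        using mult_right_mono[OF rr \<open>C \<ge> 0\<close>] by (rule mult_left_mono) simp
      finally have rr2: "\<rho>\<^sup>2 * (1 - \<beta>\<^sup>2) / 4 * (\<delta> k)\<^sup>2 \<le> 4 * r (Suc k) * r k * ((1 - \<beta>\<^sup>2) * (\<delta> k)\<^sup>2 / 16)"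
        by (simp only: C_def mult.assoc)
      have "(cmod (W (Suc k) - W k))\<^sup>2 \<le> (r (Suc k) - r k)\<^sup>2 + 4 * r (Suc k) * r k * ((sin (min (\<delta> k) pi / 2))\<^sup>2 - (1 - \<beta>\<^sup>2) * (\<delta> k)\<^sup>2 / 16)"
        unfolding W_def cmod_rcis_diff_sq
        using order_trans[OF s1 s2] rr0 by (intro add_mono order_refl mult_left_mono)
      also have "\<dots> = (cone_dist R (z (tk (Suc k))) (z (tk k)))\<^sup>2 - 4 * r (Suc k) * r k * ((1 - \<beta>\<^sup>2) * (\<delta> k)\<^sup>2 / 16)"
        by (simp add: cone_dist_sq[of R _ _ xbar] r_def \<delta>_def x_def right_diff_distrib)
      also have "\<dots> \<le> (cone_dist R (z (tk (Suc k))) (z (tk k)))\<^sup>2 - \<rho>\<^sup>2 * (1 - \<beta>\<^sup>2) / 4 * (\<delta> k)\<^sup>2"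
        using rr2 by simp
      finally show "(cmod (W (Suc k) - W k))\<^sup>2 \<le> (cone_dist R (z (tk k)) (z (tk (Suc k))))\<^sup>2 - \<rho>\<^sup>2 * (1 - \<beta>\<^sup>2) / 4 * (\<delta> k)\<^sup>2"
        by (simp add: cone_dist_commute)
    qed
    ultimately have main: "4 * (sin (pi / (2 * real n)))\<^sup>2 * (\<Sum>k<n. (r k)\<^sup>2) + \<rho>\<^sup>2 * (1 - \<beta>\<^sup>2) / 4 * (\<Sum>k<n. (\<delta> k)\<^sup>2)
        \<le> (\<Sum>k<n. (cone_dist R (z (tk k)) (z (tk (Suc k))))\<^sup>2)"
      by (simp add: W_def sum_subtractf sum_distrib_left)
    have "\<alpha> m \<le> (\<Sum>k<m. \<delta> k)" for m
    proof (induction m)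
      case (Suc m)
      then show ?case
        using torus_dist_triangle[of R "x 0" "x (Suc m)" "x m"] by (simp add: \<alpha>_def \<delta>_def torus_dist_commute)
    qed (simp add: \<alpha>_def)
    from this[of n] have "D \<le> (\<Sum>k<n. \<delta> k)" by (simp add: \<alpha>_def x_def tk D_def)
    then have "D\<^sup>2 \<le> (\<Sum>k<n. \<delta> k)\<^sup>2" using D by (intro power_mono) auto
    also have "\<dots> \<le> (\<Sum>k<n. (\<delta> k)\<^sup>2) * real n"
      using Cauchy_Schwarz_ineq_sum[of \<delta> "\<lambda>_. 1" "{..<n}"] by simp
    finally have "\<rho>\<^sup>2 * (1 - \<beta>\<^sup>2) / 4 * D\<^sup>2 \<le> \<rho>\<^sup>2 * (1 - \<beta>\<^sup>2) / 4 * ((\<Sum>k<n. (\<delta> k)\<^sup>2) * real n)"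
      using \<open>\<beta>\<^sup>2 < 1\<close> by (intro mult_left_mono) auto
    then have "c \<le> real n / T * (\<rho>\<^sup>2 * (1 - \<beta>\<^sup>2) / 4 * (\<Sum>k<n. (\<delta> k)\<^sup>2))"
      using T by (simp add: c_def divide_le_cancel field_simps)
    moreover have "real n / T * (4 * (sin (pi / (2 * real n)))\<^sup>2 * (\<Sum>k<n. (r k)\<^sup>2) + \<rho>\<^sup>2 * (1 - \<beta>\<^sup>2) / 4 * (\<Sum>k<n. (\<delta> k)\<^sup>2))
        \<le> chain_energy R T n z"
      unfolding chain_energy_def using main T by (intro mult_left_mono) (auto simp: tk_def)
    ultimately show ?thesis by (simp add: r_def tk_def distrib_left)
  qed
  then have "\<forall>\<^sub>F n in sequentially. real n / T * (4 * (sin (pi / (2 * real n)))\<^sup>2 * (\<Sum>k<n. (cone_r (z (T * real k / real n)))\<^sup>2)) + c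
    \<le> chain_energy R T n z" by (rule eventually_sequentiallyI)
  with c show thesis by (rule that)
qed

text \<open>A measurable quantity lying between the bound by \<open>Pstar T\<close> times the mass
  and the action. A strict inequality between integrals is derived with
  \<open>nn_integral_less\<close>, which asks for measurability of both integrands; the action
  itself need not provide it.\<close>

definition chain_sup :: "real \<Rightarrow> real \<Rightarrow> (real \<Rightarrow> cone) \<Rightarrow> ennreal" where
  "chain_sup R T z = (SUP n\<in>{0<..}. ennreal (chain_energy R T n z))"

lemma chain_sup_le_path_action:
  "R > 0 \<Longrightarrow> T > 0 \<Longrightarrow> chain_sup R T z \<le> path_action R T xbar z"
  unfolding chain_sup_def by (rule SUP_least) (auto intro: chain_energy_le_path_action)

lemma LINT_cone_r_sq:
  assumes "R > 0" "z \<in> mspace (path_metric R T)"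
  shows "(LINT t:{0..T}|lborel. (cone_r (z t))\<^sup>2) = integral {0..T} (\<lambda>t. (cone_r (z t))\<^sup>2)"
proof (rule set_borel_integral_eq_integral(2))
  have "continuous_on {0..T} (\<lambda>t. (cone_r (z t))\<^sup>2)"
    by (intro continuous_intros path_continuous_on_cone_r[OF assms])
  then show "set_integrable lborel {0..T} (\<lambda>t. (cone_r (z t))\<^sup>2)"
    unfolding set_integrable_def by (rule borel_integrable_compact[OF compact_Icc])
qed

lemma chain_sup_ge:
  assumes R: "R > 0" and T: "T > 0" and z: "z \<in> mspace (path_metric R T)"
    and rT: "cone_r (z T) = cone_r (z 0)"
    and far: "cone_r (z 0) = 0 \<or> pi \<le> torus_dist R (cone_x xbar (z 0)) (cone_x xbar (z T))"
  shows "ennreal (Pstar T * (LINT t:{0..T}|lborel. (cone_r (z t))\<^sup>2)) \<le> chain_sup R T z"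
proof (rule tendsto_upperbound)
  have "continuous_on {0..T} (\<lambda>t. (cone_r (z t))\<^sup>2)"
    by (intro continuous_intros path_continuous_on_cone_r[OF R z])
  then show "(\<lambda>n. ennreal (real n / T * (4 * (sin (pi / (2 * real n)))\<^sup>2 * (\<Sum>k<n. (cone_r (z (T * real k / real n)))\<^sup>2))))
      \<longlonglongrightarrow> ennreal (Pstar T * (LINT t:{0..T}|lborel. (cone_r (z t))\<^sup>2))"
    unfolding Pstar_def LINT_cone_r_sq[OF R z] by (intro tendsto_ennrealI Wirtinger_sums_tendsto T)
  show "\<forall>\<^sub>F n in sequentially. ennreal (real n / T * (4 * (sin (pi / (2 * real n)))\<^sup>2 * (\<Sum>k<n. (cone_r (z (T * real k / real n)))\<^sup>2)))
      \<le> chain_sup R T z"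
    using eventually_gt_at_top[of 0]
  proof eventually_elim
    case (elim n)
    then show ?case
      unfolding chain_sup_def using chain_energy_ge[OF R T elim rT far]
      by (intro SUP_upper2[of n]) (auto intro: ennreal_leI)
  qed
qed simp

text \<open>The surplus c of \<open>chain_energy_ge_strict\<close> does not depend on n, so it
  survives the limit; strictness for each n alone would not.\<close>

lemma chain_sup_gt:
  assumes R: "R > 0" and T: "T > 0" and z: "z \<in> mspace (path_metric R T)"
    and rT: "cone_r (z T) = cone_r (z 0)"
    and pos: "\<And>t. t \<in> {0..T} \<Longrightarrow> cone_r (z t) > 0"
    and far: "pi < torus_dist R (cone_x xbar (z 0)) (cone_x xbar (z T))"
  shows "ennreal (Pstar T * (LINT t:{0..T}|lborel. (cone_r (z t))\<^sup>2)) < chain_sup R T z"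
proof -
  let ?a = "\<lambda>n. real n / T * (4 * (sin (pi / (2 * real n)))\<^sup>2 * (\<Sum>k<n. (cone_r (z (T * real k / real n)))\<^sup>2))"
  let ?P = "Pstar T * (LINT t:{0..T}|lborel. (cone_r (z t))\<^sup>2)"
  obtain c where c: "c > 0" "\<forall>\<^sub>F n in sequentially. ?a n + c \<le> chain_energy R T n z"
    by (rule chain_energy_ge_strict[OF R T z rT pos far])
  have "ennreal (?P + c) \<le> chain_sup R T z"
  proof (rule tendsto_upperbound)
    have "continuous_on {0..T} (\<lambda>t. (cone_r (z t))\<^sup>2)"
      by (intro continuous_intros path_continuous_on_cone_r[OF R z])
    then show "(\<lambda>n. ennreal (?a n + c)) \<longlonglongrightarrow> ennreal (?P + c)"
      unfolding Pstar_def LINT_cone_r_sq[OF R z]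
      by (intro tendsto_ennrealI tendsto_add tendsto_const Wirtinger_sums_tendsto T)
    show "\<forall>\<^sub>F n in sequentially. ennreal (?a n + c) \<le> chain_sup R T z"
      using c(2) eventually_gt_at_top[of 0]
    proof eventually_elim
      case (elim n)
      then show ?case
        unfolding chain_sup_def by (intro SUP_upper2[of n]) (auto intro: ennreal_leI)
    qed
  qed simp
  moreover have "0 \<le> ?P"
    unfolding Pstar_def set_lebesgue_integral_def by (intro mult_nonneg_nonneg Bochner_Integration.integral_nonneg) auto
  then have "ennreal ?P < ennreal (?P + c)" using c(1) by (simp add: ennreal_less_iff)
  ultimately show ?thesis by (rule less_le_trans[rotated])
qed

section \<open>Borel structures\<close>

lemma space_borel_of_top [simp]: "space (borel_of_top X) = topspace X"
  and sets_borel_of_top: "sets (borel_of_top X) = sigma_sets (topspace X) {U. openin X U}"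
proof -
  have "{U. openin X U} \<subseteq> Pow (topspace X)" using openin_subset by auto
  then show "space (borel_of_top X) = topspace X"
    and "sets (borel_of_top X) = sigma_sets (topspace X) {U. openin X U}"
    by (simp_all add: borel_of_top_def)
qed

lemma borel_measurable_continuous_map:
  fixes f :: "'a \<Rightarrow> real"
  assumes "continuous_map X euclideanreal f"
  shows "f \<in> borel_measurable (borel_of_top X)"
proof (rule borel_measurableI)
  fix S :: "real set" assume "open S"
  then have "openin X {x \<in> topspace X. f x \<in> S}"
    using assms by (simp add: continuous_map_def)
  moreover have "f -` S \<inter> space (borel_of_top X) = {x \<in> topspace X. f x \<in> S}" by auto
  ultimately show "f -` S \<inter> space (borel_of_top X) \<in> sets (borel_of_top X)"
    by (auto simp: sets_borel_of_top)
qed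

lemma sets_rho0 [simp, measurable_cong]: "sets rho0 = sets borel"
  and space_rho0 [simp]: "space rho0 = UNIV"
  by (simp_all add: rho0_def)

text \<open>The torus carries the quotient topology, so openness of preimages can be tested in the
  plane.\<close>

lemma measurable_rho0:
  assumes "continuous_map euclidean X (\<lambda>p. F (torus_of p))"
  shows "F \<in> measurable rho0 (borel_of_top X)"
proof (rule measurable_sigma_sets[OF sets_borel_of_top])
  show "{U. openin X U} \<subseteq> Pow (topspace X)" using openin_subset by auto
  have "F (torus_of p) \<in> topspace X" for p
    using assms by (auto simp: continuous_map_def)
  then show "F \<in> space rho0 \<rightarrow> topspace X" by (metis Pi_I torus_cases)
  fix U assume "U \<in> {U. openin X U}"
  then have "open {p. F (torus_of p) \<in> U}" using assms by (simp add: continuous_map_def)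
  then have "open (F -` U)" by (simp add: open_torus_def vimage_def)
  then show "F -` U \<inter> space rho0 \<in> sets rho0" by simp
qed

lemma measurable_torus_of [measurable]: "torus_of \<in> borel_measurable borel"
  by (rule borel_measurableI) (simp add: open_torus_def)

lemma prob_space_rho0: "prob_space rho0"
proof -
  let ?S = "cbox 0 (vec (2 * pi)) :: (real^2) set"
  have "(0::real^2) \<in> ?S" by (simp add: mem_box_cart)
  then have ne: "?S \<noteq> {}" by blast
  have "emeasure lborel ?S = ennreal (measure lborel ?S)"
    by (rule emeasure_eq_ennreal_measure) (use emeasure_lborel_cbox_finite[of 0 "vec (2 * pi) :: real^2"] in simp)
  also have "measure lborel ?S = (2 * pi)\<^sup>2" by (simp add: content_cbox_cart[OF ne])
  finally have c: "emeasure lborel ?S = ennreal ((2 * pi)\<^sup>2)" .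
  have "emeasure (density lborel (\<lambda>p. ennreal (1 / (2 * pi)\<^sup>2) * indicator ?S p)) UNIV =
      (\<integral>\<^sup>+p. ennreal (1 / (2 * pi)\<^sup>2) * indicator ?S p \<partial>lborel)"
    by (subst emeasure_density) auto
  also have "\<dots> = ennreal (1 / (2 * pi)\<^sup>2) * emeasure lborel ?S"
    by (rule nn_integral_cmult_indicator) simp
  also have "\<dots> = 1" unfolding c by (subst ennreal_mult[symmetric]) auto
  finally have "prob_space (density lborel (\<lambda>p. ennreal (1 / (2 * pi)\<^sup>2) * indicator ?S p))"
    by (intro prob_spaceI) simp
  then show ?thesis unfolding rho0_def by (rule prob_space.prob_space_distr) simp
qed

lemma gnorm_le_norm: "gnorm R v \<le> (1 + \<bar>R\<bar>) * norm v"
proof -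
  have "gnorm R v \<le> norm (v $ 1 *\<^sub>R (axis 1 1 :: real^2)) + norm ((R * v $ 2) *\<^sub>R (axis 2 1 :: real^2))"
    unfolding gnorm_eq_norm
    by (rule order_trans[OF eq_refl norm_triangle_ineq], rule arg_cong[where f=norm])
      (simp add: vec_eq_iff forall_2 gscale_def axis_def)
  also have "\<dots> = \<bar>v $ 1\<bar> + \<bar>R\<bar> * \<bar>v $ 2\<bar>" by (simp add: abs_mult norm_axis_1)
  also have "\<dots> \<le> norm v + \<bar>R\<bar> * norm v"
    by (intro add_mono mult_left_mono component_le_norm_cart) auto
  finally show ?thesis by (simp add: algebra_simps)
qed

lemma torus_dist_torus_of_le: "torus_dist R (torus_of p) (torus_of q) \<le> (1 + \<bar>R\<bar>) * dist p q"
  using torus_dist_le[of p "q - p" "torus_of q" R] gnorm_le_norm[of R "q - p"]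
  by (simp add: dist_norm norm_minus_commute)

lemma cone_dist_same_r_le:
  assumes "0 \<le> r"
  shows "cone_dist R (cone_pt x r) (cone_pt y r) \<le> r * torus_dist R x y"
proof (rule power2_le_imp_le)
  let ?m = "min (torus_dist R x y) pi"
  have "4 * r * r * (sin (?m / 2))\<^sup>2 \<le> 4 * r * r * (?m\<^sup>2 / 4)"
    using assms by (intro mult_left_mono sin_half_sq_le) auto
  also have "\<dots> \<le> 4 * r * r * ((torus_dist R x y)\<^sup>2 / 4)"
    using assms by (intro mult_left_mono divide_right_mono power_mono) auto
  finally show "(cone_dist R (cone_pt x r) (cone_pt y r))\<^sup>2 \<le> (r * torus_dist R x y)\<^sup>2"
    unfolding cone_dist_cone_pt_sq(1)[OF assms assms] by (simp add: power2_eq_square algebra_simps)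
qed (use assms in simp)

lemma continuous_map_cone_pt:
  assumes R: "R > 0" and "0 \<le> r"
  shows "continuous_map euclidean (cone_top R) (\<lambda>p. cone_pt (torus_of (p + a)) r)"
proof -
  have "Lipschitz_continuous_map euclidean_metric (cone_metric R) (\<lambda>p. cone_pt (torus_of (p + a)) r)"
    unfolding Lipschitz_continuous_map_def
  proof (intro conjI exI ballI)
    fix p q :: "real^2"
    have "cone_dist R (cone_pt (torus_of (p + a)) r) (cone_pt (torus_of (q + a)) r) \<le> r * ((1 + \<bar>R\<bar>) * dist (p + a) (q + a))"
      by (rule order_trans[OF cone_dist_same_r_le[OF assms(2)] mult_left_mono[OF torus_dist_torus_of_le assms(2)]])
    then show "mdist (cone_metric R) (cone_pt (torus_of (p + a)) r) (cone_pt (torus_of (q + a)) r)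
        \<le> r * (1 + \<bar>R\<bar>) * mdist euclidean_metric p q"
      using R by (simp add: mult.assoc dist_norm)
  qed (use R in simp)
  then show ?thesis using Lipschitz_continuous_imp_continuous_map by force
qed

lemma continuous_map_cone_r: "R > 0 \<Longrightarrow> continuous_map (cone_top R) euclideanreal cone_r"
proof -
  assume R: "R > 0"
  have "Lipschitz_continuous_map (cone_metric R) euclidean_metric cone_r"
    unfolding Lipschitz_continuous_map_def using R
    by (auto simp: dist_real_def intro!: exI[of _ 1] cone_r_diff_le)
  then show ?thesis using Lipschitz_continuous_imp_continuous_map by force
qed

lemma continuous_map_cone_dist:
  assumes R: "R > 0"
  shows "continuous_map (prod_topology (cone_top R) (cone_top R)) euclideanreal (\<lambda>w. cone_dist R (fst w) (snd w))"
proof -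
  have "Lipschitz_continuous_map (prod_metric (cone_metric R) (cone_metric R)) euclidean_metric
      (\<lambda>w. cone_dist R (fst w) (snd w))"
    unfolding Lipschitz_continuous_map_def
  proof (intro conjI exI ballI)
    fix w w' :: "cone \<times> cone"
    obtain a b c d where w: "w = (a, b)" "w' = (c, d)" by (metis surj_pair)
    have "\<bar>cone_dist R a b - cone_dist R c d\<bar> \<le> cone_dist R a c + cone_dist R b d"
      using cone_dist_triangle[of R a b c] cone_dist_triangle[of R c b d]
        cone_dist_triangle[of R c d a] cone_dist_triangle[of R a d b]
        cone_dist_commute[of R c a] cone_dist_commute[of R d b] by linarith
    also have "\<dots> \<le> 2 * sqrt ((cone_dist R a c)\<^sup>2 + (cone_dist R b d)\<^sup>2)"
      using real_sqrt_sum_squares_ge1[of "cone_dist R a c" "cone_dist R b d"]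
        real_sqrt_sum_squares_ge2[of "cone_dist R b d" "cone_dist R a c"] by linarith
    finally show "mdist euclidean_metric (cone_dist R (fst w) (snd w)) (cone_dist R (fst w') (snd w'))
        \<le> 2 * mdist (prod_metric (cone_metric R) (cone_metric R)) w w'"
      using R by (simp add: w dist_real_def prod_dist_def)
  qed simp
  from Lipschitz_continuous_imp_continuous_map[OF this] show ?thesis
    by (simp add: mtopology_of_prod_metric)
qed

lemma cone_dist_le_path_dist:
  assumes "R > 0" "z \<in> mspace (path_metric R T)" "w \<in> mspace (path_metric R T)" "t \<in> {0..T}"
  shows "cone_dist R (z t) (w t) \<le> mdist (path_metric R T) z w"
  using mdist_cfunspace_imp_mdist_le[of z "top_of_set {0..T}" "cone_metric R" w "mdist (path_metric R T) z w" t] assms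
  by (simp add: path_metric_def)

lemma cone_dist_path_measurable:
  assumes R: "R > 0" and st: "s \<in> {0..T}" "t \<in> {0..T}"
  shows "(\<lambda>z. cone_dist R (z s) (z t)) \<in> borel_measurable (path_borel R T)"
proof (rule borel_measurable_continuous_map)
  have "Lipschitz_continuous_map (path_metric R T) euclidean_metric (\<lambda>z. cone_dist R (z s) (z t))"
    unfolding Lipschitz_continuous_map_def
  proof (intro conjI exI ballI)
    fix z w assume z: "z \<in> mspace (path_metric R T)" and w: "w \<in> mspace (path_metric R T)"
    have "\<bar>cone_dist R (z s) (z t) - cone_dist R (w s) (w t)\<bar> \<le> cone_dist R (z s) (w s) + cone_dist R (z t) (w t)"
      using cone_dist_triangle[of R "z s" "z t" "w s"] cone_dist_triangle[of R "w s" "z t" "w t"]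
        cone_dist_triangle[of R "w s" "w t" "z s"] cone_dist_triangle[of R "z s" "w t" "z t"]
        cone_dist_commute[of R "w s" "z s"] cone_dist_commute[of R "w t" "z t"] by linarith
    also have "\<dots> \<le> 2 * mdist (path_metric R T) z w"
      using cone_dist_le_path_dist[OF R z w st(1)] cone_dist_le_path_dist[OF R z w st(2)] by simp
    finally show "mdist euclidean_metric (cone_dist R (z s) (z t)) (cone_dist R (w s) (w t)) \<le> 2 * mdist (path_metric R T) z w"
      by (simp add: dist_real_def)
  qed simp
  then show "continuous_map (mtopology_of (path_metric R T)) euclideanreal (\<lambda>z. cone_dist R (z s) (z t))"
    using Lipschitz_continuous_imp_continuous_map by force
qed

lemma chain_sup_measurable:
  assumes R: "R > 0" and T: "T > 0"
  shows "chain_sup R T \<in> borel_measurable (path_borel R T)"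
proof -
  have "(\<lambda>z. chain_energy R T n z) \<in> borel_measurable (path_borel R T)" if "n > 0" for n
    unfolding chain_energy_def
  proof (intro borel_measurable_times borel_measurable_const borel_measurable_sum borel_measurable_power
      cone_dist_path_measurable[OF R])
    fix k assume "k \<in> {..<n}"
    then show "T * real k / real n \<in> {0..T}" "T * real (Suc k) / real n \<in> {0..T}"
      using T that by (auto simp: field_simps simp del: of_nat_Suc)
  qed
  then show ?thesis
    unfolding chain_sup_def[abs_def]
    by (intro borel_measurable_SUP) (auto intro!: measurable_compose[OF _ measurable_ennreal])
qed

section \<open>The Jacobian\<close>

text \<open>Two lifts of the same map differ by a lattice vector, which is locally constant.\<close>

lemma lift_derivative_unique:
  fixes F G :: "real^2 \<Rightarrow> real^2"
  assumes ev: "\<forall>\<^sub>F q in nhds p. torus_of (F q) = torus_of (G q)"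
    and F: "(F has_derivative D) (at p)" and G: "(G has_derivative E) (at p)"
  shows "D = E"
proof -
  define e where "e q = F q - G q" for q
  have e: "(e has_derivative (\<lambda>h. D h - E h)) (at p)"
    unfolding e_def[abs_def] using F G by (rule has_derivative_diff)
  have "(e \<longlongrightarrow> e p) (nhds p)"
    using has_derivative_continuous[OF e] by (simp add: continuous_at tendsto_nhds_iff)
  then have "\<forall>\<^sub>F q in nhds p. dist (e q) (e p) < 2 * pi" by (rule tendstoD) simp
  with ev have "\<forall>\<^sub>F q in nhds p. e p = e q"
  proof eventually_elim
    case (elim q)
    have "e q $ i = e p $ i" for i
    proof -
      obtain k l :: int where kl: "e q $ i = 2 * pi * of_int k" "e p $ i = 2 * pi * of_int l"
        using elim(1) eventually_nhds_x_imp_x[OF ev] unfolding torus_of_eq_iff period_rel_def e_def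
        by (metis vector_minus_component)
      have "\<bar>e q $ i - e p $ i\<bar> < 2 * pi"
        using component_le_norm_cart[of "e q - e p" i] elim(2) by (simp add: dist_norm)
      also have "e q $ i - e p $ i = 2 * pi * of_int (k - l)" by (simp add: kl algebra_simps)
      finally have "\<bar>real_of_int (k - l)\<bar> < 1" by (simp add: abs_mult)
      then have "k = l" by linarith
      then show ?thesis using kl by simp
    qed
    then show ?case by (simp add: vec_eq_iff)
  qed
  then have ev': "\<forall>\<^sub>F q in at p. e p = e q" by (simp add: eventually_at_filter eventually_mono)
  have "((\<lambda>q. e p) has_derivative (\<lambda>h. 0)) (at p)" by simp
  from has_derivative_transform_eventually[OF this ev' refl UNIV_I]
  have "(\<lambda>h. D h - E h) = (\<lambda>h. 0)" using e has_derivative_unique by blast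
  then show ?thesis by (auto simp: fun_eq_iff)
qed

text \<open>The description operator is unambiguous: another representative differs from p by a
  lattice vector, translation by it moves the second lift to p, and
  \<open>lift_derivative_unique\<close> applies.\<close>

lemma torus_Jac_eq:
  assumes "torus_of p = x" "\<forall>\<^sub>F q in nhds p. torus_of (F q) = f (torus_of q)" "(F has_derivative D) (at p)"
  shows "torus_Jac f x = det (matrix D)"
  unfolding torus_Jac_def
proof (rule the_equality)
  show "\<exists>p F D'. torus_of p = x \<and> (\<forall>\<^sub>F q in nhds p. torus_of (F q) = f (torus_of q)) \<and>
      (F has_derivative D') (at p) \<and> det (matrix D) = det (matrix D')"
    using assms by blast
  fix d assume "\<exists>p F D. torus_of p = x \<and> (\<forall>\<^sub>F q in nhds p. torus_of (F q) = f (torus_of q)) \<and>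
      (F has_derivative D) (at p) \<and> d = det (matrix D)"
  then obtain p' G E where G: "torus_of p' = x" "\<forall>\<^sub>F q in nhds p'. torus_of (G q) = f (torus_of q)"
      "(G has_derivative E) (at p')" "d = det (matrix E)" by blast
  define l where "l = p' - p"
  have l: "torus_of (q + l) = torus_of q" for q
    using G(1) assms(1) torus_of_eq_iff[of p' p] torus_of_eq_iff[of "q + l" q]
    by (simp add: period_rel_def l_def)
  have tl: "((\<lambda>q. q + l) \<longlongrightarrow> p + l) (nhds p)" by (intro tendsto_intros tendsto_ident_at) (simp add: filterlim_ident)
  have "p + l = p'" by (simp add: l_def)
  then have "\<forall>\<^sub>F q in nhds p. torus_of (G (q + l)) = f (torus_of (q + l))"
    using eventually_compose_filterlim[OF G(2) tl[unfolded \<open>p + l = p'\<close>]] by simp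
  with assms(2) have ev: "\<forall>\<^sub>F q in nhds p. torus_of (F q) = torus_of (G (q + l))"
    by eventually_elim (simp add: l)
  have "((\<lambda>q. q + l) has_derivative (\<lambda>h. h)) (at p)" by (auto intro!: derivative_eq_intros)
  moreover have "(G has_derivative E) (at (p + l))" using G(3) \<open>p + l = p'\<close> by simp
  ultimately have "((\<lambda>q. G (q + l)) has_derivative (\<lambda>h. E h)) (at p)"
    by (rule has_derivative_compose)
  from lift_derivative_unique[OF ev assms(3) this] G(4) show "d = det (matrix D)" by simp
qed

lemma torus_Jac_shift [simp]: "torus_Jac (torus_shift a) x = 1"
proof -
  obtain p where p: "x = torus_of p" by (rule torus_cases)
  have "torus_Jac (torus_shift a) x = det (matrix (\<lambda>h::real^2. h))"
    by (rule torus_Jac_eq[of p _ "\<lambda>q. q + a"])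
      (auto simp: p torus_shift_torus_of intro!: derivative_eq_intros)
  then show ?thesis by (simp add: matrix_id_mat_1[unfolded id_def])
qed

lemma torus_shift_0: "torus_shift 0 = id"
proof
  fix x show "torus_shift 0 x = id x"
    by (rule torus_cases[of x]) (simp add: torus_shift_torus_of)
qed

lemma smooth_on_imp_has_derivative:
  assumes "smooth_on U F" "open U" "p \<in> U"
  obtains D where "(F has_derivative D) (at p)"
proof -
  have "Ck_on (Suc 0) U F" using assms(1) by (simp only: smooth_on_def)
  then show thesis using assms that at_within_open[OF assms(3,2)] by (auto simp: Ck_on.simps)
qed

text \<open>A lift of the inverse composed with a lift of f lifts the identity, so the chain rule
  gives two matrices with product 1. This is what keeps the paths of a smooth flow away from the
  apex.\<close>

lemma torus_Jac_Diff_nonzero: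
  assumes "f \<in> torus_Diff"
  shows "torus_Jac f x \<noteq> 0"
proof -
  obtain p where p: "x = torus_of p" by (rule torus_cases)
  have f: "bij f" "torus_smooth f" "torus_smooth (inv f)" using assms by (auto simp: torus_Diff_def)
  obtain U F where U: "open U" "p \<in> U" "smooth_on U F" "\<forall>q\<in>U. torus_of (F q) = f (torus_of q)"
    using f(2)[unfolded torus_smooth_def, THEN spec, of p] by (elim exE conjE)
  obtain V G where V: "open V" "F p \<in> V" "smooth_on V G" "\<forall>q\<in>V. torus_of (G q) = inv f (torus_of q)"
    using f(3)[unfolded torus_smooth_def, THEN spec, of "F p"] by (elim exE conjE)
  obtain D where D: "(F has_derivative D) (at p)" by (rule smooth_on_imp_has_derivative[OF U(3,1,2)])
  obtain E where E: "(G has_derivative E) (at (F p))" by (rule smooth_on_imp_has_derivative[OF V(3,1,2)])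
  have evU: "\<forall>\<^sub>F q in nhds p. q \<in> U" using U by (simp add: eventually_nhds_in_open)
  have "(F \<longlongrightarrow> F p) (nhds p)"
    using has_derivative_continuous[OF D] by (simp add: continuous_at tendsto_nhds_iff)
  then have evV: "\<forall>\<^sub>F q in nhds p. F q \<in> V" using V topological_tendstoD by blast
  have ev: "\<forall>\<^sub>F q in nhds p. torus_of (G (F q)) = torus_of q"
    using evU evV by eventually_elim (simp add: U V inv_f_f[OF bij_is_inj[OF f(1)]])
  have "((\<lambda>q. G (F q)) has_derivative (\<lambda>h. E (D h))) (at p)"
    by (rule has_derivative_compose[OF D E])
  from lift_derivative_unique[OF ev this] have ED: "(\<lambda>h. E (D h)) = (\<lambda>h. h)"
    by (simp add: has_derivative_ident)
  have "det (matrix E ** matrix D) = det (matrix (E \<circ> D))"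
    using matrix_compose[of D E] D E has_derivative_linear by metis
  also have "\<dots> = 1" by (simp add: o_def ED matrix_id_mat_1[unfolded id_def])
  finally have "det (matrix D) \<noteq> 0" by (auto simp: det_mul)
  moreover have "torus_Jac f x = det (matrix D)"
    by (rule torus_Jac_eq[OF p[symmetric] _ D]) (use evU in \<open>auto elim: eventually_mono simp: U(4)\<close>)
  ultimately show ?thesis by simp
qed

section \<open>The lower bound\<close>

lemma torus_Jac_half_turn [simp]: "torus_Jac half_turn x = 1"
  by (simp add: half_turn_def)

text \<open>Every lift of the half-turn displaces each coordinate by an odd multiple of pi, so its
  \<open>gnorm\<close> is at least pi * sqrt (1 + R^2).\<close>

lemma half_turn_far:
  assumes "R > 0"
  shows "pi < torus_dist R x (half_turn x)"
proof -
  obtain p where p: "x = torus_of p" by (rule torus_cases)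
  obtain v where v: "torus_of (p + v) = half_turn x" "torus_dist R x (half_turn x) = gnorm R v"
    unfolding p by (rule torus_dist_attained)
  have "period_rel (p + v) (p + vec pi)"
    using v(1) by (simp add: p half_turn_def torus_shift_torus_of torus_of_eq_iff)
  have far: "pi\<^sup>2 \<le> (v $ i)\<^sup>2" for i
  proof -
    obtain k :: int where "v $ i - pi = 2 * pi * of_int k"
      using \<open>period_rel (p + v) (p + vec pi)\<close> by (auto simp: period_rel_def)
    then have "v $ i = pi * of_int (1 + 2 * k)" by (simp add: algebra_simps)
    moreover have "1 \<le> \<bar>real_of_int (1 + 2 * k)\<bar>"
    proof -
      have "1 \<le> \<bar>1 + 2 * k\<bar>" by presburger
      then show ?thesis by linarith
    qed
    ultimately have "\<bar>pi\<bar> \<le> \<bar>v $ i\<bar>" by (simp add: abs_mult)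
    then show ?thesis by (simp only: abs_le_square_iff)
  qed
  have "0 < R\<^sup>2 * pi\<^sup>2" using assms by simp
  also have "R\<^sup>2 * pi\<^sup>2 \<le> R\<^sup>2 * (v $ 2)\<^sup>2" by (intro mult_left_mono far) simp
  finally have "pi\<^sup>2 < gnorm2 R v" using far[of 1] by (simp add: gnorm2_def)
  then show ?thesis unfolding v(2) gnorm_def by (rule real_less_rsqrt)
qed

lemma coupling_map_measurable:
  assumes "R > 0"
  shows "(\<lambda>x. (cone_pt x 1, cone_pt (half_turn x) 1)) \<in> measurable rho0 (cone2_borel R)"
proof (rule measurable_rho0)
  have "continuous_map euclidean (prod_topology (cone_top R) (cone_top R))
      (\<lambda>p. (cone_pt (torus_of (p + 0)) 1, cone_pt (torus_of (p + vec pi)) 1))"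
    unfolding continuous_map_paired by (intro conjI continuous_map_cone_pt assms) simp_all
  then show "continuous_map euclidean (prod_topology (cone_top R) (cone_top R))
      (\<lambda>p. (cone_pt (torus_of p) 1, cone_pt (half_turn (torus_of p)) 1))"
    by (simp add: half_turn_def torus_shift_torus_of)
qed

lemma coupling_of_half_turn:
  "coupling_of R half_turn = distr rho0 (cone2_borel R) (\<lambda>x. (cone_pt x 1, cone_pt (half_turn x) 1))"
  by (simp add: coupling_of_def)

lemma integral_coupling:
  fixes f :: "cone \<times> cone \<Rightarrow> real"
  assumes "R > 0" "continuous_map (prod_topology (cone_top R) (cone_top R)) euclideanreal f"
  shows "(LINT w|coupling_of R half_turn. f w) = (LINT x|rho0. f (cone_pt x 1, cone_pt (half_turn x) 1))"
  unfolding coupling_of_half_turn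
  by (rule integral_distr[OF coupling_map_measurable[OF assms(1)] borel_measurable_continuous_map[OF assms(2)]])

lemma continuous_map_cone_r_pair:
  assumes "R > 0"
  shows "continuous_map (prod_topology (cone_top R) (cone_top R)) euclideanreal (\<lambda>w. cone_r (fst w))"
    and "continuous_map (prod_topology (cone_top R) (cone_top R)) euclideanreal (\<lambda>w. cone_r (snd w))"
  using continuous_map_compose[OF continuous_map_fst continuous_map_cone_r[OF assms]]
    continuous_map_compose[OF continuous_map_snd continuous_map_cone_r[OF assms]]
  by (simp_all add: o_def)

lemma coupling_in_P2:
  assumes R: "R > 0"
  shows "coupling_of R half_turn \<in> P2_cone2 R"
proof -
  have "prob_space (coupling_of R half_turn)"
    unfolding coupling_of_half_turn
    by (rule prob_space.prob_space_distr[OF prob_space_rho0 coupling_map_measurable[OF R]])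
  moreover have "(\<integral>\<^sup>+w. ennreal ((cone_dist R (fst w) apex)\<^sup>2 + (cone_dist R (snd w) apex)\<^sup>2) \<partial>coupling_of R half_turn) = 2"
  proof -
    interpret prob_space rho0 by (rule prob_space_rho0)
    have m: "(\<lambda>w. cone_r (fst w)) \<in> borel_measurable (cone2_borel R)"
      "(\<lambda>w. cone_r (snd w)) \<in> borel_measurable (cone2_borel R)"
      using continuous_map_cone_r_pair[OF R] by (auto intro: borel_measurable_continuous_map)
    then show ?thesis
      unfolding coupling_of_half_turn
      by (subst nn_integral_distr[OF coupling_map_measurable[OF R]]) (simp_all add: emeasure_space_1[simplified])
  qed
  ultimately show ?thesis by (simp add: P2_cone2_def coupling_of_half_turn)
qed

lemma two_homogeneous_antipodal_defect:
  "two_homogeneous (\<lambda>w. 2 * ((cone_r (fst w))\<^sup>2 + (cone_r (snd w))\<^sup>2) - (cone_dist R (fst w) (snd w))\<^sup>2)"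
  unfolding two_homogeneous_def
  by (intro allI impI) (simp add: cone_dist_cone_pt_sq, simp add: power2_eq_square algebra_simps)

text \<open>The function \<open>2 * (r\<^sub>0\<^sup>2 + r\<^sub>T\<^sup>2) - d\<^sup>2 = (r\<^sub>0 - r\<^sub>T)\<^sup>2 + 2 r\<^sub>0 r\<^sub>T (1 + cos (min d\<^sub>M pi))\<close> is
  nonnegative and 2-homogeneous, and its integral against the coupling vanishes.\<close>

lemma coupling_antipodal:
  assumes R: "R > 0" and \<mu>: "coupling_constraint R T (coupling_of R half_turn) \<mu>"
  shows "AE z in \<mu>. cone_r (z T) = cone_r (z 0) \<and>
    (cone_r (z 0) = 0 \<or> pi \<le> torus_dist R (cone_x xbar (z 0)) (cone_x xbar (z T)))"
proof -
  define f where "f w = 2 * ((cone_r (fst w))\<^sup>2 + (cone_r (snd w))\<^sup>2) - (cone_dist R (fst w) (snd w))\<^sup>2" for w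
  have f_eq: "f w = (cone_r (fst w) - cone_r (snd w))\<^sup>2 + 4 * cone_r (fst w) * cone_r (snd w) *
     (cos (min (torus_dist R (cone_x xbar (fst w)) (cone_x xbar (snd w))) pi / 2))\<^sup>2" for w
    unfolding f_def cone_dist_sq[of R _ _ xbar] cos_squared_eq by (simp add: power2_eq_square algebra_simps)
  have c: "continuous_map (prod_topology (cone_top R) (cone_top R)) euclideanreal f"
    unfolding f_def[abs_def] power2_eq_square
    by (intro continuous_map_diff continuous_map_real_mult_left continuous_map_add continuous_map_real_mult
      continuous_map_cone_r_pair continuous_map_cone_dist R)
  have h: "two_homogeneous f"
    unfolding f_def[abs_def] by (rule two_homogeneous_antipodal_defect)
  have int: "integrable \<mu> (\<lambda>z. f (z 0, z T))" and eq: "(LINT z|\<mu>. f (z 0, z T)) = (LINT w|coupling_of R half_turn. f w)"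
    using \<mu> c h unfolding coupling_constraint_def by blast+
  \<comment> \<open>Both radii are 1, and beyond distance pi the cosine of half the truncated angle
    is 0.\<close>
  have "f (cone_pt x 1, cone_pt (half_turn x) 1) = 0" for x
    using half_turn_far[OF R, of x] by (simp add: f_eq)
  then have "(LINT z|\<mu>. f (z 0, z T)) = 0"
    unfolding eq integral_coupling[OF R c] by simp
  then have "AE z in \<mu>. f (z 0, z T) = 0"
    by (subst (asm) integral_nonneg_eq_0_iff_AE[OF int]) (simp_all add: f_eq)
  then show ?thesis
  proof eventually_elim
    case (elim z)
    let ?m = "min (torus_dist R (cone_x xbar (z 0)) (cone_x xbar (z T))) pi"
    have r: "cone_r (z 0) = cone_r (z T)" "cone_r (z 0) * cone_r (z T) * (cos (?m / 2))\<^sup>2 = 0"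
      using elim by (auto simp: f_eq add_nonneg_eq_0_iff)
    have "pi \<le> torus_dist R (cone_x xbar (z 0)) (cone_x xbar (z T))" if "cone_r (z 0) \<noteq> 0"
    proof (rule ccontr)
      assume "\<not> pi \<le> torus_dist R (cone_x xbar (z 0)) (cone_x xbar (z T))"
      then have "0 < cos (?m / 2)" by (intro cos_gt_zero_pi) (auto intro: less_le_trans[of _ 0])
      then show False using r that by simp
    qed
    then show ?case using r by auto
  qed
qed

text \<open>This is the marginal constraint tested with the constant function 1.\<close>

lemma marginal_total_mass:
  assumes "marginal_constraint T xbar \<mu>" "T > 0"
  shows "integrable \<mu> (\<lambda>z. LINT t:{0..T}|lborel. (cone_r (z t))\<^sup>2)"
    and "(LINT z|\<mu>. (LINT t:{0..T}|lborel. (cone_r (z t))\<^sup>2)) = T"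
proof -
  interpret prob_space rho0 by (rule prob_space_rho0)
  have "continuous_on ({0..T} \<times> UNIV) (\<lambda>w. 1 :: real)" by (rule continuous_on_const)
  note * = assms(1)[unfolded marginal_constraint_def, rule_format, OF this]
  show "integrable \<mu> (\<lambda>z. LINT t:{0..T}|lborel. (cone_r (z t))\<^sup>2)" using * by simp
  have "(LINT t:{0..T}|lborel. (1::real)) = T"
    using assms(2) by (simp add: set_lebesgue_integral_def)
  then show "(LINT z|\<mu>. (LINT t:{0..T}|lborel. (cone_r (z t))\<^sup>2)) = T" using * prob_space by simp
qed

text \<open>\<open>Pstar T\<close> times the total mass T is pi^2 / T, the value that the explicit
  plan has to attain.\<close>

lemma nn_integral_mass:
  assumes "marginal_constraint T xbar \<mu>" "T > 0"
  shows "(\<integral>\<^sup>+z. ennreal (Pstar T * (LINT t:{0..T}|lborel. (cone_r (z t))\<^sup>2)) \<partial>\<mu>) = ennreal (pi\<^sup>2 / T)"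
proof -
  have nn: "0 \<le> (LINT t:{0..T}|lborel. (cone_r (z t))\<^sup>2)" for z :: "real \<Rightarrow> cone"
    unfolding set_lebesgue_integral_def by (rule Bochner_Integration.integral_nonneg) simp
  have "(\<integral>\<^sup>+z. ennreal (Pstar T * (LINT t:{0..T}|lborel. (cone_r (z t))\<^sup>2)) \<partial>\<mu>) =
      ennreal (LINT z|\<mu>. Pstar T * (LINT t:{0..T}|lborel. (cone_r (z t))\<^sup>2))"
    by (rule nn_integral_eq_integral) (use marginal_total_mass(1)[OF assms] nn in \<open>simp_all add: Pstar_def\<close>)
  also have "\<dots> = ennreal (pi\<^sup>2 / T)"
    using marginal_total_mass(2)[OF assms] assms(2) by (simp add: Pstar_def power2_eq_square)
  finally show ?thesis .
qed

lemma space_admissible: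
  assumes "\<mu> \<in> admissible_plans R T xbar \<gamma>"
  shows "sets \<mu> = sets (path_borel R T)" "space \<mu> = mspace (path_metric R T)"
proof -
  show "sets \<mu> = sets (path_borel R T)" using assms by (simp add: admissible_plans_def dynamic_plans_def)
  from sets_eq_imp_space_eq[OF this] show "space \<mu> = mspace (path_metric R T)" by simp
qed

theorem plan_action_ge:
  assumes R: "R > 0" and T: "T > 0" and \<mu>: "\<mu> \<in> admissible_plans R T xbar (coupling_of R half_turn)"
  shows "ennreal (pi\<^sup>2 / T) \<le> plan_action R T xbar \<mu>"
proof -
  have cc: "coupling_constraint R T (coupling_of R half_turn) \<mu>" and mc: "marginal_constraint T xbar \<mu>"
    using \<mu> by (auto simp: admissible_plans_def)
  have "AE z in \<mu>. ennreal (Pstar T * (LINT t:{0..T}|lborel. (cone_r (z t))\<^sup>2)) \<le> path_action R T xbar z"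
    using coupling_antipodal[OF R cc, of xbar] AE_space[of \<mu>]
  proof eventually_elim
    case (elim z)
    then have z: "z \<in> mspace (path_metric R T)" by (simp add: space_admissible[OF \<mu>])
    have "ennreal (Pstar T * (LINT t:{0..T}|lborel. (cone_r (z t))\<^sup>2)) \<le> chain_sup R T z"
      by (rule chain_sup_ge[OF R T z]) (use elim in auto)
    also have "\<dots> \<le> path_action R T xbar z" by (rule chain_sup_le_path_action[OF R T])
    finally show ?case .
  qed
  then have "(\<integral>\<^sup>+z. ennreal (Pstar T * (LINT t:{0..T}|lborel. (cone_r (z t))\<^sup>2)) \<partial>\<mu>) \<le> plan_action R T xbar \<mu>"
    unfolding plan_action_def by (rule nn_integral_mono_AE)
  then show ?thesis by (simp add: nn_integral_mass[OF mc T])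
qed

text \<open>True for arbitrary f by the way \<open>distr\<close> is built: either the image set
  function is a measure, and the preimage is empty, or the result is the zero measure. Thus the path
  map of a flow need not be shown to be Borel.\<close>

lemma emeasure_distr_vimage_empty:
  assumes "f -` A \<inter> space M = {}"
  shows "emeasure (distr M N f) A = 0"
  unfolding distr_def emeasure_measure_of_conv using assms by simp

text \<open>The form of the assumptions on \<phi> covers the rotation and smooth flows at once. The
  action of every path in the plan strictly exceeds its mass bound; since the plan has total mass 1
  and the bound a finite integral, strictness passes to the integrals.\<close>

theorem flow_plan_action_gt:
  assumes R: "R > 0" and T: "T > 0" and adm: "flow_plan R T \<phi> \<in> admissible_plans R T xbar (coupling_of R half_turn)"
    and \<phi>: "\<phi> 0 = id" "\<phi> T = half_turn" "\<And>t x. t \<in> {0..T} \<Longrightarrow> torus_Jac (\<phi> t) x \<noteq> 0"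
  shows "ennreal (pi\<^sup>2 / T) < plan_action R T xbar (flow_plan R T \<phi>)"
proof -
  define \<mu> where "\<mu> = flow_plan R T \<phi>"
  define F where "F z = ennreal (Pstar T * (LINT t:{0..T}|lborel. (cone_r (z t))\<^sup>2))" for z :: "real \<Rightarrow> cone"
  define path where "path x = (\<lambda>t\<in>{0..T}. cone_pt (\<phi> t x) (sqrt \<bar>torus_Jac (\<phi> t) x\<bar>))" for x
  have adm: "\<mu> \<in> admissible_plans R T xbar (coupling_of R half_turn)" using adm by (simp add: \<mu>_def)
  then have mc: "marginal_constraint T xbar \<mu>" and ps: "prob_space \<mu>"
    by (auto simp: admissible_plans_def dynamic_plans_def)
  interpret prob_space \<mu> by (rule ps)
  have mF: "F \<in> borel_measurable \<mu>"
    using borel_measurable_integrable[OF marginal_total_mass(1)[OF mc T]] unfolding F_def by simp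
  have mG: "chain_sup R T \<in> borel_measurable \<mu>"
    using chain_sup_measurable[OF R T] measurable_cong_sets[OF space_admissible(1)[OF adm] refl] by blast
  define A where "A = {z \<in> space \<mu>. \<not> F z < chain_sup R T z}"
  have "A \<in> sets \<mu>" unfolding A_def using mF mG by measurable
  moreover have "emeasure \<mu> A = 0"
    unfolding \<mu>_def flow_plan_def push_plan_def
  proof (rule emeasure_distr_vimage_empty)
    \<comment> \<open>Elements of A lie in the path space, so assuming membership supplies the
      continuity that \<open>chain_sup_gt\<close> requires.\<close>
    have "path x \<notin> A" for x
    proof
      assume "path x \<in> A"
      then have z: "path x \<in> mspace (path_metric R T)" and le: "\<not> F (path x) < chain_sup R T (path x)"
        by (simp_all add: A_def space_admissible[OF adm])
      have "F (path x) < chain_sup R T (path x)"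
        unfolding F_def
      proof (rule chain_sup_gt[OF R T z])
        have id: "torus_Jac id x = 1" using torus_Jac_shift[of 0] by (simp add: torus_shift_0)
        show "cone_r (path x T) = cone_r (path x 0)"
          using T by (simp add: path_def \<phi> id)
        show "0 < cone_r (path x t)" if "t \<in> {0..T}" for t
          using that \<phi>(3)[OF that, of x] by (simp add: path_def)
        show "pi < torus_dist R (cone_x undefined (path x 0)) (cone_x undefined (path x T))"
          using T half_turn_far[OF R, of x] by (simp add: path_def \<phi> id)
      qed
      with le show False by simp
    qed
    then show "(\<lambda>x. \<lambda>t\<in>{0..T}. cone_pt (\<phi> t x) (sqrt \<bar>torus_Jac (\<phi> t) x\<bar>)) -` A \<inter> space rho0 = {}"
      unfolding path_def by auto
  qed
  ultimately have "A \<in> null_sets \<mu>" by (rule null_setsI[rotated])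
  then have AE: "AE z in \<mu>. F z < chain_sup R T z"
    by (rule AE_I') (simp only: A_def order_refl)
  have "(\<integral>\<^sup>+z. F z \<partial>\<mu>) < (\<integral>\<^sup>+z. chain_sup R T z \<partial>\<mu>)"
  proof (rule nn_integral_less[OF mF mG])
    show "(\<integral>\<^sup>+z. F z \<partial>\<mu>) \<noteq> \<infinity>" unfolding F_def nn_integral_mass[OF mc T] by simp
    show "AE z in \<mu>. F z \<le> chain_sup R T z" using AE by (auto elim: eventually_mono)
    show "\<not> (AE z in \<mu>. chain_sup R T z \<le> F z)"
    proof
      assume "AE z in \<mu>. chain_sup R T z \<le> F z"
      with AE have "AE z in \<mu>. False" by eventually_elim simp
      then show False by simp
    qed
  qed
  also have "\<dots> \<le> plan_action R T xbar \<mu>"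
    unfolding plan_action_def by (intro nn_integral_mono chain_sup_le_path_action R T)
  finally show ?thesis unfolding F_def nn_integral_mass[OF mc T] unfolding \<mu>_def .
qed

section \<open>Integration against \<open>rho0\<close> and against half sums\<close>

lemma ennreal_add_half: "0 \<le> x \<Longrightarrow> 0 \<le> y \<Longrightarrow> ennreal x / 2 + ennreal y / 2 = ennreal ((x + y) / 2)"
  by (simp add: add_divide_distrib ennreal_divide_numeral)

lemma ennreal_add_halves: "c / 2 + c / 2 = (c :: ennreal)"
  by (cases c) (auto simp: ennreal_add_half ennreal_top_divide)

lemma nn_integral_half_sum:
  assumes sets: "sets \<nu> = sets \<mu>" and f: "f \<in> borel_measurable \<mu>"
  shows "(\<integral>\<^sup>+x. f x \<partial>half_sum \<mu> \<nu>) = (\<integral>\<^sup>+x. f x \<partial>\<mu>) / 2 + (\<integral>\<^sup>+x. f x \<partial>\<nu>) / 2"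
  using f
proof (induction rule: borel_measurable_induct)
  case (cong f g)
  have "space \<nu> = space \<mu>" using sets by (rule sets_eq_imp_space_eq)
  then have "(\<integral>\<^sup>+x. f x \<partial>M) = (\<integral>\<^sup>+x. g x \<partial>M)" if "M \<in> {\<mu>, \<nu>, half_sum \<mu> \<nu>}" for M
    using that cong(3) by (intro nn_integral_cong) auto
  then show ?case using cong by simp
next
  case (set A)
  then show ?case using sets by (simp add: emeasure_half_sum)
next
  case (mult u c)
  have m: "u \<in> borel_measurable \<nu>" "u \<in> borel_measurable (half_sum \<mu> \<nu>)"
    using mult(2) sets by (simp_all cong: measurable_cong_sets)
  show ?case
    using mult m by (simp add: nn_integral_cmult divide_ennreal_def distrib_left mult.assoc)
next
  case (add u v)
  have m: "u \<in> borel_measurable \<nu>" "u \<in> borel_measurable (half_sum \<mu> \<nu>)"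
    "v \<in> borel_measurable \<nu>" "v \<in> borel_measurable (half_sum \<mu> \<nu>)"
    using add sets by (simp_all cong: measurable_cong_sets)
  show ?case
    using add m by (simp add: nn_integral_add add_divide_distrib_ennreal ac_simps)
next
  case (seq U)
  have m: "U i \<in> borel_measurable \<nu>" "U i \<in> borel_measurable (half_sum \<mu> \<nu>)" for i
    using seq(1) sets by (simp_all cong: measurable_cong_sets)
  have inc: "incseq (\<lambda>i. \<integral>\<^sup>+x. U i x \<partial>M)" for M
    using seq(3) by (auto simp: incseq_def le_fun_def intro!: nn_integral_mono)
  have "(\<integral>\<^sup>+x. (SUP i. U i) x \<partial>half_sum \<mu> \<nu>) = (SUP i. (\<integral>\<^sup>+x. U i x \<partial>\<mu>) / 2 + (\<integral>\<^sup>+x. U i x \<partial>\<nu>) / 2)"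
    using seq m by (simp add: nn_integral_monotone_convergence_SUP image_comp)
  also have "\<dots> = (SUP i. (\<integral>\<^sup>+x. U i x \<partial>\<mu>) / 2) + (SUP i. (\<integral>\<^sup>+x. U i x \<partial>\<nu>) / 2)"
    by (rule ennreal_SUP_add) (use inc[THEN incseqD] in \<open>auto simp: incseq_def intro!: divide_right_mono_ennreal\<close>)
  also have "\<dots> = (\<integral>\<^sup>+x. (SUP i. U i) x \<partial>\<mu>) / 2 + (\<integral>\<^sup>+x. (SUP i. U i) x \<partial>\<nu>) / 2"
    using seq m by (simp add: nn_integral_monotone_convergence_SUP image_comp SUP_divide_ennreal)
  finally show ?case .
qed

lemma integral_half_sum:
  fixes f :: "'a \<Rightarrow> real"
  assumes sets: "sets \<nu> = sets \<mu>" and f: "integrable \<mu> f" "integrable \<nu> f"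
  shows "integrable (half_sum \<mu> \<nu>) f"
    and "(LINT x|half_sum \<mu> \<nu>. f x) = ((LINT x|\<mu>. f x) + (LINT x|\<nu>. f x)) / 2"
proof -
  have m: "f \<in> borel_measurable \<mu>" using f(1) by (rule borel_measurable_integrable)
  have m': "f \<in> borel_measurable (half_sum \<mu> \<nu>)" using m by (simp cong: measurable_cong_sets)
  have nn: "(\<integral>\<^sup>+x. ennreal (g (f x)) \<partial>half_sum \<mu> \<nu>) = (\<integral>\<^sup>+x. ennreal (g (f x)) \<partial>\<mu>) / 2 + (\<integral>\<^sup>+x. ennreal (g (f x)) \<partial>\<nu>) / 2"
    if "g \<in> borel_measurable borel" for g :: "real \<Rightarrow> real"
    by (rule nn_integral_half_sum[OF sets]) (use m that in measurable)
  have "(\<integral>\<^sup>+x. ennreal (norm (f x)) \<partial>half_sum \<mu> \<nu>) < \<infinity>"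
    using f nn[of norm] by (simp add: integrable_iff_bounded ennreal_divide_eq_top_iff less_top[symmetric])
  then show int: "integrable (half_sum \<mu> \<nu>) f" using m' by (simp add: integrable_iff_bounded)
  have half: "enn2real (a / 2 + b / 2) = (enn2real a + enn2real b) / 2" if ab: "a < \<infinity>" "b < \<infinity>" for a b
  proof -
    obtain x y where "a = ennreal x" "b = ennreal y" "0 \<le> x" "0 \<le> y"
      using ab by (cases a; cases b) auto
    then show ?thesis by (simp add: ennreal_add_half)
  qed
  have fin: "(\<integral>\<^sup>+x. ennreal (f x) \<partial>M) < \<infinity>" "(\<integral>\<^sup>+x. ennreal (- f x) \<partial>M) < \<infinity>"
    if "integrable M f" for M
    using that by (simp_all add: real_integrable_def less_top[symmetric])
  show "(LINT x|half_sum \<mu> \<nu>. f x) = ((LINT x|\<mu>. f x) + (LINT x|\<nu>. f x)) / 2"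
    unfolding real_lebesgue_integral_def[OF int] real_lebesgue_integral_def[OF f(1)] real_lebesgue_integral_def[OF f(2)]
    using nn[of "\<lambda>x. x"] nn[of uminus] half[OF fin(1)[OF f(1)] fin(1)[OF f(2)]] half[OF fin(2)[OF f(1)] fin(2)[OF f(2)]]
    by (simp add: field_simps)
qed

text \<open>The integrand need not be measurable: the integral is a supremum over simple functions.\<close>

lemma nn_integral_half_sum_distr_le:
  assumes "prob_space M" and g: "g1 \<in> measurable M N" "g2 \<in> measurable M N"
    and f: "\<And>x. x \<in> space M \<Longrightarrow> f (g1 x) \<le> c" "\<And>x. x \<in> space M \<Longrightarrow> f (g2 x) \<le> c"
  shows "(\<integral>\<^sup>+z. f z \<partial>half_sum (distr M N g1) (distr M N g2)) \<le> c"
  unfolding nn_integral_def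
proof (rule SUP_least)
  interpret prob_space M by fact
  let ?H = "half_sum (distr M N g1) (distr M N g2)"
  fix s assume "s \<in> {s. simple_function ?H s \<and> s \<le> f}"
  then have s: "simple_function ?H s" "s \<le> f" by auto
  have m: "s \<in> borel_measurable N"
    using borel_measurable_simple_function[OF s(1)] by (simp cong: measurable_cong_sets)
  have "integral\<^sup>S ?H s = (\<integral>\<^sup>+x. s x \<partial>?H)" by (rule nn_integral_eq_simple_integral[OF s(1), symmetric])
  also have "\<dots> = (\<integral>\<^sup>+x. s (g1 x) \<partial>M) / 2 + (\<integral>\<^sup>+x. s (g2 x) \<partial>M) / 2"
    using m g by (subst nn_integral_half_sum) (simp_all add: nn_integral_distr)
  also have "\<dots> \<le> (\<integral>\<^sup>+x. c \<partial>M) / 2 + (\<integral>\<^sup>+x. c \<partial>M) / 2"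
    using f s(2) by (intro add_mono divide_right_mono_ennreal nn_integral_mono) (auto simp: le_fun_def intro: order_trans)
  also have "\<dots> = c" by (simp add: emeasure_space_1 ennreal_add_halves)
  finally show "integral\<^sup>S ?H s \<le> c" .
qed

lemma continuous_on_torus_of [continuous_intros]:
  "continuous_on S f \<Longrightarrow> continuous_on S (\<lambda>x. torus_of (f x))"
proof -
  have "continuous_on UNIV torus_of"
    by (subst continuous_on_open_vimage) (auto simp: open_torus_def)
  then show "continuous_on S f \<Longrightarrow> continuous_on S (\<lambda>x. torus_of (f x))"
    by (rule continuous_on_compose2) auto
qed

text \<open>Fractional parts choose a representative in the fundamental square, whose compactness
  then bounds continuous functions on the torus.\<close>

lemma torus_cases_box:
  obtains p where "x = torus_of p" "p \<in> cbox 0 (vec (2 * pi))"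
proof -
  obtain q where q: "x = torus_of q" by (rule torus_cases)
  define p :: "real^2" where "p = (\<chi> i. 2 * pi * frac (q $ i / (2 * pi)))"
  have "period_rel p q"
    unfolding period_rel_def
  proof
    fix i
    have "p $ i - q $ i = 2 * pi * of_int (- \<lfloor>q $ i / (2 * pi)\<rfloor>)"
      by (simp add: p_def frac_def right_diff_distrib)
    then show "\<exists>k::int. p $ i - q $ i = 2 * pi * of_int k" by blast
  qed
  moreover have "p \<in> cbox 0 (vec (2 * pi))"
    using less_imp_le[OF frac_lt_1] by (auto simp: mem_box_cart p_def frac_ge_0)
  ultimately show thesis using that[of p] q torus_of_eq_iff by metis
qed

lemma measurable_rho0_iff: "measurable rho0 N = measurable borel N"
  by (rule measurable_cong_sets) simp_all

lemma integrable_rho0: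
  fixes F :: "torus \<Rightarrow> real"
  assumes "continuous_on UNIV (\<lambda>p. F (torus_of p))"
  shows "integrable rho0 F" and "F \<in> borel_measurable borel"
proof -
  interpret prob_space rho0 by (rule prob_space_rho0)
  show m: "F \<in> borel_measurable borel"
  proof (rule borel_measurableI)
    fix S :: "real set" assume "open S"
    then have "open ((\<lambda>p. F (torus_of p)) -` S)" using assms by (simp add: continuous_on_open_vimage)
    then show "F -` S \<inter> space borel \<in> sets borel" by (simp add: open_torus_def vimage_def)
  qed
  have "compact ((\<lambda>p. F (torus_of p)) ` cbox 0 (vec (2 * pi)))"
    by (intro compact_continuous_image continuous_on_subset[OF assms]) auto
  from compact_imp_bounded[OF this] obtain B
    where B: "\<forall>y\<in>(\<lambda>p. F (torus_of p)) ` cbox 0 (vec (2 * pi)). norm y \<le> B"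
    unfolding bounded_iff by blast
  have "norm (F x) \<le> B" for x by (rule torus_cases_box[of x]) (use B in simp)
  then show "integrable rho0 F"
    by (intro integrable_const_bound[of _ B]) (use m in \<open>simp_all add: measurable_rho0_iff\<close>)
qed

section \<open>Invariance of \<open>rho0\<close> under the half-turn\<close>

definition half_box :: "int \<Rightarrow> int \<Rightarrow> (real^2) set" where
  "half_box i j = {p. pi * of_int i \<le> p $ 1 \<and> p $ 1 < pi * of_int (i + 1) \<and>
     pi * of_int j \<le> p $ 2 \<and> p $ 2 < pi * of_int (j + 1)}"

lemma half_box_measurable [measurable]: "half_box i j \<in> sets borel"
proof -
  have [measurable]: "(\<lambda>p::real^2. p $ k) \<in> borel_measurable borel" for k
    by (intro borel_measurable_continuous_onI continuous_intros)
  show ?thesis unfolding half_box_def by measurable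
qed

lemma nn_integral_translate:
  fixes g :: "real^2 \<Rightarrow> ennreal"
  assumes "g \<in> borel_measurable borel"
  shows "(\<integral>\<^sup>+p. g (p + c) \<partial>lborel) = (\<integral>\<^sup>+p. g p \<partial>lborel)"
proof -
  have "(\<integral>\<^sup>+p. g p \<partial>lborel) = (\<integral>\<^sup>+p. g p \<partial>distr lborel borel ((+) c))" by (simp add: lborel_distr_plus)
  also have "\<dots> = (\<integral>\<^sup>+p. g (c + p) \<partial>lborel)" using assms by (subst nn_integral_distr) auto
  finally show ?thesis by (simp add: add.commute)
qed

lemma AE_lborel_component_neq: "AE p in lborel. (p :: real^2) $ k \<noteq> c"
proof -
  have "{p :: real^2. p $ k = c} \<in> null_sets lebesgue"
    unfolding negligible_iff_null_sets[symmetric]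
    using negligible_standard_hyperplane[of "axis k (1::real) :: real^2" c]
    by (simp add: axis_in_Basis_iff cart_eq_inner_axis)
  then have "AE p in lebesgue. p \<notin> {p :: real^2. p $ k = c}" by (rule AE_not_in)
  then show ?thesis by (simp add: AE_completion_iff)
qed

text \<open>Cut the fundamental square into four squares of side \<open>pi\<close>; the half-turn permutes their
  classes modulo the lattice.\<close>

lemma nn_integral_half_turn_box:
  fixes g :: "real^2 \<Rightarrow> ennreal"
  assumes g: "g \<in> borel_measurable borel" and per: "\<And>k p. g (p + (2 * pi) *\<^sub>R axis k 1) = g p"
  shows "(\<integral>\<^sup>+p. g (p + vec pi) * indicator (cbox 0 (vec (2 * pi))) p \<partial>lborel) =
    (\<integral>\<^sup>+p. g p * indicator (cbox 0 (vec (2 * pi))) p \<partial>lborel)"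
proof -
  define J where "J i j = (\<integral>\<^sup>+p. g p * indicator (half_box i j) p \<partial>lborel)" for i j
  have split: "(\<integral>\<^sup>+p. h p * indicator (cbox 0 (vec (2 * pi))) p \<partial>lborel) =
      (\<integral>\<^sup>+p. h p * indicator (half_box 0 0) p \<partial>lborel) + (\<integral>\<^sup>+p. h p * indicator (half_box 0 1) p \<partial>lborel) +
      (\<integral>\<^sup>+p. h p * indicator (half_box 1 0) p \<partial>lborel) + (\<integral>\<^sup>+p. h p * indicator (half_box 1 1) p \<partial>lborel)"
    if h: "h \<in> borel_measurable borel" for h :: "real^2 \<Rightarrow> ennreal"
  proof -
    have "AE p in lborel. (h p * indicator (cbox 0 (vec (2 * pi))) p :: ennreal) =
      h p * indicator (half_box 0 0) p + h p * indicator (half_box 0 1) p +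
      h p * indicator (half_box 1 0) p + h p * indicator (half_box 1 1) p"
      using AE_lborel_component_neq[of 1 "2 * pi"] AE_lborel_component_neq[of 2 "2 * pi"]
    proof eventually_elim
      case (elim p)
      consider "p \<in> half_box 0 0" | "p \<in> half_box 0 1" | "p \<in> half_box 1 0" | "p \<in> half_box 1 1"
        | "p \<notin> half_box 0 0" "p \<notin> half_box 0 1" "p \<notin> half_box 1 0" "p \<notin> half_box 1 1" by blast
      then show ?case
      proof cases
        case 5
        then have "p \<notin> cbox 0 (vec (2 * pi))"
          using elim by (auto simp: half_box_def mem_box_cart forall_2 not_le not_less)
        then show ?thesis using 5 by simp
      qed (use pi_gt_zero in \<open>auto simp: half_box_def mem_box_cart forall_2 indicator_def\<close>)
    qed
    from nn_integral_cong_AE[OF this] show ?thesis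
      using h by (simp add: nn_integral_add)
  qed
  have tr: "(\<integral>\<^sup>+p. g (p + c) * indicator (half_box i j) p \<partial>lborel) =
      (\<integral>\<^sup>+p. g p * indicator (half_box i j) (p - c) \<partial>lborel)" for i j c
    using nn_integral_translate[of "\<lambda>p. g p * indicator (half_box i j) (p - c)" c] g by simp
  have shift: "(\<integral>\<^sup>+p. g (p + vec pi) * indicator (half_box i j) p \<partial>lborel) = J (i + 1) (j + 1)" for i j
    unfolding tr J_def by (intro nn_integral_cong) (auto simp: half_box_def indicator_def algebra_simps)
  \<comment> \<open>Periodicity makes J depend on its indices modulo 2 only, so raising both indices
    by 1 permutes the four values.\<close>
  have J1: "J (i + 2) j = J i j" for i j
  proof -
    have "J i j = (\<integral>\<^sup>+p. g (p + (2 * pi) *\<^sub>R axis 1 1) * indicator (half_box i j) p \<partial>lborel)"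
      by (simp add: J_def per)
    also have "\<dots> = J (i + 2) j"
      unfolding tr J_def by (intro nn_integral_cong) (auto simp: half_box_def indicator_def axis_def algebra_simps)
    finally show ?thesis ..
  qed
  have J2: "J i (j + 2) = J i j" for i j
  proof -
    have "J i j = (\<integral>\<^sup>+p. g (p + (2 * pi) *\<^sub>R axis 2 1) * indicator (half_box i j) p \<partial>lborel)"
      by (simp add: J_def per)
    also have "\<dots> = J i (j + 2)"
      unfolding tr J_def by (intro nn_integral_cong) (auto simp: half_box_def indicator_def axis_def algebra_simps)
    finally show ?thesis ..
  qed
  have "(\<lambda>p. g (p + vec pi)) \<in> borel_measurable borel" using g by measurable
  then have "(\<integral>\<^sup>+p. g (p + vec pi) * indicator (cbox 0 (vec (2 * pi))) p \<partial>lborel) = J 1 1 + J 1 2 + J 2 1 + J 2 2"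
    by (simp add: split shift)
  moreover have "(\<integral>\<^sup>+p. g p * indicator (cbox 0 (vec (2 * pi))) p \<partial>lborel) = J 0 0 + J 0 1 + J 1 0 + J 1 1"
    by (simp add: split[OF g] J_def)
  ultimately show ?thesis
    using J1[of 0 0] J1[of 0 1] J2[of 0 0] J2[of 1 0] J2[of 2 0] by (simp add: ac_simps)
qed

lemma half_turn_measurable [measurable]: "half_turn \<in> measurable borel borel"
proof (rule borel_measurableI)
  fix U :: "torus set" assume "open U"
  then have "open (torus_of -` U)" by (simp add: open_torus_def)
  then have "open ((\<lambda>p. p + vec pi) -` (torus_of -` U))"
    by (rule open_vimage) (intro continuous_intros)
  moreover have "torus_of -` (half_turn -` U) = (\<lambda>p. p + vec pi) -` (torus_of -` U)"
    by (auto simp: half_turn_def torus_shift_torus_of)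
  ultimately show "half_turn -` U \<inter> space borel \<in> sets borel" by (simp add: open_torus_def)
qed

text \<open>The marginal constraint relies on this: after time T / 2 the second family of paths sits
  over the half-turned points, which must again be distributed by \<open>rho0\<close>.\<close>

lemma distr_rho0_half_turn: "distr rho0 borel half_turn = rho0"
proof (rule measure_eqI)
  fix A assume "A \<in> sets (distr rho0 borel half_turn)"
  then have A: "A \<in> sets borel" by simp
  have ind_torus: "(\<lambda>p. indicator B (torus_of p) :: ennreal) \<in> borel_measurable borel" if "B \<in> sets borel" for B
  proof -
    have "torus_of -` B \<in> sets borel" using measurable_sets[OF measurable_torus_of that] by simp
    then have "(indicator (torus_of -` B) :: _ \<Rightarrow> ennreal) \<in> borel_measurable borel" by simp
    moreover have "indicator (torus_of -` B) = (\<lambda>p. indicator B (torus_of p) :: ennreal)"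
      by (auto simp: indicator_def)
    ultimately show ?thesis by simp
  qed
  have em: "emeasure rho0 B = ennreal (1 / (2 * pi)\<^sup>2) *
      (\<integral>\<^sup>+p. indicator B (torus_of p) * indicator (cbox 0 (vec (2 * pi))) p \<partial>lborel)"
    if B: "B \<in> sets borel" for B
  proof -
    have v: "torus_of -` B \<in> sets borel" using measurable_sets[OF measurable_torus_of B] by simp
    have "emeasure rho0 B = (\<integral>\<^sup>+p. ennreal (1 / (2 * pi)\<^sup>2) * indicator (cbox 0 (vec (2 * pi))) p * indicator (torus_of -` B) p \<partial>lborel)"
      unfolding rho0_def using B v by (simp add: emeasure_distr emeasure_density)
    also have "\<dots> = (\<integral>\<^sup>+p. ennreal (1 / (2 * pi)\<^sup>2) * (indicator B (torus_of p) * indicator (cbox 0 (vec (2 * pi))) p) \<partial>lborel)"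
      by (intro nn_integral_cong) (auto simp: indicator_def)
    also have "\<dots> = ennreal (1 / (2 * pi)\<^sup>2) * (\<integral>\<^sup>+p. indicator B (torus_of p) * indicator (cbox 0 (vec (2 * pi))) p \<partial>lborel)"
      by (rule nn_integral_cmult) (use ind_torus[OF B] in simp)
    finally show ?thesis .
  qed
  have v: "half_turn -` A \<in> sets borel" using measurable_sets[OF half_turn_measurable A] by simp
  have "emeasure (distr rho0 borel half_turn) A = emeasure rho0 (half_turn -` A)"
    using A by (subst emeasure_distr) (auto simp: measurable_rho0_iff)
  also have "\<dots> = ennreal (1 / (2 * pi)\<^sup>2) *
      (\<integral>\<^sup>+p. indicator A (torus_of (p + vec pi)) * indicator (cbox 0 (vec (2 * pi))) p \<partial>lborel)"
    unfolding em[OF v] by (simp add: half_turn_def torus_shift_torus_of indicator_def)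
  also have "(\<integral>\<^sup>+p. indicator A (torus_of (p + vec pi)) * indicator (cbox 0 (vec (2 * pi))) p \<partial>lborel) =
      (\<integral>\<^sup>+p. indicator A (torus_of p) * indicator (cbox 0 (vec (2 * pi))) p \<partial>lborel)"
  proof (rule nn_integral_half_turn_box)
    show "(\<lambda>p. indicator A (torus_of p) :: ennreal) \<in> borel_measurable borel" by (rule ind_torus[OF A])
    fix k :: 2 and p :: "real^2"
    have "torus_of (p + (2 * pi) *\<^sub>R axis k 1) = torus_of p"
      unfolding torus_of_eq_iff period_rel_def
    proof
      fix i
      have "(p + (2 * pi) *\<^sub>R axis k 1) $ i - p $ i = 2 * pi * of_int (if i = k then 1 else 0)"
        by (simp add: axis_def)
      then show "\<exists>m::int. (p + (2 * pi) *\<^sub>R axis k 1) $ i - p $ i = 2 * pi * of_int m" by blast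
    qed
    then show "indicator A (torus_of (p + (2 * pi) *\<^sub>R axis k 1)) = (indicator A (torus_of p) :: ennreal)"
      by simp
  qed
  finally show "emeasure (distr rho0 borel half_turn) A = emeasure rho0 A" by (simp add: em[OF A])
qed simp

lemma integral_rho0_half_turn:
  fixes F :: "torus \<Rightarrow> real"
  assumes "F \<in> borel_measurable borel"
  shows "(LINT x|rho0. F (half_turn x)) = (LINT x|rho0. F x)"
proof -
  have "(LINT x|rho0. F x) = (LINT x|distr rho0 borel half_turn. F x)" by (simp add: distr_rho0_half_turn)
  also have "\<dots> = (LINT x|rho0. F (half_turn x))"
    by (rule integral_distr) (use assms in \<open>simp_all add: measurable_rho0_iff\<close>)
  finally show ?thesis ..
qed

section \<open>The explicit plan\<close>

lemma continuous_on_torus_fun: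
  fixes f :: "real \<times> torus \<Rightarrow> real"
  assumes "continuous_on ({0..T} \<times> UNIV) f"
  shows "continuous_on ({0..T} \<times> UNIV) (\<lambda>w. f (fst w, torus_of (snd w)))"
  by (rule continuous_on_compose2[OF assms]) (auto intro!: continuous_intros)

lemma torus_fun_bounded:
  fixes f :: "real \<times> torus \<Rightarrow> real"
  assumes f: "continuous_on ({0..T} \<times> UNIV) f"
  obtains B where "0 \<le> B" "\<And>s x. s \<in> {0..T} \<Longrightarrow> \<bar>f (s, x)\<bar> \<le> B"
proof -
  let ?K = "{0..T} \<times> cbox 0 (vec (2 * pi) :: real^2)"
  have "compact ((\<lambda>w. f (fst w, torus_of (snd w))) ` ?K)"
    by (intro compact_continuous_image continuous_on_subset[OF continuous_on_torus_fun[OF f]] compact_Times) auto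
  from compact_imp_bounded[OF this] obtain B
    where B: "\<forall>y\<in>(\<lambda>w. f (fst w, torus_of (snd w))) ` ?K. norm y \<le> B"
    unfolding bounded_iff by blast
  show thesis
  proof (rule that[of "max B 0"])
    fix s x assume s: "s \<in> {0..T}"
    obtain p where p: "x = torus_of p" "p \<in> cbox 0 (vec (2 * pi))" by (rule torus_cases_box)
    have "norm (f (fst (s, p), torus_of (snd (s, p)))) \<le> B"
      by (rule B[THEN bspec], rule imageI) (use s p in simp)
    then show "\<bar>f (s, x)\<bar> \<le> max B 0" using p by simp
  qed simp
qed

lemma norm_le_gnorm:
  assumes "R > 0"
  shows "norm v \<le> (1 + 1 / R) * gnorm R v"
proof -
  have "norm v \<le> \<bar>v $ 1\<bar> + \<bar>v $ 2\<bar>" using norm_le_l1_cart[of v] by (simp add: sum_2)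
  also have "\<bar>v $ 1\<bar> \<le> gnorm R v" by (rule gnorm_component_le(1))
  also have "\<bar>v $ 2\<bar> \<le> gnorm R v / R" using gnorm_component_le(2)[of R v] assms by (simp add: field_simps)
  finally show ?thesis by (simp add: algebra_simps)
qed

text \<open>The weight \<open>r\<^sup>2\<close> makes \<open>f (t, x) * r\<^sup>2\<close> continuous at the apex.\<close>

lemma weighted_tendsto:
  fixes f :: "real \<times> torus \<Rightarrow> real"
  assumes R: "R > 0" and f: "continuous_on ({0..T} \<times> UNIV) f"
    and s: "(s \<longlongrightarrow> t) F" and ev: "\<forall>\<^sub>F i in F. s i \<in> {0..T}" and t: "t \<in> {0..T}"
    and w: "((\<lambda>i. cone_dist R (w i) v) \<longlongrightarrow> 0) F"
  shows "((\<lambda>i. f (s i, cone_x xbar (w i)) * (cone_r (w i))\<^sup>2) \<longlongrightarrow> f (t, cone_x xbar v) * (cone_r v)\<^sup>2) F"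
proof -
  have r: "((\<lambda>i. cone_r (w i)) \<longlongrightarrow> cone_r v) F"
  proof -
    have "((\<lambda>i. cone_r (w i) - cone_r v) \<longlongrightarrow> 0) F"
      by (rule Lim_null_comparison[OF _ w]) (simp add: cone_r_diff_le)
    then show ?thesis by (simp add: LIM_zero_iff)
  qed
  show ?thesis
  proof (cases "cone_r v = 0")
    case True
    obtain B where B: "0 \<le> B" "\<And>s x. s \<in> {0..T} \<Longrightarrow> \<bar>f (s, x)\<bar> \<le> B"
      using torus_fun_bounded[OF f] by blast
    have "((\<lambda>i. B * (cone_r (w i))\<^sup>2) \<longlongrightarrow> B * (cone_r v)\<^sup>2) F" by (intro tendsto_intros r)
    then have "((\<lambda>i. B * (cone_r (w i))\<^sup>2) \<longlongrightarrow> 0) F" by (simp add: True)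
    moreover have "\<forall>\<^sub>F i in F. norm (f (s i, cone_x xbar (w i)) * (cone_r (w i))\<^sup>2) \<le> B * (cone_r (w i))\<^sup>2"
      using ev by eventually_elim (auto simp: abs_mult intro!: mult_right_mono B)
    ultimately have "((\<lambda>i. f (s i, cone_x xbar (w i)) * (cone_r (w i))\<^sup>2) \<longlongrightarrow> 0) F"
      by (rule Lim_null_comparison[rotated])
    then show ?thesis by (simp add: True)
  next
    case False
    then have rv: "cone_r v > 0" by (simp add: less_le)
    define d where "d i = torus_dist R (cone_x xbar v) (cone_x xbar (w i))" for i
    have ev_r: "\<forall>\<^sub>F i in F. cone_r v / 2 < cone_r (w i)"
      using order_tendstoD(1)[OF r, of "cone_r v / 2"] rv by simp
    \<comment> \<open>Once the radius of \<open>w i\<close> exceeds half that of v,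
      \<open>sin_ge_half\<close> bounds the squared cone distance below by r^2 * m^2 / 8, with r the
      radius of v and m = min (d i) pi; the factor 3 absorbs sqrt 8.\<close>
    have "\<forall>\<^sub>F i in F. min (d i) pi \<le> 3 / cone_r v * cone_dist R (w i) v"
      using ev_r
    proof eventually_elim
      case (elim i)
      have "min (d i) pi / 2 / 2 \<le> sin (min (d i) pi / 2)"
        by (rule sin_ge_half) (auto simp: d_def)
      then have "(min (d i) pi / 2 / 2)\<^sup>2 \<le> (sin (min (d i) pi / 2))\<^sup>2"
        by (intro power_mono) (auto simp: d_def)
      moreover have "cone_r v / 2 * cone_r v \<le> cone_r (w i) * cone_r v"
        using elim rv by (intro mult_right_mono) auto
      ultimately have "4 * (cone_r v / 2 * cone_r v) * (min (d i) pi / 2 / 2)\<^sup>2 \<le>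
          4 * (cone_r (w i) * cone_r v) * (sin (min (d i) pi / 2))\<^sup>2"
        by (intro mult_mono) (auto simp: rv less_imp_le)
      also have "\<dots> \<le> (cone_dist R (w i) v)\<^sup>2"
        unfolding cone_dist_sq[of R _ _ xbar] d_def torus_dist_commute[of R "cone_x xbar v"]
        by (simp add: mult.assoc)
      finally have "(cone_r v)\<^sup>2 * (min (d i) pi)\<^sup>2 / 8 \<le> (cone_dist R (w i) v)\<^sup>2"
        by (simp add: power_divide power2_eq_square[of "cone_r v"])
      then have "(cone_r v)\<^sup>2 * (min (d i) pi)\<^sup>2 \<le> 9 * (cone_dist R (w i) v)\<^sup>2"
        using zero_le_power2[of "cone_dist R (w i) v"] by linarith
      then have "(cone_r v * min (d i) pi)\<^sup>2 \<le> (3 * cone_dist R (w i) v)\<^sup>2"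
        by (simp add: power_mult_distrib)
      then have "cone_r v * min (d i) pi \<le> 3 * cone_dist R (w i) v"
        by (rule power2_le_imp_le) simp
      then show ?case using rv by (simp add: field_simps)
    qed
    moreover have "((\<lambda>i. 3 / cone_r v * cone_dist R (w i) v) \<longlongrightarrow> 0) F"
      by (rule tendsto_mult_right_zero[OF w])
    moreover have "0 \<le> min (d i) pi" for i by (simp add: d_def)
    ultimately have m0: "((\<lambda>i. min (d i) pi) \<longlongrightarrow> 0) F"
      by (intro Lim_null_comparison[where f="\<lambda>i. min (d i) pi"]) auto
    have "\<forall>\<^sub>F i in F. min (d i) pi < pi" using order_tendstoD(2)[OF m0] pi_gt_zero by blast
    then have "\<forall>\<^sub>F i in F. min (d i) pi = d i" by eventually_elim (auto simp: min_def split: if_splits)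
    with m0 have d0: "(d \<longlongrightarrow> 0) F" by (simp add: tendsto_cong)
    obtain p where p: "cone_x xbar v = torus_of p" by (rule torus_cases)
    \<comment> \<open>Shortest displacements from a fixed lift p of the limit point turn the
      convergence into one in the plane, where the lifted f is continuous.\<close>
    have "\<exists>u. torus_of (p + u) = cone_x xbar (w i) \<and> d i = gnorm R u" for i
      unfolding d_def p by (rule torus_dist_attained[of p "cone_x xbar (w i)" R]) blast
    then obtain u where u: "\<And>i. torus_of (p + u i) = cone_x xbar (w i)" "\<And>i. d i = gnorm R (u i)"
      by metis
    have "((\<lambda>i. (1 + 1 / R) * d i) \<longlongrightarrow> 0) F" by (rule tendsto_mult_right_zero[OF d0])
    then have "(u \<longlongrightarrow> 0) F"
      by (rule Lim_null_comparison[rotated]) (use norm_le_gnorm[OF R] in \<open>simp add: u\<close>)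
    then have "((\<lambda>i. (s i, p + u i)) \<longlongrightarrow> (t, p + 0)) F"
      by (intro tendsto_Pair tendsto_add tendsto_const s)
    then have "((\<lambda>i. (s i, p + u i)) \<longlongrightarrow> (t, p)) F" by simp
    from continuous_on_tendsto_compose[OF continuous_on_torus_fun[OF f] this]
    have "((\<lambda>i. f (s i, torus_of (p + u i))) \<longlongrightarrow> f (t, torus_of p)) F"
      using t ev by simp
    then have "((\<lambda>i. f (s i, cone_x xbar (w i))) \<longlongrightarrow> f (t, cone_x xbar v)) F" by (simp add: u p)
    then show ?thesis by (intro tendsto_intros r)
  qed
qed

lemma weighted_path_continuous_on:
  fixes f :: "real \<times> torus \<Rightarrow> real"
  assumes R: "R > 0" and f: "continuous_on ({0..T} \<times> UNIV) f" and z: "z \<in> mspace (path_metric R T)"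
  shows "continuous_on {0..T} (\<lambda>t. f (t, cone_x xbar (z t)) * (cone_r (z t))\<^sup>2)"
  unfolding continuous_on
proof
  fix t assume t: "t \<in> {0..T}"
  show "((\<lambda>s. f (s, cone_x xbar (z s)) * (cone_r (z s))\<^sup>2) \<longlongrightarrow> f (t, cone_x xbar (z t)) * (cone_r (z t))\<^sup>2) (at t within {0..T})"
    by (rule weighted_tendsto[OF R f tendsto_ident_at _ t path_tendsto[OF R z t]])
      (auto simp: eventually_at_topological intro!: exI[of _ UNIV])
qed

section \<open>The marginal functional on path space\<close>

lemma marginal_functional:
  fixes f :: "real \<times> torus \<Rightarrow> real"
  assumes R: "R > 0" and f: "continuous_on ({0..T} \<times> UNIV) f" and z: "z \<in> mspace (path_metric R T)"
  shows "set_integrable lborel {0..T} (\<lambda>t. f (t, cone_x xbar (z t)) * (cone_r (z t))\<^sup>2)"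
    and "(LINT t:{0..T}|lborel. f (t, cone_x xbar (z t)) * (cone_r (z t))\<^sup>2) =
      integral {0..T} (\<lambda>t. f (t, cone_x xbar (z t)) * (cone_r (z t))\<^sup>2)"
proof -
  show "set_integrable lborel {0..T} (\<lambda>t. f (t, cone_x xbar (z t)) * (cone_r (z t))\<^sup>2)"
    unfolding set_integrable_def
    by (rule borel_integrable_compact[OF compact_Icc weighted_path_continuous_on[OF assms]])
  then show "(LINT t:{0..T}|lborel. f (t, cone_x xbar (z t)) * (cone_r (z t))\<^sup>2) =
      integral {0..T} (\<lambda>t. f (t, cone_x xbar (z t)) * (cone_r (z t))\<^sup>2)"
    by (rule set_borel_integral_eq_integral)
qed

text \<open>The functional is continuous for the supremum distance, as tested on sequences: the
  integrands converge at each time by \<open>weighted_tendsto\<close> and are dominated by B *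
  (\<rho> + 1)^2, where \<rho> bounds the radius of the limit path and 1 the distance to it.\<close>

lemma marginal_functional_measurable:
  fixes f :: "real \<times> torus \<Rightarrow> real"
  assumes R: "R > 0" and f: "continuous_on ({0..T} \<times> UNIV) f"
  shows "(\<lambda>z. LINT t:{0..T}|lborel. f (t, cone_x xbar (z t)) * (cone_r (z t))\<^sup>2) \<in> borel_measurable (path_borel R T)"
proof (rule borel_measurable_continuous_map)
  define k where "k z t = f (t, cone_x xbar (z t)) * (cone_r (z t))\<^sup>2" for z t
  define \<Phi> where "\<Phi> z = (LINT t:{0..T}|lborel. k z t)" for z
  interpret P: Metric_space "mspace (path_metric R T)" "mdist (path_metric R T)"
    by (rule Metric_space_mspace_mdist)
  have int: "set_integrable lborel {0..T} (k z)" if "z \<in> mspace (path_metric R T)" for z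
    using marginal_functional(1)[OF R f that, of xbar] by (simp add: k_def[abs_def])
  obtain B where B: "0 \<le> B" "\<And>s x. s \<in> {0..T} \<Longrightarrow> \<bar>f (s, x)\<bar> \<le> B"
    using torus_fun_bounded[OF f] by blast
  have "\<exists>\<delta>>0. \<forall>w. w \<in> mspace (path_metric R T) \<and> mdist (path_metric R T) z w < \<delta> \<longrightarrow> dist (\<Phi> z) (\<Phi> w) < \<epsilon>"
    if z: "z \<in> mspace (path_metric R T)" and "\<epsilon> > 0" for z \<epsilon>
  proof (rule ccontr)
    assume "\<not> ?thesis"
    then have "\<forall>\<delta>>0. \<exists>w. w \<in> mspace (path_metric R T) \<and> mdist (path_metric R T) z w < \<delta> \<and> \<epsilon> \<le> dist (\<Phi> z) (\<Phi> w)"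
      by (force simp: not_less)
    then have "\<forall>n. \<exists>w. w \<in> mspace (path_metric R T) \<and> mdist (path_metric R T) z w < inverse (real (Suc n)) \<and> \<epsilon> \<le> dist (\<Phi> z) (\<Phi> w)"
      by simp
    from choice[OF this] obtain w where w: "\<And>n. w n \<in> mspace (path_metric R T)"
      "\<And>n. mdist (path_metric R T) z (w n) < inverse (real (Suc n))" "\<And>n. \<epsilon> \<le> dist (\<Phi> z) (\<Phi> (w n))" by blast
    have "compact ((\<lambda>t. cone_r (z t)) ` {0..T})"
      by (intro compact_continuous_image path_continuous_on_cone_r[OF R z]) auto
    from compact_imp_bounded[OF this] obtain \<rho> where \<rho>: "\<forall>y\<in>(\<lambda>t. cone_r (z t)) ` {0..T}. norm y \<le> \<rho>"
      unfolding bounded_iff by blast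
    have wd: "cone_dist R (w n t) (z t) \<le> inverse (real (Suc n))" if "t \<in> {0..T}" for n t
      using cone_dist_le_path_dist[OF R z w(1)[of n] that] w(2)[of n] by (simp add: cone_dist_commute)
    have "(\<lambda>n. \<Phi> (w n)) \<longlonglongrightarrow> \<Phi> z"
      unfolding \<Phi>_def set_lebesgue_integral_def
    proof (rule integral_dominated_convergence[where w="\<lambda>t. indicator {0..T} t * (B * (\<rho> + 1)\<^sup>2)"])
      show "integrable lborel (\<lambda>t. indicator {0..T} t * (B * (\<rho> + 1)\<^sup>2))"
        by (intro integrable_mult_left integrable_real_indicator) (auto simp: emeasure_lborel_Icc_eq)
      show "(\<lambda>t. indicator {0..T} t *\<^sub>R k z t) \<in> borel_measurable lborel"
        using int[OF z] unfolding set_integrable_def by (rule borel_measurable_integrable)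
      show "(\<lambda>t. indicator {0..T} t *\<^sub>R k (w n) t) \<in> borel_measurable lborel" for n
        using int[OF w(1)] unfolding set_integrable_def by (rule borel_measurable_integrable)
      show "AE t in lborel. (\<lambda>n. indicator {0..T} t *\<^sub>R k (w n) t) \<longlonglongrightarrow> indicator {0..T} t *\<^sub>R k z t"
      proof (rule AE_I2)
        fix t
        show "(\<lambda>n. indicator {0..T} t *\<^sub>R k (w n) t) \<longlonglongrightarrow> indicator {0..T} t *\<^sub>R k z t"
        proof (cases "t \<in> {0..T}")
          case True
          have "(\<lambda>n. cone_dist R (w n t) (z t)) \<longlonglongrightarrow> 0"
            by (rule Lim_null_comparison[OF _ LIMSEQ_inverse_real_of_nat]) (use wd[OF True] in simp)
          then have "(\<lambda>n. k (w n) t) \<longlonglongrightarrow> k z t"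
            unfolding k_def by (intro weighted_tendsto[OF R f]) (use True in auto)
          then show ?thesis by (intro tendsto_intros)
        qed simp
      qed
      show "AE t in lborel. norm (indicator {0..T} t *\<^sub>R k (w n) t) \<le> indicator {0..T} t * (B * (\<rho> + 1)\<^sup>2)" for n
      proof (rule AE_I2)
        fix t
        show "norm (indicator {0..T} t *\<^sub>R k (w n) t) \<le> indicator {0..T} t * (B * (\<rho> + 1)\<^sup>2)"
        proof (cases "t \<in> {0..T}")
          case True
          have "inverse (real (Suc n)) \<le> 1" by (simp add: inverse_le_1_iff)
          then have "cone_r (w n t) \<le> cone_r (z t) + 1"
            using cone_r_diff_le[of "w n t" "z t" R] wd[OF True, of n] by linarith
          also have "cone_r (z t) \<le> \<rho>" using \<rho> True by auto
          finally have "(cone_r (w n t))\<^sup>2 \<le> (\<rho> + 1)\<^sup>2" by (intro power_mono) auto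
          then have "\<bar>f (t, cone_x xbar (w n t))\<bar> * (cone_r (w n t))\<^sup>2 \<le> B * (\<rho> + 1)\<^sup>2"
            using B(1) B(2)[OF True] by (intro mult_mono) auto
          then show ?thesis using True by (simp add: k_def abs_mult)
        qed simp
      qed
    qed
    then obtain n where "dist (\<Phi> (w n)) (\<Phi> z) < \<epsilon>"
      using LIMSEQ_imp_Suc \<open>\<epsilon> > 0\<close> by (metis (no_types) lim_sequentially order_refl)
    with w(3)[of n] show False by (simp add: dist_commute)
  qed
  then have "continuous_map P.mtopology Met_TC.mtopology \<Phi>"
    by (subst P.metric_continuous_map[OF Met_TC.Metric_space_axioms]) simp
  then show "continuous_map (mtopology_of (path_metric R T)) euclideanreal
      (\<lambda>z. LINT t:{0..T}|lborel. f (t, cone_x xbar (z t)) * (cone_r (z t))\<^sup>2)"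
    by (simp add: mtopology_of_def \<Phi>_def[abs_def] k_def[abs_def])
qed

text \<open>Both families of paths in the plan lie on a straight line through the apex; \<open>g\<close> is the signed
  coordinate on that line.\<close>

lemma straight_path_in_AC2:
  assumes R: "R > 0" and T: "T > 0" and ext: "z \<in> extensional {0..T}"
    and d: "\<And>s t. s \<in> {0..T} \<Longrightarrow> t \<in> {0..T} \<Longrightarrow> cone_dist R (z s) (z t) = \<bar>g s - g t\<bar>"
    and g: "\<And>t. (g has_real_derivative g' t) (at t)" "\<And>t. \<bar>g' t\<bar> \<le> B"
  shows "z \<in> mspace (path_metric R T)" and "z \<in> AC2 R T"
proof -
  have cont: "((\<lambda>s. g s) \<longlongrightarrow> g t) (at t within {0..T})" for t
    using DERIV_isCont[OF g(1)[of t]] by (auto simp: isCont_def intro: tendsto_within_subset)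
  have ev: "\<forall>\<^sub>F s in at t within {0..T}. s \<in> {0..T} \<and> s \<noteq> t" for t
    by (auto simp: eventually_at_topological intro!: exI[of _ UNIV])
  have "((\<lambda>s. cone_dist R (z s) (z t)) \<longlongrightarrow> 0) (at t within {0..T})" if t: "t \<in> {0..T}" for t
  proof -
    have "((\<lambda>s. \<bar>g s - g t\<bar>) \<longlongrightarrow> \<bar>g t - g t\<bar>) (at t within {0..T})" by (intro tendsto_intros cont)
    moreover have "\<forall>\<^sub>F s in at t within {0..T}. \<bar>g s - g t\<bar> = cone_dist R (z s) (z t)"
      using ev by eventually_elim (use d[of _ t] t in auto)
    ultimately show ?thesis by (simp add: tendsto_cong)
  qed
  then show z: "z \<in> mspace (path_metric R T)"
    using ext by (simp add: path_space_iff[OF R] continuous_map_cone_iff[OF R])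
  have Lip: "\<bar>g s - g t\<bar> \<le> B * \<bar>s - t\<bar>" for s t
    using field_differentiable_bound[of UNIV g g' B s t] g by (simp add: has_field_derivative_at_within)
  have "abs_cont_path R T z"
    unfolding abs_cont_path_def
  proof (intro exI[of _ "\<lambda>_. B"] conjI allI impI)
    show "set_integrable lborel {0..T} (\<lambda>_. B)"
      by (simp add: set_integrable_def emeasure_lborel_Icc_eq)
    fix s t assume st: "0 \<le> s" "s \<le> t" "t \<le> T"
    then have "cone_dist R (z s) (z t) \<le> B * (t - s)" using Lip[of s t] by (simp add: d)
    then show "cone_dist R (z s) (z t) \<le> (LINT u:{s..t}|lborel. B)"
      using st by (simp add: set_lebesgue_integral_def mult.commute)
  qed
  moreover have "metric_deriv R T z t = \<bar>g' t\<bar>" if t: "t \<in> {0..T}" for t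
    unfolding metric_deriv_def
  proof (rule tendsto_Lim)
    show "at t within {0..T} \<noteq> bot" using t T by (simp add: trivial_limit_within)
    have "((\<lambda>s. (g s - g t) / (s - t)) \<longlongrightarrow> g' t) (at t within {0..T})"
      using has_field_derivative_at_within[OF g(1)[of t]] by (simp add: has_field_derivative_iff)
    then have "((\<lambda>s. \<bar>(g s - g t) / (s - t)\<bar>) \<longlongrightarrow> \<bar>g' t\<bar>) (at t within {0..T})" by (rule tendsto_rabs)
    moreover have "\<forall>\<^sub>F s in at t within {0..T}. \<bar>(g s - g t) / (s - t)\<bar> = cone_dist R (z s) (z t) / \<bar>s - t\<bar>"
      using ev by eventually_elim (use d[of _ t] t in \<open>auto simp: abs_divide\<close>)
    ultimately show "((\<lambda>s. cone_dist R (z s) (z t) / \<bar>s - t\<bar>) \<longlongrightarrow> \<bar>g' t\<bar>) (at t within {0..T})"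
      by (rule Lim_transform_eventually)
  qed
  then have "(metric_deriv R T z t)\<^sup>2 \<le> B\<^sup>2" if "t \<in> {0..T}" for t
    using that power_mono[OF g(2)[of t], of 2] by simp
  then have "(\<integral>\<^sup>+t\<in>{0..T}. ennreal ((metric_deriv R T z t)\<^sup>2) \<partial>lborel) \<le> (\<integral>\<^sup>+t\<in>{0..T}. ennreal (B\<^sup>2) \<partial>lborel)"
    by (intro nn_integral_mono) (simp add: indicator_def ennreal_leI)
  moreover have "(\<integral>\<^sup>+t\<in>{0..T}. ennreal (B\<^sup>2) \<partial>lborel) < \<infinity>"
    using T by (simp add: nn_integral_cmult_indicator ennreal_mult_less_top)
  ultimately show "z \<in> AC2 R T" using z by (auto simp: AC2_def intro: le_less_trans)
qed

text \<open>Where the radius is positive, the path moves along one ray with radius \<sigma> g, so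
  its speed is the absolute value of g'. At the apex \<open>speed2\<close> is 0, whatever g' may be;
  hence an inequality.\<close>

lemma straight_path_action_le:
  assumes R: "R > 0" and T: "T > 0" and ext: "z \<in> extensional {0..T}"
    and d: "\<And>s t. s \<in> {0..T} \<Longrightarrow> t \<in> {0..T} \<Longrightarrow> cone_dist R (z s) (z t) = \<bar>g s - g t\<bar>"
    and g: "\<And>t. (g has_real_derivative g' t) (at t)" "\<And>t. \<bar>g' t\<bar> \<le> B"
    and ray: "\<And>t. t \<in> {0..T} \<Longrightarrow> cone_r (z t) > 0 \<Longrightarrow> \<exists>\<sigma>\<in>{1, -1}. cone_r (z t) = \<sigma> * g t \<and>
      (\<forall>\<^sub>F s in at t within {0..T}. cone_r (z s) = \<sigma> * g s \<and> cone_x xbar (z s) = cone_x xbar (z t))"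
  shows "path_action R T xbar z \<le> (\<integral>\<^sup>+t\<in>{0..T}. ennreal ((g' t)\<^sup>2) \<partial>lborel)"
proof -
  have "speed2 R T xbar z t \<le> (g' t)\<^sup>2" if t: "t \<in> {0..T}" for t
  proof (cases "cone_r (z t) > 0")
    case False
    then show ?thesis by (simp add: speed2_def Let_def)
  next
    case True
    then obtain \<sigma> where \<sigma>: "\<sigma> \<in> {1, -1}" "cone_r (z t) = \<sigma> * g t"
      "\<forall>\<^sub>F s in at t within {0..T}. cone_r (z s) = \<sigma> * g s \<and> cone_x xbar (z s) = cone_x xbar (z t)"
      using ray[OF t] by blast
    obtain p where p: "cone_x xbar (z t) = torus_of p" by (rule torus_cases)
    have vel: "torus_has_velocity T (\<lambda>s. cone_x xbar (z s)) 0 t"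
      unfolding torus_has_velocity_def
      by (intro exI[of _ "\<lambda>s. p"]) (use \<sigma>(3) in \<open>auto simp: p elim: eventually_mono\<close>)
    have the: "(THE v. torus_has_velocity T (\<lambda>s. cone_x xbar (z s)) v t) = 0"
    proof (rule the_equality)
      show "v = 0" if "torus_has_velocity T (\<lambda>s. cone_x xbar (z s)) v t" for v
        by (rule torus_has_velocity_unique[OF T t that vel])
    qed (rule vel)
    have "((\<lambda>s. \<sigma> * g s) has_vector_derivative \<sigma> * g' t) (at t within {0..T})"
      using has_field_derivative_at_within[OF DERIV_cmult[OF g(1)]]
      by (simp add: has_real_derivative_iff_has_vector_derivative)
    moreover have "\<forall>\<^sub>F s in at t within {0..T}. \<sigma> * g s = cone_r (z s)"
      using \<sigma>(3) by (auto elim: eventually_mono)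
    ultimately have rd: "((\<lambda>s. cone_r (z s)) has_vector_derivative \<sigma> * g' t) (at t within {0..T})"
      unfolding has_vector_derivative_def
      using \<sigma>(2) t by (auto intro: has_derivative_transform_eventually)
    have "vector_derivative (\<lambda>s. cone_r (z s)) (at t within {0..T}) = \<sigma> * g' t"
      using vector_derivative_within_closed_interval[OF T t rd] .
    then have "speed2 R T xbar z t \<le> (\<sigma> * g' t)\<^sup>2"
      by (simp add: speed2_def Let_def the gnorm2_def)
    then show ?thesis using \<sigma>(1) by (auto simp: power_mult_distrib)
  qed
  then have "(\<integral>\<^sup>+t\<in>{0..T}. ennreal (speed2 R T xbar z t) \<partial>lborel) \<le> (\<integral>\<^sup>+t\<in>{0..T}. ennreal ((g' t)\<^sup>2) \<partial>lborel)"
    by (intro nn_integral_mono) (auto simp: indicator_def intro!: ennreal_leI)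
  then show ?thesis
    using straight_path_in_AC2(2)[OF R T ext d g] by (simp add: path_action_def)
qed

definition plan_path :: "real \<Rightarrow> (real \<Rightarrow> torus \<Rightarrow> torus) \<Rightarrow> (real \<Rightarrow> torus \<Rightarrow> real) \<Rightarrow> torus \<Rightarrow> real \<Rightarrow> cone" where
  "plan_path T \<phi> l x = (\<lambda>t\<in>{0..T}. cone_pt (\<phi> t x) (l t x))"

lemma push_plan_eq: "push_plan R T \<phi> l = distr rho0 (path_borel R T) (plan_path T \<phi> l)"
  by (simp add: push_plan_def plan_path_def[abs_def])

text \<open>At each time the map is a translation and the radius is independent of the point, so the
  supremum distance of two paths is at most a constant times the planar distance of their starting
  points.\<close>

lemma plan_path_measurable:
  assumes R: "R > 0" and T: "T > 0" and z: "\<And>x. plan_path T \<phi> l x \<in> mspace (path_metric R T)"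
    and l: "\<And>t x. t \<in> {0..T} \<Longrightarrow> l t x = \<rho> t" "\<And>t. t \<in> {0..T} \<Longrightarrow> 0 \<le> \<rho> t" "\<And>t. t \<in> {0..T} \<Longrightarrow> \<rho> t \<le> L"
    and \<phi>: "\<And>t. t \<in> {0..T} \<Longrightarrow> \<phi> t = torus_shift (a t)"
  shows "plan_path T \<phi> l \<in> measurable rho0 (path_borel R T)"
proof (rule measurable_rho0)
  have "0 \<le> L" using l(2,3)[of 0] T by force
  have "Lipschitz_continuous_map euclidean_metric (path_metric R T) (\<lambda>p. plan_path T \<phi> l (torus_of p))"
    unfolding Lipschitz_continuous_map_def
  proof (intro conjI exI ballI)
    fix p q :: "real^2"
    have "cone_dist R (plan_path T \<phi> l (torus_of p) t) (plan_path T \<phi> l (torus_of q) t) \<le> L * (1 + \<bar>R\<bar>) * dist p q"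
      if t: "t \<in> {0..T}" for t
    proof -
      have "cone_dist R (plan_path T \<phi> l (torus_of p) t) (plan_path T \<phi> l (torus_of q) t) =
          cone_dist R (cone_pt (torus_of (p + a t)) (\<rho> t)) (cone_pt (torus_of (q + a t)) (\<rho> t))"
        using t by (simp add: plan_path_def l(1)[OF t] \<phi>[OF t] torus_shift_torus_of)
      also have "\<dots> \<le> \<rho> t * torus_dist R (torus_of (p + a t)) (torus_of (q + a t))"
        by (rule cone_dist_same_r_le[OF l(2)[OF t]])
      also have "\<dots> \<le> L * ((1 + \<bar>R\<bar>) * dist (p + a t) (q + a t))"
        using l(2,3)[OF t] by (intro mult_mono torus_dist_torus_of_le) auto
      finally show ?thesis by (simp add: dist_norm mult.assoc)
    qed
    then show "mdist (path_metric R T) (plan_path T \<phi> l (torus_of p)) (plan_path T \<phi> l (torus_of q))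
        \<le> L * (1 + \<bar>R\<bar>) * mdist euclidean_metric p q"
      using R T \<open>0 \<le> L\<close> z[unfolded path_metric_def]
      unfolding path_metric_def by (subst cfunspace_mdist_le) auto
  qed (use z in auto)
  from Lipschitz_continuous_imp_continuous_map[OF this]
  show "continuous_map euclidean (mtopology_of (path_metric R T)) (\<lambda>p. plan_path T \<phi> l (torus_of p))" by simp
qed

lemma cone_dist_same_x:
  assumes "0 \<le> r" "0 \<le> s"
  shows "cone_dist R (cone_pt x r) (cone_pt x s) = \<bar>r - s\<bar>"
  by (rule power2_eq_imp_eq) (simp_all add: cone_dist_cone_pt_sq assms)

text \<open>The truncated angle is pi, so the law of cosines degenerates to the length of the two
  radial segments through the apex.\<close>

lemma cone_dist_antipodal:
  assumes "R > 0" "0 \<le> r" "0 \<le> s"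
  shows "cone_dist R (cone_pt x r) (cone_pt (half_turn x) s) = r + s"
proof (rule power2_eq_imp_eq)
  show "(cone_dist R (cone_pt x r) (cone_pt (half_turn x) s))\<^sup>2 = (r + s)\<^sup>2"
    using half_turn_far[OF assms(1), of x] assms
    by (simp add: cone_dist_cone_pt_sq, simp add: power2_eq_square algebra_simps)
qed (use assms in simp_all)

lemma psi1_eq: "psi1 T t = torus_shift (if t \<le> T / 2 then 0 else vec pi)"
  by (auto simp: psi1_def torus_shift_0 fun_eq_iff)

section \<open>The two families of paths, for fixed radius and time\<close>

context
  fixes R T :: real
  assumes R: "R > 0" and T: "T > 0"
begin

definition \<omega> where omega_def: "\<omega> = pi / T"

lemma omega: "0 < \<omega>" "\<omega> * T = pi"
  using T by (simp_all add: omega_def)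

lemma sqrt_Pstar: "sqrt (Pstar T) = \<omega>"
  using T by (simp add: Pstar_def omega_def)

lemma cos_first_half: "t \<in> {0..T} \<Longrightarrow> t \<le> T / 2 \<Longrightarrow> 0 \<le> cos (\<omega> * t)"
  using T by (intro cos_ge_zero) (auto simp: omega_def field_simps intro: order_trans[of _ 0])

lemma cos_first_half_pos: "t \<in> {0..T} \<Longrightarrow> t < T / 2 \<Longrightarrow> 0 < cos (\<omega> * t)"
  using T by (intro cos_gt_zero_pi) (auto simp: omega_def field_simps intro: less_le_trans[of _ 0])

lemma cos_reflect: "cos (\<omega> * (T - t)) = - cos (\<omega> * t)"
  by (simp add: right_diff_distrib omega cos_diff)

lemma cos_second_half: "t \<in> {0..T} \<Longrightarrow> T / 2 \<le> t \<Longrightarrow> cos (\<omega> * t) \<le> 0"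
  using cos_first_half[of "T - t"] by (simp add: cos_reflect)

lemma cos_second_half_neg: "t \<in> {0..T} \<Longrightarrow> T / 2 < t \<Longrightarrow> cos (\<omega> * t) < 0"
  using cos_first_half_pos[of "T - t"] by (simp add: cos_reflect)

lemma sin_nonneg: "t \<in> {0..T} \<Longrightarrow> 0 \<le> sin (\<omega> * t)"
  using T by (intro sin_ge_zero) (auto simp: omega_def field_simps)

definition "g0 t = sqrt 2 * sin (\<omega> * t)"
definition "g1 t = sqrt 2 * cos (\<omega> * t)"

abbreviation "path0 \<equiv> plan_path T (\<lambda>t. id) (zeta0 T)"
abbreviation "path1 \<equiv> plan_path T (psi1 T) (zeta1 T)"

lemma path0_eq: "t \<in> {0..T} \<Longrightarrow> path0 x t = cone_pt x (g0 t)"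
  by (simp add: plan_path_def zeta0_def g0_def sqrt_Pstar)

lemma path1_eq: "t \<in> {0..T} \<Longrightarrow> path1 x t = cone_pt (psi1 T t x) \<bar>g1 t\<bar>"
  by (simp add: plan_path_def zeta1_def g1_def sqrt_Pstar abs_mult)

lemma g0_nonneg: "t \<in> {0..T} \<Longrightarrow> 0 \<le> g0 t"
  unfolding g0_def by (intro mult_nonneg_nonneg sin_nonneg) simp_all

lemma g1_sign:
  "t \<in> {0..T} \<Longrightarrow> t \<le> T / 2 \<Longrightarrow> 0 \<le> g1 t" "t \<in> {0..T} \<Longrightarrow> T / 2 \<le> t \<Longrightarrow> g1 t \<le> 0"
  "t \<in> {0..T} \<Longrightarrow> t < T / 2 \<Longrightarrow> 0 < g1 t" "t \<in> {0..T} \<Longrightarrow> T / 2 < t \<Longrightarrow> g1 t < 0"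
  using cos_first_half[of t] cos_second_half[of t] cos_first_half_pos[of t] cos_second_half_neg[of t]
  by (simp_all add: g1_def mult_le_0_iff mult_less_0_iff del: atLeastAtMost_iff)

lemma g0_deriv: "(g0 has_real_derivative sqrt 2 * \<omega> * cos (\<omega> * t)) (at t)"
  unfolding g0_def[abs_def] by (auto intro!: derivative_eq_intros)

lemma g1_deriv: "(g1 has_real_derivative - (sqrt 2 * \<omega> * sin (\<omega> * t))) (at t)"
  unfolding g1_def[abs_def] by (auto intro!: derivative_eq_intros)

lemma g_deriv_bound:
  "\<bar>sqrt 2 * \<omega> * cos (\<omega> * t)\<bar> \<le> sqrt 2 * \<omega>"
  "\<bar>- (sqrt 2 * \<omega> * sin (\<omega> * t))\<bar> \<le> sqrt 2 * \<omega>"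
proof -
  have c: "0 \<le> sqrt 2 * \<omega>" using omega(1) by simp
  have "\<bar>sqrt 2 * \<omega>\<bar> * \<bar>cos (\<omega> * t)\<bar> \<le> \<bar>sqrt 2 * \<omega>\<bar> * 1"
    by (intro mult_left_mono abs_cos_le_one) simp
  then show "\<bar>sqrt 2 * \<omega> * cos (\<omega> * t)\<bar> \<le> sqrt 2 * \<omega>"
    using c by (simp only: abs_mult[of "sqrt 2 * \<omega>"] abs_of_nonneg[OF c] mult_1_right)
  have "\<bar>sqrt 2 * \<omega>\<bar> * \<bar>sin (\<omega> * t)\<bar> \<le> \<bar>sqrt 2 * \<omega>\<bar> * 1"
    by (intro mult_left_mono abs_sin_le_one) simp
  then show "\<bar>- (sqrt 2 * \<omega> * sin (\<omega> * t))\<bar> \<le> sqrt 2 * \<omega>"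
    using c by (simp only: abs_minus_cancel abs_mult[of "sqrt 2 * \<omega>"] abs_of_nonneg[OF c] mult_1_right)
qed

lemma path0_dist:
  assumes "s \<in> {0..T}" "t \<in> {0..T}"
  shows "cone_dist R (path0 x s) (path0 x t) = \<bar>g0 s - g0 t\<bar>"
  using assms by (simp add: path0_eq cone_dist_same_x g0_nonneg del: atLeastAtMost_iff)

lemma path1_dist:
  assumes s: "s \<in> {0..T}" and t: "t \<in> {0..T}"
  shows "cone_dist R (path1 x s) (path1 x t) = \<bar>g1 s - g1 t\<bar>"
proof -
  \<comment> \<open>Times on opposite sides of T / 2 give antipodal rays, and \<open>g1\<close>
    changes sign there, so the sum of the radii is the difference of the signed coordinates.\<close>
  have cross: "cone_dist R (path1 x s) (path1 x t) = \<bar>g1 s - g1 t\<bar>"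
    if st: "s \<in> {0..T}" "t \<in> {0..T}" "s \<le> T / 2" "\<not> t \<le> T / 2" for s t
  proof -
    have "cone_dist R (path1 x s) (path1 x t) = \<bar>g1 s\<bar> + \<bar>g1 t\<bar>"
      using st cone_dist_antipodal[OF R, of "\<bar>g1 s\<bar>" "\<bar>g1 t\<bar>" x]
      by (simp add: path1_eq psi1_def half_turn_def del: atLeastAtMost_iff)
    then show ?thesis using g1_sign(1)[of s] g1_sign(2)[of t] st by simp
  qed
  have same: "cone_dist R (path1 x s) (path1 x t) = \<bar>\<bar>g1 s\<bar> - \<bar>g1 t\<bar>\<bar>" if "(s \<le> T / 2) = (t \<le> T / 2)"
    using that s t by (simp add: path1_eq psi1_def cone_dist_same_x del: atLeastAtMost_iff)
  consider "s \<le> T / 2" "t \<le> T / 2" | "\<not> s \<le> T / 2" "\<not> t \<le> T / 2"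
    | "s \<le> T / 2" "\<not> t \<le> T / 2" | "\<not> s \<le> T / 2" "t \<le> T / 2" by blast
  then show ?thesis
  proof cases
    case 1
    then show ?thesis using same g1_sign(1)[OF s] g1_sign(1)[OF t] by simp
  next
    case 2
    then show ?thesis using same g1_sign(2)[OF s] g1_sign(2)[OF t] by simp
  next
    case 3
    then show ?thesis using cross s t by blast
  next
    case 4
    then show ?thesis using cross[OF t s] by (simp add: cone_dist_commute abs_minus_commute)
  qed
qed

lemma plan_path_extensional: "plan_path T \<phi> l x \<in> extensional {0..T}"
  by (simp add: plan_path_def)

lemma path0_mspace: "path0 x \<in> mspace (path_metric R T)"
  by (rule straight_path_in_AC2(1)[OF R T plan_path_extensional path0_dist g0_deriv g_deriv_bound(1)])

lemma path1_mspace: "path1 x \<in> mspace (path_metric R T)"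
  by (rule straight_path_in_AC2(1)[OF R T plan_path_extensional path1_dist g1_deriv g_deriv_bound(2)])

lemma path0_measurable: "path0 \<in> measurable rho0 (path_borel R T)"
proof (rule plan_path_measurable[OF R T path0_mspace, where \<rho>=g0 and L="sqrt 2" and a="\<lambda>_. 0"])
  fix t x assume "t \<in> {0..T}"
  then show "0 \<le> g0 t" by (rule g0_nonneg)
qed (simp_all add: zeta0_def g0_def sqrt_Pstar torus_shift_0)

lemma path1_measurable: "path1 \<in> measurable rho0 (path_borel R T)"
proof (rule plan_path_measurable[OF R T path1_mspace, where \<rho>="\<lambda>t. \<bar>g1 t\<bar>" and L="sqrt 2" and a="\<lambda>t. if t \<le> T / 2 then 0 else vec pi"])
  fix t show "\<bar>g1 t\<bar> \<le> sqrt 2" by (simp add: g1_def abs_mult)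
qed (simp_all add: zeta1_def g1_def sqrt_Pstar abs_mult psi1_eq)

lemma within_T: "\<forall>\<^sub>F s in at t within {0..T}. s \<in> {0..T}"
  by (auto simp: eventually_at_topological intro!: exI[of _ UNIV])

lemma within_open:
  assumes "open U" "t \<in> U"
  shows "\<forall>\<^sub>F s in at t within {0..T}. s \<in> U"
  using assms by (auto simp: eventually_at_topological)

lemma path0_action: "path_action R T xbar (path0 x) \<le> ennreal (pi\<^sup>2 / T)"
proof -
  have "path_action R T xbar (path0 x) \<le> (\<integral>\<^sup>+t\<in>{0..T}. ennreal ((sqrt 2 * \<omega> * cos (\<omega> * t))\<^sup>2) \<partial>lborel)"
  proof (rule straight_path_action_le[OF R T plan_path_extensional path0_dist g0_deriv g_deriv_bound(1)])
    fix t assume t: "t \<in> {0..T}" and pos: "cone_r (path0 x t) > 0"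
    have gt: "0 < g0 t" using pos t by (simp add: path0_eq g0_nonneg del: atLeastAtMost_iff)
    have "open (g0 -` {0<..})"
      by (rule open_vimage) (auto simp: g0_def[abs_def] intro!: continuous_intros)
    from within_open[OF this, of t] gt have "\<forall>\<^sub>F s in at t within {0..T}. 0 < g0 s" by simp
    with within_T[of t] have "\<forall>\<^sub>F s in at t within {0..T}. cone_r (path0 x s) = 1 * g0 s \<and> cone_x xbar (path0 x s) = cone_x xbar (path0 x t)"
      by eventually_elim (use t gt in \<open>simp add: path0_eq del: atLeastAtMost_iff\<close>)
    then show "\<exists>\<sigma>\<in>{1, -1}. cone_r (path0 x t) = \<sigma> * g0 t \<and>
        (\<forall>\<^sub>F s in at t within {0..T}. cone_r (path0 x s) = \<sigma> * g0 s \<and> cone_x xbar (path0 x s) = cone_x xbar (path0 x t))"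
      using t gt by (intro bexI[of _ 1]) (simp_all add: path0_eq del: atLeastAtMost_iff)
  qed
  \<comment> \<open>The integrand is 2 \<omega>^2 cos^2. The product term of its antiderivative
    vanishes at both ends because \<omega> * T = pi, which leaves \<omega>^2 * T = pi^2 / T.\<close>
  also have "\<dots> = ennreal ((\<omega>\<^sup>2 * T + \<omega> * (sin (\<omega> * T) * cos (\<omega> * T))) - (\<omega>\<^sup>2 * 0 + \<omega> * (sin (\<omega> * 0) * cos (\<omega> * 0))))"
  proof (rule nn_integral_FTC_Icc)
    fix t
    have sin: "(sin (\<omega> * t))\<^sup>2 = 1 - (cos (\<omega> * t))\<^sup>2" by (rule sin_squared_eq)
    have "((\<lambda>t. \<omega>\<^sup>2 * t + \<omega> * (sin (\<omega> * t) * cos (\<omega> * t))) has_real_derivative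
        \<omega>\<^sup>2 + \<omega> * (\<omega> * cos (\<omega> * t) * cos (\<omega> * t) - \<omega> * sin (\<omega> * t) * sin (\<omega> * t))) (at t)"
      by (auto intro!: derivative_eq_intros)
    moreover have "\<omega>\<^sup>2 + \<omega> * (\<omega> * cos (\<omega> * t) * cos (\<omega> * t) - \<omega> * sin (\<omega> * t) * sin (\<omega> * t))
        = \<omega>\<^sup>2 * (1 + (cos (\<omega> * t))\<^sup>2 - (sin (\<omega> * t))\<^sup>2)"
      by (simp add: power2_eq_square algebra_simps)
    moreover have "\<dots> = (sqrt 2 * \<omega> * cos (\<omega> * t))\<^sup>2"
      unfolding sin by (simp add: power_mult_distrib)
    ultimately show "((\<lambda>t. \<omega>\<^sup>2 * t + \<omega> * (sin (\<omega> * t) * cos (\<omega> * t))) has_real_derivative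
        (sqrt 2 * \<omega> * cos (\<omega> * t))\<^sup>2) (at t)" by simp
  qed (use T in simp_all)
  also have "\<dots> = ennreal (pi\<^sup>2 / T)"
    using T by (simp add: omega) (simp add: omega_def power2_eq_square)
  finally show ?thesis .
qed

lemma path1_action: "path_action R T xbar (path1 x) \<le> ennreal (pi\<^sup>2 / T)"
proof -
  have "path_action R T xbar (path1 x) \<le> (\<integral>\<^sup>+t\<in>{0..T}. ennreal ((- (sqrt 2 * \<omega> * sin (\<omega> * t)))\<^sup>2) \<partial>lborel)"
  proof (rule straight_path_action_le[OF R T plan_path_extensional path1_dist g1_deriv g_deriv_bound(2)])
    fix t assume t: "t \<in> {0..T}" and pos: "cone_r (path1 x t) > 0"
    have gt: "g1 t \<noteq> 0" using pos t by (auto simp: path1_eq simp del: atLeastAtMost_iff)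
    \<comment> \<open>The base point jumps at T / 2, where the radius vanishes; a positive radius
      thus leaves a neighbourhood on which the base point is constant.\<close>
    then have "t \<noteq> T / 2" using g1_sign(1,2)[OF t] by force
    then consider "t < T / 2" | "T / 2 < t" by linarith
    then show "\<exists>\<sigma>\<in>{1, -1}. cone_r (path1 x t) = \<sigma> * g1 t \<and>
        (\<forall>\<^sub>F s in at t within {0..T}. cone_r (path1 x s) = \<sigma> * g1 s \<and> cone_x xbar (path1 x s) = cone_x xbar (path1 x t))"
    proof cases
      case 1
      have "\<forall>\<^sub>F s in at t within {0..T}. s \<in> {..<T / 2}" by (rule within_open) (use 1 in auto)
      with within_T[of t] have "\<forall>\<^sub>F s in at t within {0..T}. cone_r (path1 x s) = 1 * g1 s \<and> cone_x xbar (path1 x s) = cone_x xbar (path1 x t)"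
      proof eventually_elim
        case (elim s)
        then show ?case
          using g1_sign(3)[OF t 1] g1_sign(3)[of s] t 1
          by (simp add: path1_eq psi1_def del: atLeastAtMost_iff)
      qed
      then show ?thesis
        using t g1_sign(3)[OF t 1] by (intro bexI[of _ 1]) (simp_all add: path1_eq del: atLeastAtMost_iff)
    next
      case 2
      have "\<forall>\<^sub>F s in at t within {0..T}. s \<in> {T / 2<..}" by (rule within_open) (use 2 in auto)
      with within_T[of t] have "\<forall>\<^sub>F s in at t within {0..T}. cone_r (path1 x s) = - 1 * g1 s \<and> cone_x xbar (path1 x s) = cone_x xbar (path1 x t)"
      proof eventually_elim
        case (elim s)
        then show ?case
          using g1_sign(4)[OF t 2] g1_sign(4)[of s] t 2
          by (simp add: path1_eq psi1_def del: atLeastAtMost_iff)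
      qed
      then show ?thesis
        using t g1_sign(4)[OF t 2] by (intro bexI[of _ "- 1"]) (simp_all add: path1_eq del: atLeastAtMost_iff)
    qed
  qed
  also have "\<dots> = ennreal ((\<omega>\<^sup>2 * T - \<omega> * (sin (\<omega> * T) * cos (\<omega> * T))) - (\<omega>\<^sup>2 * 0 - \<omega> * (sin (\<omega> * 0) * cos (\<omega> * 0))))"
  proof (rule nn_integral_FTC_Icc)
    fix t
    have cos: "(cos (\<omega> * t))\<^sup>2 = 1 - (sin (\<omega> * t))\<^sup>2" by (rule cos_squared_eq)
    have "((\<lambda>t. \<omega>\<^sup>2 * t - \<omega> * (sin (\<omega> * t) * cos (\<omega> * t))) has_real_derivative
        \<omega>\<^sup>2 - \<omega> * (\<omega> * cos (\<omega> * t) * cos (\<omega> * t) - \<omega> * sin (\<omega> * t) * sin (\<omega> * t))) (at t)"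
      by (auto intro!: derivative_eq_intros)
    moreover have "\<omega>\<^sup>2 - \<omega> * (\<omega> * cos (\<omega> * t) * cos (\<omega> * t) - \<omega> * sin (\<omega> * t) * sin (\<omega> * t))
        = \<omega>\<^sup>2 * (1 - (cos (\<omega> * t))\<^sup>2 + (sin (\<omega> * t))\<^sup>2)"
      by (simp add: power2_eq_square algebra_simps)
    moreover have "\<dots> = (- (sqrt 2 * \<omega> * sin (\<omega> * t)))\<^sup>2"
      unfolding cos by (simp add: power_mult_distrib)
    ultimately show "((\<lambda>t. \<omega>\<^sup>2 * t - \<omega> * (sin (\<omega> * t) * cos (\<omega> * t))) has_real_derivative
        (- (sqrt 2 * \<omega> * sin (\<omega> * t)))\<^sup>2) (at t)" by simp
  qed (use T in simp_all)
  also have "\<dots> = ennreal (pi\<^sup>2 / T)"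
    using T by (simp add: omega) (simp add: omega_def power2_eq_square)
  finally show ?thesis .
qed

section \<open>Admissibility and optimality of the explicit plan\<close>

lemma mu_star_eq: "mu_star R T = half_sum (distr rho0 (path_borel R T) path0) (distr rho0 (path_borel R T) path1)"
  by (simp add: mu_star_def push_plan_eq)

lemma plan_action_mu_star_le: "plan_action R T xbar (mu_star R T) \<le> ennreal (pi\<^sup>2 / T)"
  unfolding plan_action_def mu_star_eq
  by (rule nn_integral_half_sum_distr_le[OF prob_space_rho0 path0_measurable path1_measurable])
    (rule path0_action path1_action)+

lemma prob_space_mu_star: "prob_space (mu_star R T)"
proof (rule prob_spaceI)
  interpret P0: prob_space "distr rho0 (path_borel R T) path0"
    by (rule prob_space.prob_space_distr[OF prob_space_rho0 path0_measurable])
  interpret P1: prob_space "distr rho0 (path_borel R T) path1"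
    by (rule prob_space.prob_space_distr[OF prob_space_rho0 path1_measurable])
  show "emeasure (mu_star R T) (space (mu_star R T)) = 1"
    unfolding mu_star_eq using P0.emeasure_space_1 P1.emeasure_space_1 sets.top[of "path_borel R T"]
    by (subst emeasure_half_sum) (simp_all add: ennreal_add_halves)
qed

lemma integral_mu_star:
  fixes h :: "(real \<Rightarrow> cone) \<Rightarrow> real"
  assumes h: "h \<in> borel_measurable (path_borel R T)"
    and i: "integrable rho0 (\<lambda>x. h (path0 x))" "integrable rho0 (\<lambda>x. h (path1 x))"
  shows "integrable (mu_star R T) h"
    and "(LINT z|mu_star R T. h z) = ((LINT x|rho0. h (path0 x)) + (LINT x|rho0. h (path1 x))) / 2"
proof -
  have i': "integrable (distr rho0 (path_borel R T) path0) h" "integrable (distr rho0 (path_borel R T) path1) h"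
    using i h by (simp_all add: integrable_distr_eq path0_measurable path1_measurable)
  show "integrable (mu_star R T) h"
    unfolding mu_star_eq by (rule integral_half_sum(1)[OF _ i']) simp
  have "(LINT z|mu_star R T. h z) = ((LINT z|distr rho0 (path_borel R T) path0. h z) + (LINT z|distr rho0 (path_borel R T) path1. h z)) / 2"
    unfolding mu_star_eq by (rule integral_half_sum(2)[OF _ i']) simp
  then show "(LINT z|mu_star R T. h z) = ((LINT x|rho0. h (path0 x)) + (LINT x|rho0. h (path1 x))) / 2"
    by (simp add: integral_distr[OF path0_measurable h] integral_distr[OF path1_measurable h])
qed

lemma continuous_map_eval:
  assumes "t \<in> {0..T}"
  shows "continuous_map (mtopology_of (path_metric R T)) (cone_top R) (\<lambda>z. z t)"
proof (rule Lipschitz_continuous_imp_continuous_map)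
  show "Lipschitz_continuous_map (path_metric R T) (cone_metric R) (\<lambda>z. z t)"
    unfolding Lipschitz_continuous_map_def using R cone_dist_le_path_dist[OF R _ _ assms]
    by (auto intro!: exI[of _ 1])
qed

text \<open>The first family starts and ends at the apex, where 2-homogeneous functions vanish. The
  second has radius sqrt 2 at both ends, and the resulting factor 2 cancels against the weight 1 /
  2.\<close>

lemma mu_star_coupling: "coupling_constraint R T (coupling_of R half_turn) (mu_star R T)"
  unfolding coupling_constraint_def
proof (intro allI impI)
  fix f :: "cone \<times> cone \<Rightarrow> real"
  assume "continuous_map (prod_topology (cone_top R) (cone_top R)) euclideanreal f \<and> two_homogeneous f"
  then have c: "continuous_map (prod_topology (cone_top R) (cone_top R)) euclideanreal f" and h: "two_homogeneous f" by auto
  have hom: "f (cone_pt x1 (l * r1), cone_pt x2 (l * r2)) = l\<^sup>2 * f (cone_pt x1 r1, cone_pt x2 r2)"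
    if "0 \<le> r1" "0 \<le> r2" "0 < l" for x1 r1 x2 r2 l
    using h that unfolding two_homogeneous_def by blast
  have T0: "0 \<in> {0..T}" and TT: "T \<in> {0..T}" using T by auto
  have m: "(\<lambda>z. f (z 0, z T)) \<in> borel_measurable (path_borel R T)"
    using continuous_map_compose[OF continuous_map_pairedI[OF continuous_map_eval[OF T0] continuous_map_eval[OF TT]] c]
    by (intro borel_measurable_continuous_map) (simp add: o_def)
  \<comment> \<open>At the pair of apexes, homogeneity with factor 2 reads f = 4 f.\<close>
  have f0: "f (path0 x 0, path0 x T) = 0" for x
    using hom[of 0 0 2 x x] T by (simp add: path0_eq[OF T0] path0_eq[OF TT] g0_def omega)
  have f1: "f (path1 x 0, path1 x T) = 2 * f (cone_pt x 1, cone_pt (half_turn x) 1)" for x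
    using hom[of 1 1 "sqrt 2" x "half_turn x"] T
    by (simp add: path1_eq[OF T0] path1_eq[OF TT] g1_def psi1_def half_turn_def omega)
  have "integrable rho0 (\<lambda>x. f (cone_pt x 1, cone_pt (half_turn x) 1))"
  proof (rule integrable_rho0(1))
    have "continuous_map euclidean (prod_topology (cone_top R) (cone_top R))
        (\<lambda>p. (cone_pt (torus_of (p + 0)) 1, cone_pt (torus_of (p + vec pi)) 1))"
      unfolding continuous_map_paired by (intro conjI continuous_map_cone_pt R) simp_all
    from continuous_map_compose[OF this c]
    show "continuous_on UNIV (\<lambda>p. f (cone_pt (torus_of p) 1, cone_pt (half_turn (torus_of p)) 1))"
      by (simp add: o_def half_turn_def torus_shift_torus_of flip: continuous_map_iff_continuous2)
  qed
  then have "integrable rho0 (\<lambda>x. f (path0 x 0, path0 x T))" "integrable rho0 (\<lambda>x. f (path1 x 0, path1 x T))"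
    by (simp_all add: f0 f1)
  from integral_mu_star[OF m this]
  show "integrable (mu_star R T) (\<lambda>z. f (z 0, z T)) \<and>
      (LINT z|mu_star R T. f (z 0, z T)) = (LINT w|coupling_of R half_turn. f w)"
    by (simp add: f0 f1 integral_coupling[OF R c])
qed

text \<open>At every time the squared radii 2 sin^2 and 2 cos^2 add up to 2, so the two halves
  together have weight 1. Over the second half of the time interval, invariance of
  \<open>rho0\<close> undoes the half-turn.\<close>

lemma mu_star_marginal: "marginal_constraint T xbar (mu_star R T)"
  unfolding marginal_constraint_def
proof (intro allI impI)
  fix f :: "real \<times> torus \<Rightarrow> real"
  assume f: "continuous_on ({0..T} \<times> UNIV) f"
  define h where "h z = (LINT t:{0..T}|lborel. f (t, cone_x xbar (z t)) * (cone_r (z t))\<^sup>2)" for z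
  define A where "A a b c x = integral {a..b} (\<lambda>t. f (t, x) * c t)" for a b x and c :: "real \<Rightarrow> real"
  have fx: "continuous_on {a..b} (\<lambda>t. f (t, x))" if "{a..b} \<subseteq> {0..T}" for a b x
    by (rule continuous_on_compose2[OF f]) (use that in \<open>auto intro!: continuous_intros\<close>)
  have A_int: "integrable rho0 (A a b c)" and A_borel: "A a b c \<in> borel_measurable borel"
    if ab: "{a..b} \<subseteq> {0..T}" and c: "continuous_on {a..b} c" for a b c
  proof -
    have "continuous_on (UNIV \<times> cbox a b) (\<lambda>(p, t). f (t, torus_of p) * c t)"
      unfolding split_def
    proof (intro continuous_on_mult)
      show "continuous_on (UNIV \<times> cbox a b) (\<lambda>w. f (snd w, torus_of (fst w)))"
        by (rule continuous_on_compose2[OF f]) (use ab in \<open>auto intro!: continuous_intros\<close>)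
      show "continuous_on (UNIV \<times> cbox a b) (\<lambda>w. c (snd w))"
        by (rule continuous_on_compose2[OF c]) (auto intro!: continuous_intros)
    qed
    from integral_continuous_on_param[OF this]
    have "continuous_on UNIV (\<lambda>p. A a b c (torus_of p))" by (simp add: A_def)
    then show "integrable rho0 (A a b c)" "A a b c \<in> borel_measurable borel" by (rule integrable_rho0)+
  qed
  define c0 where "c0 t = (g0 t)\<^sup>2" for t
  define c1 where "c1 t = (g1 t)\<^sup>2" for t
  have cc: "continuous_on S c0" "continuous_on S c1" for S
    unfolding c0_def c1_def g0_def g1_def by (intro continuous_intros)+
  have sum: "c0 t + c1 t = 2" for t
    by (simp add: c0_def c1_def g0_def g1_def power_mult_distrib flip: distrib_left)
  have sub: "{0..T / 2} \<subseteq> {0..T}" "{T / 2..T} \<subseteq> {0..T}" using T by auto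
  have h0: "h (path0 x) = A 0 T c0 x" for x
    unfolding h_def marginal_functional(2)[OF R f path0_mspace] A_def
  proof (rule Henstock_Kurzweil_Integration.integral_cong)
    fix t assume t: "t \<in> {0..T}"
    then show "f (t, cone_x xbar (path0 x t)) * (cone_r (path0 x t))\<^sup>2 = f (t, x) * c0 t"
      using g0_nonneg[OF t] by (cases "g0 t = 0") (simp_all add: path0_eq c0_def del: atLeastAtMost_iff)
  qed
  have h1: "h (path1 x) = A 0 (T / 2) c1 x + A (T / 2) T c1 (half_turn x)" for x
  proof -
    let ?k = "\<lambda>t. f (t, cone_x xbar (path1 x t)) * (cone_r (path1 x t))\<^sup>2"
    have k: "?k t = f (t, psi1 T t x) * c1 t" if "t \<in> {0..T}" for t
      using that by (cases "g1 t = 0") (simp_all add: path1_eq c1_def del: atLeastAtMost_iff)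
    have "?k integrable_on {0..T}"
      by (rule integrable_continuous_real[OF weighted_path_continuous_on[OF R f path1_mspace]])
    then have "h (path1 x) = integral {0..T / 2} ?k + integral {T / 2..T} ?k"
      unfolding h_def marginal_functional(2)[OF R f path1_mspace]
      using T by (intro Henstock_Kurzweil_Integration.integral_combine[symmetric]) auto
    also have "integral {0..T / 2} ?k = A 0 (T / 2) c1 x"
      unfolding A_def
    proof (rule Henstock_Kurzweil_Integration.integral_cong)
      fix t assume "t \<in> {0..T / 2}"
      then show "?k t = f (t, x) * c1 t" using k[of t] sub(1) by (simp add: psi1_def)
    qed
    also have "integral {T / 2..T} ?k = A (T / 2) T c1 (half_turn x)"
      unfolding A_def
    proof (rule Henstock_Kurzweil_Integration.integral_cong)
      fix t assume t: "t \<in> {T / 2..T}"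
      then have t': "t \<in> {0..T}" using sub(2) by blast
      show "?k t = f (t, half_turn x) * c1 t"
      proof (cases "t = T / 2")
        \<comment> \<open>At T / 2 the map \<open>psi1\<close> is still the identity, not the
          half-turn, but the weight \<open>c1\<close> is 0 there.\<close>
        case True
        then have "c1 t = 0" using g1_sign(1,2)[OF t'] by (simp add: c1_def)
        then show ?thesis using k[OF t'] by simp
      next
        case False
        then show ?thesis using k[OF t'] t by (simp add: psi1_def half_turn_def)
      qed
    qed
    finally show ?thesis .
  qed
  note int0 = A_int[OF order_refl cc(1)] and int1 = A_int[OF sub(1) cc(2)] and int2 = A_int[OF sub(2) cc(2)]
  have int2': "integrable rho0 (\<lambda>x. A (T / 2) T c1 (half_turn x))"
  proof -
    have m: "half_turn \<in> measurable rho0 borel" by (simp add: measurable_rho0_iff)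
    have "integrable (distr rho0 borel half_turn) (A (T / 2) T c1)" using int2 by (simp add: distr_rho0_half_turn)
    then show ?thesis by (subst (asm) integrable_distr_eq[OF m A_borel[OF sub(2) cc(2)]])
  qed
  have total: "A 0 T c0 x + (A 0 (T / 2) c1 x + A (T / 2) T c1 x) = 2 * (LINT t:{0..T}|lborel. f (t, x))" for x
  proof -
    have i: "(\<lambda>t. f (t, x) * c t) integrable_on {0..T}" if "continuous_on {0..T} c" for c
      by (intro integrable_continuous_real continuous_on_mult fx that) simp
    have "A 0 (T / 2) c1 x + A (T / 2) T c1 x = A 0 T c1 x"
      unfolding A_def using T by (intro Henstock_Kurzweil_Integration.integral_combine i cc) auto
    then have "A 0 T c0 x + (A 0 (T / 2) c1 x + A (T / 2) T c1 x) = integral {0..T} (\<lambda>t. f (t, x) * c0 t + f (t, x) * c1 t)"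
      unfolding A_def by (simp add: Henstock_Kurzweil_Integration.integral_add i cc)
    also have "\<dots> = integral {0..T} (\<lambda>t. f (t, x) * 2)" by (simp add: sum flip: distrib_left)
    also have "\<dots> = 2 * integral {0..T} (\<lambda>t. f (t, x))" by simp
    also have "integral {0..T} (\<lambda>t. f (t, x)) = (LINT t:{0..T}|lborel. f (t, x))"
    proof (rule set_borel_integral_eq_integral(2)[symmetric])
      show "set_integrable lborel {0..T} (\<lambda>t. f (t, x))"
        unfolding set_integrable_def by (rule borel_integrable_compact[OF compact_Icc fx]) simp
    qed
    finally show ?thesis .
  qed
  have m: "h \<in> borel_measurable (path_borel R T)"
    unfolding h_def[abs_def] by (rule marginal_functional_measurable[OF R f])
  have i: "integrable rho0 (\<lambda>x. h (path0 x))" "integrable rho0 (\<lambda>x. h (path1 x))"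
    unfolding h0 h1 using int0 int1 int2' by simp_all
  have "(LINT z|mu_star R T. h z) = ((LINT x|rho0. A 0 T c0 x) + ((LINT x|rho0. A 0 (T / 2) c1 x) + (LINT x|rho0. A (T / 2) T c1 x))) / 2"
    unfolding integral_mu_star(2)[OF m i] h0 h1
    using int1 int2' by (simp add: integral_rho0_half_turn[OF A_borel[OF sub(2) cc(2)]])
  also have "\<dots> = (LINT x|rho0. A 0 T c0 x + (A 0 (T / 2) c1 x + A (T / 2) T c1 x)) / 2"
    using int0 int1 int2 by simp
  also have "\<dots> = (LINT x|rho0. (LINT t:{0..T}|lborel. f (t, x)))" unfolding total by simp
  finally show "integrable (mu_star R T) (\<lambda>z. LINT t:{0..T}|lborel. f (t, cone_x xbar (z t)) * (cone_r (z t))\<^sup>2) \<and>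
      (LINT z|mu_star R T. (LINT t:{0..T}|lborel. f (t, cone_x xbar (z t)) * (cone_r (z t))\<^sup>2))
        = (LINT x|rho0. (LINT t:{0..T}|lborel. f (t, x)))"
    using integral_mu_star(1)[OF m i] by (simp add: h_def)
qed

lemma mu_star_admissible: "mu_star R T \<in> admissible_plans R T xbar (coupling_of R half_turn)"
  using prob_space_mu_star mu_star_coupling mu_star_marginal
  by (simp add: admissible_plans_def dynamic_plans_def mu_star_eq)

lemma mu_star_is_minimizer: "is_minimizer R T xbar (coupling_of R half_turn) (mu_star R T)"
  unfolding is_minimizer_def
  using mu_star_admissible order_trans[OF plan_action_mu_star_le plan_action_ge[OF R T]] by blast

text \<open>A minimizer would cost no more than the explicit plan, whose action is at most pi^2 /
  T.\<close>

lemma flow_plan_not_minimizer: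
  assumes "\<phi> 0 = id" "\<phi> T = half_turn" "\<And>t x. t \<in> {0..T} \<Longrightarrow> torus_Jac (\<phi> t) x \<noteq> 0"
  shows "\<not> is_minimizer R T xbar (coupling_of R half_turn) (flow_plan R T \<phi>)"
proof
  assume "is_minimizer R T xbar (coupling_of R half_turn) (flow_plan R T \<phi>)"
  then have adm: "flow_plan R T \<phi> \<in> admissible_plans R T xbar (coupling_of R half_turn)"
    and "plan_action R T xbar (flow_plan R T \<phi>) \<le> plan_action R T xbar (mu_star R T)"
    using mu_star_admissible by (auto simp: is_minimizer_def)
  with flow_plan_action_gt[OF R T adm assms] plan_action_mu_star_le[of xbar] show False by simp
qed

end

theorem theorem7p11:
  fixes T :: real and xbar :: torus
  assumes "T > 0"
  shows "(\<forall>R>0.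
            coupling_of R half_turn \<in> P2_cone2 R \<and>
            is_minimizer R T xbar (coupling_of R half_turn) (mu_star R T) \<and>
            \<not> is_minimizer R T xbar (coupling_of R half_turn) (flow_plan R T (rotation T))) \<and>
         (\<exists>R0>0. \<forall>R\<ge>R0.
            \<not> (\<exists>\<phi>. smooth_Diff_curve T \<phi> \<and> \<phi> 0 = id \<and> \<phi> T = half_turn \<and>
                  is_minimizer R T xbar (coupling_of R half_turn) (flow_plan R T \<phi>)))"
\<comment> \<open>The threshold R0 is taken to be 1, from which the second part obtains R >
  0.\<close>
proof (intro conjI allI impI exI[of _ 1])
  fix R :: real assume R: "R > 0"
  show "coupling_of R half_turn \<in> P2_cone2 R" by (rule coupling_in_P2[OF R])
  show "is_minimizer R T xbar (coupling_of R half_turn) (mu_star R T)" by (rule mu_star_is_minimizer[OF R assms])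
  \<comment> \<open>Brings the rotation at time 0 into the form of \<open>torus_shift_0\<close>. At
    time T it is the half-turn, and its Jacobian is 1 throughout.\<close>
  have "(vec 0 :: real^2) = 0" by (simp add: vec_eq_iff)
  then show "\<not> is_minimizer R T xbar (coupling_of R half_turn) (flow_plan R T (rotation T))"
    using assms by (intro flow_plan_not_minimizer R) (simp_all add: rotation_def half_turn_def torus_shift_0)
next
  fix R :: real assume "R \<ge> 1"
  then have R: "R > 0" by simp
  show "\<not> (\<exists>\<phi>. smooth_Diff_curve T \<phi> \<and> \<phi> 0 = id \<and> \<phi> T = half_turn \<and>
      is_minimizer R T xbar (coupling_of R half_turn) (flow_plan R T \<phi>))"
    using flow_plan_not_minimizer[OF R assms] torus_Jac_Diff_nonzero
    unfolding smooth_Diff_curve_def by blast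
qed simp

end
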